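(* Let $m\ge 1$ and let $(X_j,d_j,\mu_j)$, $0\le j\le m$, be metric measure spaces satisfying the standing assumptions (i) and (ii) of the context. For each $z\in\overline{\mathbf S}$ let $T_z$ be an $m$-linear operator defined on $\mathcal C_c(X_1)\times\cdots\times\mathcal C_c(X_m)$ with values in $L^1_{\mathrm{loc}}(X_0)$, and suppose that $\{T_z\}_{z\in\overline{\mathbf S}}$ is an analytic family of admissible growth. For $\kappa\in\{1,\dots,m\}$ let $0<p_0^\kappa,p_1^\kappa\le\infty$, let $0<q_0,q_1\le\infty$, fix $0<\theta<1$, and define $p^\kappa$ and $q$ by $$\frac1{p^\kappa}=\frac{1-\theta}{p_0^\kappa}+\frac{\theta}{p_1^\kappa},\qquad \frac1q=\frac{1-\theta}{q_0}+\frac{\theta}{q_1}.$$ Suppose that for all $(f^1,\dots,f^m)\in\mathcal C_c(X_1)\times\cdots\times\mathcal C_c(X_m)$ and all $y\in\mathbb R$ we have $$\big\|T_{iy}(f^1,\dots,f^m)\big\|_{L^{q_0}(X_0)}\le B_0M_0(y)\prod_{\kappa=1}^m\|f^\kappa\|_{L^{p_0^\kappa}(X_\kappa)},$$ $$\big\|T_{1+iy}(f^1,\dots,f^m)\big\|_{L^{q_1}(X_0)}\le B_1M_1(y)\prod_{\kappa=1}^m\|f^\kappa\|_{L^{p_1^\kappa}(X_\kappa)},$$ where $B_0,B_1>0$ and $M_0,M_1$ are nonnegative continuous functions on the real line satisfying, for all $y\in\mathbb R$, $$M_0(y)\le e^{c\,e^{\tau|y|}},\qquad M_1(y)\le e^{c\,e^{\tau|y|}}$$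 for some $c,\tau\ge0$ with $\tau<\pi$. Then for all $f^j\in\mathcal C_c(X_j)$, $1\le j\le m$, we have $$\big\|T_\theta(f^1,\dots,f^m)\big\|_{L^q(X_0)}\le B_0^{1-\theta}B_1^{\theta}\,M(\theta)\prod_{\kappa=1}^m\|f^\kappa\|_{L^{p^\kappa}(X_\kappa)},$$ where $$M(\theta)=\exp\bigg\{\int_{-\infty}^{\infty}\Big[\Omega(1-\theta,y)\log M_0(y)+\Omega(\theta,y)\log M_1(y)\Big]\,dy\bigg\}.$$
   Context: Standing assumptions on a metric measure space $(X,d,\mu)$: $X$ is a metric space with metric $d$, and $\mu$ is a positive measure on a $\sigma$-algebra $\mathcal A$ of subsets of $X$ containing the Borel sets, such that, with $B(x,r)=\{y\in X: d(x,y)<r\}$: (i) $\mu(B(x,r))<\infty$ for every $x\in X$ and $r>0$; (ii) $\mu$ is regular: for every $A\in\mathcal A$ with $\mu(A)<\infty$, $\mu(A)=\sup\{\mu(K): K\subset A,\ K\text{ compact}\}$ and $\mu(A)=\inf\{\mu(U): U\supset A,\ U\text{ open}\}$. Notation: $\mathcal C_c(X)$ is the space of continuous complex-valued functions with compact support on $X$; $L^1_{\mathrm{loc}}(X)$ is the space of measurable functions on $X$ that are integrable over every compact subset of $X$. $L^p$ for $0<p<1$ carries the usual quasi-norm $\|f\|_{L^p}=(\int|f|^p\,d\mu)^{1/p}$, and $1/\infty=0$. $\mathbf S=\{z\in\mathbb C: 0<\mathrm{Re}\,z<1\}$ is the open unit strip and $\overline{\mathbf S}$ is its closure. Analytic family: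 a family $\{T_z\}_{z\in\overline{\mathbf S}}$ of $m$-linear operators from $\mathcal C_c(X_1)\times\cdots\times\mathcal C_c(X_m)$ to $L^1_{\mathrm{loc}}(X_0)$ is called analytic if for all $(\varphi_1,\dots,\varphi_m)\in\mathcal C_c(X_1)\times\cdots\times\mathcal C_c(X_m)$ and every bounded (measurable) function $w$ with compact support on $X_0$, the mapping $$z\mapsto\int_{X_0}T_z(\varphi_1,\dots,\varphi_m)\,w\,d\mu_0$$ is analytic in $\mathbf S$ and continuous on $\overline{\mathbf S}$. Admissible growth: the analytic family is of admissible growth if there are a constant $\gamma$ with $0\le\gamma<\pi$ and an $s$ with $1\le s\le\infty$ such that for every $(\varphi_1,\dots,\varphi_m)\in\mathcal C_c(X_1)\times\cdots\times\mathcal C_c(X_m)$ and every compact $K\subset X_0$ there is a constant $C(\varphi_1,\dots,\varphi_m,K)$ with $$\log\bigg[\int_K|T_z(\varphi_1,\dots,\varphi_m)|^s\,d\mu_0\bigg]^{1/s}\le C(\varphi_1,\dots,\varphi_m,K)\,e^{\gamma|\mathrm{Im}\,z|}\qquad\text{for all }z\in\overline{\mathbf S}$$ (for $s=\infty$ the bracketed expression to the power $1/s$ is the $L^\infty(K)$ norm). Half Poisson kernel of the strip: for $0<x<1$ and $y\in\mathbb R$, $$\Omega(x,y)=\frac12\,\frac{\sin(\pi x)}{\cosh(\pi y)+\cos(\pi x)}.$$ Conventions: $\log 0=-\infty$ and $e^{-\infty}=0$. *)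

theory Defs
  imports "HOL-Analysis.Analysis" "HOL-Probability.Essential_Supremum"
begin

definition metric_measure_space :: "'a metric \<Rightarrow> 'a measure \<Rightarrow> bool" where
  "metric_measure_space X \<mu> \<longleftrightarrow>
     space \<mu> = mspace X \<and>
     (\<forall>U. openin (mtopology_of X) U \<longrightarrow> U \<in> sets \<mu>) \<and>
     (\<forall>x\<in>mspace X. \<forall>r>0. emeasure \<mu> (mball_of X x r) < \<infinity>) \<and>
     (\<forall>A\<in>sets \<mu>. emeasure \<mu> A < \<infinity> \<longrightarrow>
        emeasure \<mu> A = (SUP K\<in>{K. K \<subseteq> A \<and> compactin (mtopology_of X) K}. emeasure \<mu> K) \<and>
        emeasure \<mu> A = (INF U\<in>{U. A \<subseteq> U \<and> openin (mtopology_of X) U}. emeasure \<mu> U))"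

definition compact_support :: "'a metric \<Rightarrow> ('a \<Rightarrow> complex) \<Rightarrow> bool" where
  "compact_support X f \<longleftrightarrow>
     compactin (mtopology_of X) (mtopology_of X closure_of {x \<in> mspace X. f x \<noteq> 0})"

text \<open>
  A function on \<open>X\<close> is represented by its extension by zero to the whole type, so that
  an operator defined on these representatives depends only on the function on \<open>X\<close>.
\<close>
definition Cc :: "'a metric \<Rightarrow> ('a \<Rightarrow> complex) set" where
  "Cc X = {f. continuous_map (mtopology_of X) euclidean f \<and> compact_support X f \<and>
              (\<forall>x. x \<notin> mspace X \<longrightarrow> f x = 0)}"

definition L1_loc :: "'a metric \<Rightarrow> 'a measure \<Rightarrow> ('a \<Rightarrow> complex) set" where
  "L1_loc X \<mu> = {f \<in> borel_measurable \<mu>.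
     \<forall>K. compactin (mtopology_of X) K \<longrightarrow> set_integrable \<mu> K f}"

text \<open>Positive powers of \<open>[0,\<infinity>]\<close>; only used with \<open>a > 0\<close>.\<close>
definition ennpowr :: "ennreal \<Rightarrow> real \<Rightarrow> ennreal" where
  "ennpowr x a = (if x = \<infinity> then \<infinity> else ennreal (enn2real x powr a))"

text \<open>
  The \<open>L\<^sup>p\<close> (quasi-)norm for \<open>0 < p \<le> \<infinity>\<close>, with value \<open>\<infinity>\<close> for measurable functions outside
  \<open>L\<^sup>p\<close>. The essential supremum is taken in \<open>[0,\<infinity>]\<close>, hence is \<open>0\<close> over a null measure.
\<close>
definition Lp_norm :: "ennreal \<Rightarrow> 'a measure \<Rightarrow> ('a \<Rightarrow> complex) \<Rightarrow> ennreal" where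
  "Lp_norm p \<mu> f =
     (if p = \<infinity> then esssup \<mu> (\<lambda>x. ennreal (norm (f x)))
      else ennpowr (\<integral>\<^sup>+ x. ennreal (norm (f x) powr enn2real p) \<partial>\<mu>) (1 / enn2real p))"

definition open_strip :: "complex set" where
  "open_strip = {z. 0 < Re z \<and> Re z < 1}"

definition Cc_tuples :: "nat \<Rightarrow> (nat \<Rightarrow> 'a metric) \<Rightarrow> (nat \<Rightarrow> 'a \<Rightarrow> complex) set" where
  "Cc_tuples m X = (\<Pi>\<^sub>E \<kappa>\<in>{1..m}. Cc (X \<kappa>))"

text \<open>
  Elements of \<open>L1_loc\<close> are identified when they agree almost everywhere, so linearity in each
  argument is required almost everywhere.
\<close>
definition multilinear_op ::
  "nat \<Rightarrow> (nat \<Rightarrow> 'a metric) \<Rightarrow> (nat \<Rightarrow> 'a measure) \<Rightarrow>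
    ((nat \<Rightarrow> 'a \<Rightarrow> complex) \<Rightarrow> 'a \<Rightarrow> complex) \<Rightarrow> bool" where
  "multilinear_op m X \<mu> L \<longleftrightarrow>
     (\<forall>\<phi>\<in>Cc_tuples m X. L \<phi> \<in> L1_loc (X 0) (\<mu> 0)) \<and>
     (\<forall>\<phi>\<in>Cc_tuples m X. \<forall>\<kappa>\<in>{1..m}. \<forall>f\<in>Cc (X \<kappa>). \<forall>g\<in>Cc (X \<kappa>). \<forall>a b.
        AE x in \<mu> 0. L (\<phi>(\<kappa> := (\<lambda>t. a * f t + b * g t))) x =
                     a * L (\<phi>(\<kappa> := f)) x + b * L (\<phi>(\<kappa> := g)) x)"

definition analytic_family ::
  "nat \<Rightarrow> (nat \<Rightarrow> 'a metric) \<Rightarrow> (nat \<Rightarrow> 'a measure) \<Rightarrow>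
    (complex \<Rightarrow> (nat \<Rightarrow> 'a \<Rightarrow> complex) \<Rightarrow> 'a \<Rightarrow> complex) \<Rightarrow> bool" where
  "analytic_family m X \<mu> T \<longleftrightarrow>
     (\<forall>\<phi>\<in>Cc_tuples m X. \<forall>w\<in>borel_measurable (\<mu> 0).
        (\<exists>b. \<forall>x\<in>mspace (X 0). norm (w x) \<le> b) \<and> compact_support (X 0) w \<longrightarrow>
        (\<lambda>z. LINT x|\<mu> 0. T z \<phi> x * w x) analytic_on open_strip \<and>
        continuous_on (closure open_strip) (\<lambda>z. LINT x|\<mu> 0. T z \<phi> x * w x))"

definition elog :: "ennreal \<Rightarrow> ereal" where
  "elog x = (if x = 0 then - \<infinity> else if x = \<infinity> then \<infinity> else ereal (ln (enn2real x)))"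

definition eexp :: "ereal \<Rightarrow> ennreal" where
  "eexp x = (if x = - \<infinity> then 0 else if x = \<infinity> then \<infinity> else ennreal (exp (real_of_ereal x)))"

definition admissible_growth ::
  "nat \<Rightarrow> (nat \<Rightarrow> 'a metric) \<Rightarrow> (nat \<Rightarrow> 'a measure) \<Rightarrow>
    (complex \<Rightarrow> (nat \<Rightarrow> 'a \<Rightarrow> complex) \<Rightarrow> 'a \<Rightarrow> complex) \<Rightarrow> bool" where
  "admissible_growth m X \<mu> T \<longleftrightarrow>
     (\<exists>\<gamma>::real. 0 \<le> \<gamma> \<and> \<gamma> < pi \<and> (\<exists>s::ennreal. 1 \<le> s \<and>
       (\<forall>\<phi>\<in>Cc_tuples m X. \<forall>K. compactin (mtopology_of (X 0)) K \<longrightarrow>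
         (\<exists>C::real. \<forall>z\<in>closure open_strip.
            elog (Lp_norm s (restrict_space (\<mu> 0) K) (T z \<phi>))
              \<le> ereal (C * exp (\<gamma> * \<bar>Im z\<bar>))))))"

definition half_poisson :: "real \<Rightarrow> real \<Rightarrow> real" where
  "half_poisson x y = 1 / 2 * (sin (pi * x) / (cosh (pi * y) + cos (pi * x)))"

text \<open>
  The integral of an extended real valued function as the integral of its positive part minus
  that of its negative part. It is meaningful when one of the two is finite; for the integrand
  of \<open>interp_const\<close> below this is the positive part, owing to the growth bounds on \<open>M0\<close>, \<open>M1\<close>.
\<close>
definition ereal_integral :: "'a measure \<Rightarrow> ('a \<Rightarrow> ereal) \<Rightarrow> ereal" where
  "ereal_integral \<mu> F =
     enn2ereal (\<integral>\<^sup>+ x. e2ennreal (F x) \<partial>\<mu>) - enn2ereal (\<integral>\<^sup>+ x. e2ennreal (- F x) \<partial>\<mu>)"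

definition interp_const :: "(real \<Rightarrow> real) \<Rightarrow> (real \<Rightarrow> real) \<Rightarrow> real \<Rightarrow> ennreal" where
  "interp_const M0 M1 \<theta> = eexp (ereal_integral lborel (\<lambda>y.
     ereal (half_poisson (1 - \<theta>) y) * elog (ennreal (M0 y)) +
     ereal (half_poisson \<theta> y) * elog (ennreal (M1 y))))"

end

theory Submission
  imports Defs "HOL-Complex_Analysis.Complex_Analysis" "HOL-Real_Asymp.Real_Asymp"
begin

text \<open>
  The theorem is a three lines theorem in which every object is as weak as possible: the
  exponents may lie below \<open>1\<close>, so duality is not available; the families \<open>z \<mapsto> T z \<phi>\<close> are
  analytic, and continuous up to the boundary, only after integration against test functions;
  and \<open>T z\<close> acts on compactly supported continuous functions only. Four ideas deal with this.

  The scalar case is Hirschman's lemma \<open>hirschman_lemma\<close>: for an analytic \<open>F\<close> of growth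
  \<open>exp (C exp (\<gamma> \<bar>Im z\<bar>))\<close>, \<open>\<gamma> < \<pi>\<close>, the number \<open>ln \<bar>F \<theta>\<bar>\<close> is at most the average of \<open>ln \<bar>F\<bar>\<close>
  over the two edges of the strip, weighted by the half Poisson kernels. A conformal map moves
  the statement to the disc. On a circle the continuous function \<open>ln (max \<bar>F\<bar> \<eta>)\<close> is uniformly
  close to the real part of a polynomial \<open>P\<close>, and the maximum principle for \<open>F exp (- P)\<close> is
  all that is needed. The radius tends to \<open>1\<close> by dominated convergence, because \<open>exp (\<gamma> \<bar>y\<bar>)\<close>
  is integrable against the kernels.

  Vectors need no further complex analysis (\<open>finite_interpolation\<close>). Given \<open>c\<^sub>A(z)\<close> with
  weights \<open>w\<^sub>A\<close>, let \<open>l\<^sub>A\<close> be the probability weights proportional to \<open>w\<^sub>A \<bar>c\<^sub>A(\<theta>)\<bar>\<^sup>q\<close>, and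
  let \<open>E\<close> be their entropy relative to \<open>w\<close>. By concavity of the logarithm
  \<open>\<Sum> l\<^sub>A ln b\<^sub>A \<le> ln \<parallel>b\<parallel>\<^sub>p + E / p\<close> for all \<open>b\<close> and all \<open>p \<in> (0, \<infinity>]\<close>, with equality for
  \<open>b = \<bar>c(\<theta>)\<bar>\<close> and \<open>p = q\<close>. Averaging the scalar estimates with the weights \<open>l\<^sub>A\<close> and using
  that \<open>1 / q\<close> is the convex combination of \<open>1 / q0\<close> and \<open>1 / q1\<close>, the entropies cancel and
  the interpolation inequality for the norms remains. (For \<open>q = \<infinity>\<close> all exponents are infinite
  and the coordinates can be estimated one by one.)

  A weakly analytic family on a compact set is replaced by its averages over the cells of a
  finite partition. The averages are finitely many scalar functions, analytic inside and
  continuous up to the boundary. When the cells shrink, they converge in \<open>L\<^sup>1\<close> for each fixed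
  \<open>z\<close> (\<open>compact_resolving_partitions\<close>). This controls the edge norms: for exponents at least
  \<open>1\<close> averaging is a contraction, and for smaller exponents convergence in \<open>L\<^sup>1\<close> implies
  convergence in \<open>L\<^sup>q\<close> on a set of finite measure (\<open>majorants_exist\<close>). The limit under the
  logarithmic integral, whose value may be \<open>- \<infinity>\<close>, is a reverse Fatou lemma. This gives
  \<open>tame_family_interpolation\<close>.

  Finally each argument \<open>f\<close> is placed in a family \<open>F\<^sub>z\<close> of finite sums of test functions with
  analytic coefficients such that \<open>F\<^sub>\<theta>\<close> is exactly \<open>f\<close> and the edge norms of \<open>F\<^sub>z\<close> are
  essentially powers of the norm of \<open>f\<close> (\<open>test_function_deformation\<close>). Such a family arises by
  cutting the values of \<open>f\<close> into slices \<open>\<bar>f\<bar> \<approx> \<beta>\<^sup>j\<close> with a partition of unity on the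
  logarithmic scale, letting the slice factor \<open>\<beta>\<^sup>j\<close> vary analytically and keeping the
  approximation error as a constant term. Multilinearity makes \<open>z \<mapsto> T z F\<^sub>z\<close> a finite analytic
  combination of the given families, to which the previous result applies.
\<close>

section \<open>Jensen's inequality on the disc\<close>

lemma closure_open_strip: "closure open_strip = {z. 0 \<le> Re z \<and> Re z \<le> 1}"
proof
  have "closed ({z. 0 \<le> Re z} \<inter> {z. Re z \<le> 1})"
    by (intro closed_Int closed_halfspace_Re_ge closed_halfspace_Re_le)
  moreover have "open_strip \<subseteq> {z. 0 \<le> Re z} \<inter> {z. Re z \<le> 1}"
    by (auto simp: open_strip_def)
  ultimately show "closure open_strip \<subseteq> {z. 0 \<le> Re z \<and> Re z \<le> 1}"
    using closure_minimal by blast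
  show "{z. 0 \<le> Re z \<and> Re z \<le> 1} \<subseteq> closure open_strip"
  proof
    fix z assume z: "z \<in> {z. 0 \<le> Re z \<and> Re z \<le> 1}"
    \<comment> \<open>Points of the closed strip are limits along the segment to the interior point \<open>1/2\<close>.\<close>
    have "((\<lambda>t. z + of_real t * (1/2 - z)) \<longlongrightarrow> z + of_real 0 * (1/2 - z)) (at_right (0::real))"
      by (intro tendsto_intros)
    moreover have "eventually (\<lambda>t. z + of_real t * (1/2 - z) \<in> open_strip) (at_right (0::real))"
      unfolding eventually_at_right_field
    proof (intro exI[of _ 1] conjI allI impI)
      fix t :: real assume t: "0 < t" "t < 1"
      have re: "Re (z + of_real t * (1/2 - z)) = (1 - t) * Re z + t/2"
        by (simp add: algebra_simps)
      have "0 \<le> (1 - t) * Re z" and 2: "(1 - t) * Re z \<le> 1 - t"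
        using z t mult_left_mono[of "Re z" 1 "1 - t"] by auto
      then show "z + of_real t * (1/2 - z) \<in> open_strip"
        using t 2 unfolding open_strip_def mem_Collect_eq re by (intro conjI; linarith)
    qed auto
    ultimately show "z \<in> closure open_strip"
      by (intro Lim_in_closed_set[of _ _ "at_right (0::real)"])
         (auto elim!: eventually_mono intro: subsetD[OF closure_subset])
  qed
qed

text \<open>
  On the unit circle the real parts of polynomials form an algebra, since \<open>cnj w = 1 / w\<close>
  there. This makes them dense by the Stone--Weierstrass theorem, and each of them is the real
  part of an entire function, as the maximum principle requires.
\<close>
inductive_set trig_poly :: "(complex \<Rightarrow> real) set" where
  monom: "(\<lambda>w. Re (c * w ^ n)) \<in> trig_poly"
| add: "f \<in> trig_poly \<Longrightarrow> g \<in> trig_poly \<Longrightarrow> (\<lambda>w. f w + g w) \<in> trig_poly"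

lemma trig_poly_entire:
  assumes "f \<in> trig_poly"
  obtains P where "P holomorphic_on UNIV" "\<And>w. f w = Re (P w)"
proof -
  have "\<exists>P. P holomorphic_on UNIV \<and> (\<forall>w. f w = Re (P w))"
    using assms
  proof induction
    case (monom c n)
    show ?case by (rule exI[of _ "\<lambda>w. c * w ^ n"]) (auto intro!: holomorphic_intros)
  next
    case (add f g)
    then obtain P Q where "P holomorphic_on UNIV" "\<forall>w. f w = Re (P w)" "Q holomorphic_on UNIV" "\<forall>w. g w = Re (Q w)" by auto
    then show ?case
      by (intro exI[of _ "\<lambda>w. P w + Q w"]) (auto intro!: holomorphic_intros)
  qed
  then show ?thesis using that by auto
qed

text \<open>
  Products are only equal to real parts of polynomials on the circle: in
  \<open>Re u Re v = Re (u v) / 2 + Re (u cnj v) / 2\<close> the second summand involves a negative power,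
  which conjugation turns into a positive one.
\<close>
lemma trig_poly_mult:
  assumes "f \<in> trig_poly" "g \<in> trig_poly"
  shows "\<exists>h\<in>trig_poly. \<forall>w\<in>sphere 0 1. f w * g w = h w"
  using assms
proof (induction f rule: trig_poly.induct)
  case f: (monom c n)
  show ?case using f(1)
  proof (induction g rule: trig_poly.induct)
    case (monom d k)
    define e l where "e = (if k \<le> n then c * cnj d else cnj c * d)" and "l = (if k \<le> n then n - k else k - n)"
    have "Re (c * w ^ n) * Re (d * w ^ k) = Re (c * d / 2 * w ^ (n + k)) + Re (e / 2 * w ^ l)"
      if w: "w \<in> sphere 0 1" for w :: complex
    proof -
      have ww: "w * cnj w = 1" using w by (simp add: complex_norm_square[symmetric])
      have prod: "Re u * Re v = Re (u * v / 2) + Re (u * cnj v / 2)" for u v :: complex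
        by (simp add: field_simps)
      have "Re (c * w ^ n * cnj (d * w ^ k) / 2) = Re (e / 2 * w ^ l)"
      proof (cases "k \<le> n")
        case True
        then have "w ^ n = w ^ l * w ^ k" by (simp add: l_def power_add[symmetric])
        then have "c * w ^ n * cnj (d * w ^ k) = c * cnj d * w ^ l * (w * cnj w) ^ k"
          by (simp add: power_mult_distrib mult_ac)
        then have "c * w ^ n * cnj (d * w ^ k) / 2 = e / 2 * w ^ l" using True ww by (simp add: e_def)
        then show ?thesis by (rule arg_cong)
      next
        case False
        then have "w ^ k = w ^ l * w ^ n" by (simp add: l_def power_add[symmetric])
        then have "c * w ^ n * cnj (d * w ^ k) = cnj (cnj c * d * w ^ l) * (w * cnj w) ^ n"
          by (simp add: power_mult_distrib mult_ac)
        then have "c * w ^ n * cnj (d * w ^ k) = cnj (e * w ^ l)" using False ww by (simp add: e_def)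
        then have "Re (c * w ^ n * cnj (d * w ^ k)) = Re (e * w ^ l)" by (metis cnj.sel(1))
        then show ?thesis by (metis Re_divide_numeral times_divide_eq_left)
      qed
      then show ?thesis using prod[of "c * w ^ n" "d * w ^ k"]
        by (simp add: power_add mult_ac)
    qed
    then show ?case
      by (intro bexI[of _ "\<lambda>w. Re (c * d / 2 * w ^ (n + k)) + Re (e / 2 * w ^ l)"])
         (blast, intro trig_poly.intros)
  next
    case (add g1 g2)
    then obtain h1 h2 where "h1 \<in> trig_poly" "h2 \<in> trig_poly"
      "\<forall>w\<in>sphere 0 1. Re (c * w ^ n) * g1 w = h1 w" "\<forall>w\<in>sphere 0 1. Re (c * w ^ n) * g2 w = h2 w"
      by auto
    then show ?case
      by (intro bexI[of _ "\<lambda>w. h1 w + h2 w"]) (auto intro: trig_poly.intros simp: distrib_left)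
  qed
next
  case (add f1 f2)
  then obtain h1 h2 where "h1 \<in> trig_poly" "h2 \<in> trig_poly"
    "\<forall>w\<in>sphere 0 1. f1 w * g w = h1 w" "\<forall>w\<in>sphere 0 1. f2 w * g w = h2 w"
    by auto
  then show ?case
    by (intro bexI[of _ "\<lambda>w. h1 w + h2 w"]) (auto intro: trig_poly.intros simp: distrib_right)
qed

lemma circle_approx_Re_entire:
  fixes u :: "complex \<Rightarrow> real"
  assumes u: "continuous_on (sphere 0 1) u" and e: "e > 0"
  obtains P where "P holomorphic_on UNIV" "\<And>w. w \<in> sphere 0 1 \<Longrightarrow> \<bar>u w - Re (P w)\<bar> < e"
proof -
  define R where "R = {f. \<exists>h\<in>trig_poly. \<forall>w\<in>sphere 0 1. f w = h w}"
  interpret function_ring_on R "sphere (0::complex) 1"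
  proof
    show "compact (sphere (0::complex) 1)" by simp
    fix f assume f: "f \<in> R"
    then obtain h where h: "h \<in> trig_poly" "\<forall>w\<in>sphere 0 1. f w = h w" by (auto simp: R_def)
    obtain P where P: "P holomorphic_on UNIV" "\<And>w. h w = Re (P w)" using trig_poly_entire[OF h(1)] by blast
    have "continuous_on (sphere 0 1) (\<lambda>w. Re (P w))"
      using P(1) by (auto intro!: continuous_intros holomorphic_on_imp_continuous_on intro: holomorphic_on_subset)
    then show "continuous_on (sphere 0 1) f"
      by (rule continuous_on_eq) (use h(2) P(2) in auto)
    fix g assume "g \<in> R"
    then obtain k where k: "k \<in> trig_poly" "\<forall>w\<in>sphere 0 1. g w = k w" by (auto simp: R_def)
    show "(\<lambda>x. f x + g x) \<in> R" unfolding R_def using h k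
      by (auto intro!: bexI[of _ "\<lambda>x. h x + k x"] trig_poly.intros)
    show "(\<lambda>x. f x * g x) \<in> R" unfolding R_def using h k trig_poly_mult[OF h(1) k(1)] by auto
  next
    fix c :: real
    show "(\<lambda>_. c) \<in> R" unfolding R_def using trig_poly.monom[of "of_real c" 0] by auto
  next
    fix x y :: complex assume xy: "x \<in> sphere 0 1" "y \<in> sphere 0 1" "x \<noteq> y"
    have 1: "(\<lambda>w. Re w) \<in> R" unfolding R_def using trig_poly.monom[of 1 1] by auto
    have 2: "(\<lambda>w. Im w) \<in> R" unfolding R_def using trig_poly.monom[of "-\<i>" 1] by auto
    show "\<exists>f\<in>R. f x \<noteq> f y"
      using 1 2 xy(3) complex_eqI[of x y] by blast
  qed
  obtain f where f: "f \<in> R" "\<forall>x\<in>sphere 0 1. \<bar>u x - f x\<bar> < e"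
    using Stone_Weierstrass_basic[OF u e] by blast
  then obtain h where h: "h \<in> trig_poly" "\<forall>w\<in>sphere 0 1. f w = h w" by (auto simp: R_def)
  obtain P where P: "P holomorphic_on UNIV" "\<And>w. h w = Re (P w)" using trig_poly_entire[OF h(1)] by blast
  show ?thesis using that[of P] P f(2) h(2) by auto
qed

lemma circle_mean_entire:
  assumes "P holomorphic_on UNIV"
  shows "((\<lambda>t. Re (P (cis t))) has_integral 2 * pi * Re (P 0)) {0..2*pi}"
proof -
  have "((\<lambda>w. P w / (w - 0)) has_contour_integral (2 * of_real pi * \<i> * P 0)) (circlepath 0 1)"
    by (rule Cauchy_integral_circlepath_simple) (auto intro: holomorphic_on_subset[OF assms])
  then have "((\<lambda>t. P (0 + of_real 1 * cis t) / (0 + of_real 1 * cis t - 0) * of_real 1 * \<i> * cis t) has_integral (2 * of_real pi * \<i> * P 0)) {0..2*pi}"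
    unfolding circlepath_def
    by (subst (asm) has_contour_integral_part_circlepath_iff) auto
  then have "((\<lambda>t. P (cis t) * \<i>) has_integral (2 * of_real pi * \<i> * P 0)) {0..2*pi}"
    by (simp add: mult_ac)
  from has_integral_mult_left[OF this, of "-\<i>"]
  have "((\<lambda>t. P (cis t)) has_integral (2 * of_real pi * P 0)) {0..2*pi}"
    by (simp add: mult_ac)
  from has_integral_Re[OF this] show ?thesis by simp
qed

text \<open>
  Approximating \<open>ln (max \<bar>F\<bar> \<eta>)\<close> on the circle by \<open>Re P\<close> avoids any discussion of the zeros of
  \<open>F\<close>: the function \<open>F exp (- P)\<close> is almost bounded by \<open>1\<close> on the circle, hence also at the
  centre, where \<open>Re P\<close> is the circle mean. The truncation at \<open>\<eta>\<close> is there to make the boundary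
  function continuous.
\<close>
lemma jensen_inequality_disc:
  fixes F :: "complex \<Rightarrow> complex"
  assumes F: "F holomorphic_on ball 0 1" "continuous_on (cball 0 1) F" and nz: "F 0 \<noteq> 0" and eta: "\<eta> > 0"
  shows "2 * pi * ln (norm (F 0)) \<le> integral {0..2*pi} (\<lambda>t. ln (max (norm (F (cis t))) \<eta>))"
proof (rule field_le_epsilon)
  fix e :: real assume e: "e > 0"
  define u where "u = (\<lambda>w. ln (max (norm (F w)) \<eta>))"
  define d where "d = e / (4 * pi)"
  have d: "d > 0" using e by (simp add: d_def)
  have cu: "continuous_on (sphere 0 1) u"
    unfolding u_def using eta
    by (intro continuous_on_ln continuous_on_max continuous_intros continuous_on_subset[OF F(2)])
       (auto simp: max_def)
  obtain P where P: "P holomorphic_on UNIV" "\<And>w. w \<in> sphere 0 1 \<Longrightarrow> \<bar>u w - Re (P w)\<bar> < d"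
    using circle_approx_Re_entire[OF cu d] by blast
  have "norm (F 0 * exp (- P 0)) \<le> exp d"
  proof (rule maximum_modulus_frontier[where S = "ball 0 1" and f = "\<lambda>w. F w * exp (- P w)"])
    show "(\<lambda>w. F w * exp (- P w)) holomorphic_on interior (ball 0 1)"
      using F(1) holomorphic_on_subset[OF P(1)] by (auto intro!: holomorphic_intros)
    show "continuous_on (closure (ball 0 1)) (\<lambda>w. F w * exp (- P w))"
      using F(2) holomorphic_on_imp_continuous_on[OF holomorphic_on_subset[OF P(1)]]
      by (auto intro!: continuous_intros)
    fix w :: complex assume "w \<in> frontier (ball 0 1)"
    then have w: "w \<in> sphere 0 1" by simp
    have "norm (F w) \<le> exp (u w)" using eta by (auto simp: u_def)
    also have "\<dots> \<le> exp (d + Re (P w))" using P(2)[OF w] by simp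
    finally have "norm (F w) * exp (- Re (P w)) \<le> exp (d + Re (P w)) * exp (- Re (P w))"
      by (intro mult_right_mono) auto
    then show "norm (F w * exp (- P w)) \<le> exp d"
      by (simp add: norm_mult exp_add exp_minus norm_divide norm_exp_eq_Re field_simps)
  qed auto
  then have "norm (F 0) \<le> exp (d + Re (P 0))"
    by (simp add: norm_mult exp_add exp_minus norm_divide norm_exp_eq_Re field_simps)
  then have "ln (norm (F 0)) \<le> d + Re (P 0)"
    using nz by (metis ln_exp ln_le_cancel_iff exp_gt_zero zero_less_norm_iff)
  then have "2 * pi * ln (norm (F 0)) \<le> 2 * pi * d + 2 * pi * Re (P 0)"
    by (simp add: distrib_left[symmetric])
  also have "2 * pi * Re (P 0) \<le> integral {0..2*pi} (\<lambda>t. u (cis t) + d)"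
  proof (rule has_integral_le[OF circle_mean_entire[OF P(1)] integrable_integral])
    have "continuous_on {0..2*pi} (\<lambda>t. u (cis t))"
      by (rule continuous_on_compose2[OF cu]) (auto intro!: continuous_intros)
    then show "(\<lambda>t. u (cis t) + d) integrable_on {0..2*pi}"
      by (intro integrable_continuous_real continuous_intros)
    show "Re (P (cis t)) \<le> u (cis t) + d" for t using P(2)[of "cis t"] by auto
  qed
  also have "integral {0..2*pi} (\<lambda>t. u (cis t) + d) = integral {0..2*pi} (\<lambda>t. u (cis t)) + 2 * pi * d"
  proof -
    have "continuous_on {0..2*pi} (\<lambda>t. u (cis t))"
      by (rule continuous_on_compose2[OF cu]) (auto intro!: continuous_intros)
    then show ?thesis
      by (subst integral_add) (auto intro!: integrable_continuous_real)
  qed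
  also have "2 * pi * d + (integral {0..2*pi} (\<lambda>t. u (cis t)) + 2 * pi * d) = integral {0..2*pi} (\<lambda>t. u (cis t)) + e"
    by (simp add: d_def)
  finally show "2 * pi * ln (norm (F 0)) \<le> integral {0..2*pi} (\<lambda>t. ln (max (norm (F (cis t))) \<eta>)) + e"
    by (simp add: u_def)
qed

section \<open>Harmonic measure of the strip\<close>

text \<open>
  The edges of the strip correspond to two arcs of the unit circle under the conformal map
  that sends \<open>0\<close> to \<open>\<theta>\<close>. The point of height \<open>y\<close> on the left edge (\<open>\<sigma> = 1\<close>) or on the right
  edge (\<open>\<sigma> = -1\<close>) has the angle \<open>strip_angle \<sigma> \<theta> y\<close>; it lies over the boundary point
  \<open>\<sigma> exp (- \<pi> y)\<close> of the upper half plane.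
\<close>
definition strip_angle :: "real \<Rightarrow> real \<Rightarrow> real \<Rightarrow> real" where
  "strip_angle \<sigma> \<theta> y = pi + 2 * arctan ((\<sigma> * exp (- pi * y) - cos (pi * \<theta>)) / sin (pi * \<theta>))"

lemma sin_pi_pos: "0 < \<theta> \<Longrightarrow> \<theta> < 1 \<Longrightarrow> 0 < sin (pi * \<theta>)"
  by (intro sin_gt_zero) auto

lemma half_poisson_reflect:
  "half_poisson (1 - \<theta>) y = 1 / 2 * (sin (pi * \<theta>) / (cosh (pi * y) - cos (pi * \<theta>)))"
  by (simp add: half_poisson_def right_diff_distrib cos_diff sin_diff)

lemma cos_less_cosh:
  fixes \<theta> y :: real
  assumes "0 < \<theta>" "\<theta> < 1"
  shows "\<bar>cos (pi * \<theta>)\<bar> < cosh (pi * y)"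
proof -
  have "(cos (pi * \<theta>))\<^sup>2 < 1" using sin_pi_pos[OF assms] sin_cos_squared_add[of "pi * \<theta>"]
    by (smt (verit) zero_less_power)
  then have "\<bar>cos (pi * \<theta>)\<bar> < 1" by (simp add: abs_square_less_1)
  also have "1 \<le> cosh (pi * y)" by (rule cosh_real_ge_1)
  finally show ?thesis .
qed

lemma half_poisson_pos: "0 < \<theta> \<Longrightarrow> \<theta> < 1 \<Longrightarrow> 0 < half_poisson \<theta> y"
  using cos_less_cosh[of \<theta> y] sin_pi_pos[of \<theta>] by (auto simp: half_poisson_def)

lemma half_poisson_measurable [measurable]: "half_poisson \<theta> \<in> borel_measurable borel"
  unfolding half_poisson_def cosh_def by measurable

text \<open>
  Up to the factor \<open>2 \<pi>\<close> and the orientation, the half Poisson kernels are the densities of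
  the angle on the two edges. Everything that is needed about them below (total mass, mean
  value formula) follows from this substitution.
\<close>
lemma strip_angle_deriv:
  assumes "0 < \<theta>" "\<theta> < 1"
  shows "(strip_angle 1 \<theta> has_real_derivative - (2 * pi * half_poisson (1 - \<theta>) y)) (at y within A)"
    and "(strip_angle (-1) \<theta> has_real_derivative 2 * pi * half_poisson \<theta> y) (at y within A)"
proof -
  define c s e where "c = cos (pi * \<theta>)" and "s = sin (pi * \<theta>)" and "e = exp (- pi * y)"
  have s: "s > 0" using sin_pi_pos[OF assms] by (simp add: s_def)
  have cs: "c\<^sup>2 + s\<^sup>2 = 1" by (simp add: c_def s_def)
  have e: "e > 0" by (simp add: e_def)
  have cosh: "cosh (pi * y) = (1 / e + e) / 2"
    by (simp add: cosh_def e_def exp_minus field_simps)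
  have *: "2 * (1 / (1 + ((\<sigma> * e - c) / s)\<^sup>2)) * (\<sigma> * (e * - pi) / s) = - \<sigma> * (2 * pi * (1/2 * (s / (cosh (pi * y) - \<sigma> * c))))"
    if \<sigma>: "\<sigma>\<^sup>2 = 1" for \<sigma>
  proof -
    have ne: "s\<^sup>2 + (\<sigma> * e - c)\<^sup>2 > 0" using s by (intro add_pos_nonneg) auto
    have eq: "s\<^sup>2 + (\<sigma> * e - c)\<^sup>2 = 2 * e * (cosh (pi * y) - \<sigma> * c)"
    proof -
      have "s\<^sup>2 + (\<sigma> * e - c)\<^sup>2 = (c\<^sup>2 + s\<^sup>2) + \<sigma>\<^sup>2 * e\<^sup>2 - 2 * \<sigma> * e * c"
        by (simp add: power2_eq_square algebra_simps)
      also have "\<dots> = 1 + e\<^sup>2 - 2 * \<sigma> * e * c" using cs \<sigma> by simp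
      also have "\<dots> = 2 * e * (cosh (pi * y) - \<sigma> * c)"
        using e unfolding cosh by (simp add: power2_eq_square field_simps)
      finally show ?thesis .
    qed
    then have ne2: "cosh (pi * y) - \<sigma> * c \<noteq> 0" using ne by auto
    have "2 * (1 / (1 + ((\<sigma> * e - c) / s)\<^sup>2)) * (\<sigma> * (e * - pi) / s) = 2 * (s\<^sup>2 / (s\<^sup>2 + (\<sigma> * e - c)\<^sup>2)) * (\<sigma> * (e * - pi) / s)"
      using s by (simp add: power_divide field_simps)
    also have "\<dots> = 2 * (s\<^sup>2 / (2 * e * (cosh (pi * y) - \<sigma> * c))) * (\<sigma> * (e * - pi) / s)"
      by (simp only: eq)
    also have "\<dots> = - \<sigma> * (2 * pi * (1/2 * (s / (cosh (pi * y) - \<sigma> * c))))"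
      using s e ne2 by (simp add: field_simps power2_eq_square)
    finally show ?thesis .
  qed
  have D: "(strip_angle \<sigma> \<theta> has_real_derivative 2 * (1 / (1 + ((\<sigma> * e - c) / s)\<^sup>2)) * (\<sigma> * (e * - pi) / s)) (at y within A)" for \<sigma>
    unfolding strip_angle_def[abs_def] c_def s_def e_def
    by (rule derivative_eq_intros refl | use s in \<open>simp add: s_def field_simps\<close>)+
  show "(strip_angle 1 \<theta> has_real_derivative - (2 * pi * half_poisson (1 - \<theta>) y)) (at y within A)"
    using D[of 1] *[of 1] by (simp add: half_poisson_reflect c_def s_def)
  show "(strip_angle (-1) \<theta> has_real_derivative 2 * pi * half_poisson \<theta> y) (at y within A)"
    using D[of "-1"] *[of "-1"] by (simp add: half_poisson_def c_def s_def)
qed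

lemma strip_angle_bounds: "0 < strip_angle \<sigma> \<theta> y" "strip_angle \<sigma> \<theta> y < 2 * pi"
  using arctan_lbound[of "((\<sigma> * exp (- pi * y) - cos (pi * \<theta>)) / sin (pi * \<theta>))"]
    arctan_ubound[of "((\<sigma> * exp (- pi * y) - cos (pi * \<theta>)) / sin (pi * \<theta>))"]
  by (auto simp: strip_angle_def)

lemma inj_strip_angle:
  assumes "0 < \<theta>" "\<theta> < 1" "\<sigma> \<noteq> 0"
  shows "inj (strip_angle \<sigma> \<theta>)"
  using sin_pi_pos[OF assms(1,2)] assms(3)
  by (auto simp: inj_def strip_angle_def arctan_eq_iff)

lemma arctan_neg_cot:
  assumes "0 < \<theta>" "\<theta> < 1"
  shows "2 * arctan (- cos (pi * \<theta>) / sin (pi * \<theta>)) = 2 * pi * \<theta> - pi"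
proof -
  have t: "tan (pi * \<theta> - pi / 2) = - cos (pi * \<theta>) / sin (pi * \<theta>)"
    by (simp add: tan_def sin_diff cos_diff)
  have "arctan (- cos (pi * \<theta>) / sin (pi * \<theta>)) = pi * \<theta> - pi / 2"
    by (rule arctan_unique) (use assms t in \<open>auto simp: field_simps\<close>)
  then show ?thesis by simp
qed

text \<open>
  The two arcs are separated by the angle \<open>2 \<pi> \<theta>\<close>, the image of the upper end of the strip
  (the lower end goes to the angle \<open>0\<close>); their lengths are \<open>2 \<pi>\<close> times the masses of the two
  kernels.
\<close>
lemma range_strip_angle:
  assumes "0 < \<theta>" "\<theta> < 1"
  shows "range (strip_angle 1 \<theta>) = {2 * pi * \<theta> <..< 2 * pi}"
    and "range (strip_angle (-1) \<theta>) = {0 <..< 2 * pi * \<theta>}"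
proof -
  define c s where "c = cos (pi * \<theta>)" and "s = sin (pi * \<theta>)"
  have s: "s > 0" using sin_pi_pos[OF assms] by (simp add: s_def)
  have base: "2 * pi * \<theta> = pi + 2 * arctan (- c / s)"
    using arctan_neg_cot[OF assms] by (simp add: c_def s_def)
  have surj: "t \<in> range (strip_angle \<sigma> \<theta>)"
    if t: "0 < t" "t < 2 * pi" and \<sigma>: "\<sigma>\<^sup>2 = 1" and pos: "\<sigma> * (c + s * tan ((t - pi) / 2)) > 0" for t \<sigma>
  proof -
    define y where "y = - ln (\<sigma> * (c + s * tan ((t - pi) / 2))) / pi"
    have ey: "exp (- pi * y) = \<sigma> * (c + s * tan ((t - pi) / 2))" using pos by (simp add: y_def)
    have "\<sigma> * exp (- pi * y) = \<sigma>\<^sup>2 * (c + s * tan ((t - pi) / 2))"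
      unfolding ey by (simp add: power2_eq_square)
    then have "\<sigma> * exp (- pi * y) - c = s * tan ((t - pi) / 2)"
      using \<sigma> by simp
    then have "strip_angle \<sigma> \<theta> y = pi + 2 * arctan (tan ((t - pi) / 2))"
      using s by (simp add: strip_angle_def c_def s_def)
    also have "arctan (tan ((t - pi) / 2)) = (t - pi) / 2"
      using t by (intro arctan_tan) auto
    finally have "strip_angle \<sigma> \<theta> y = t" by (simp add: field_simps)
    then show ?thesis by (auto intro!: image_eqI[of _ _ y])
  qed
  have tn: "arctan (tan ((t - pi) / 2)) = (t - pi) / 2" if t: "0 < t" "t < 2 * pi" for t
    using t by (intro arctan_tan) auto
  show "range (strip_angle 1 \<theta>) = {2 * pi * \<theta> <..< 2 * pi}"
  proof safe
    fix y
    have "- c / s < (1 * exp (- pi * y) - c) / s" using s by (intro divide_strict_right_mono) auto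
    then show "strip_angle 1 \<theta> y \<in> {2 * pi * \<theta> <..< 2 * pi}"
      using strip_angle_bounds[of 1 \<theta> y] unfolding base strip_angle_def c_def s_def by (simp add: arctan_less_iff)
  next
    fix t assume "t \<in> {2 * pi * \<theta> <..< 2 * pi}"
    then have t: "2 * pi * \<theta> < t" "0 < t" "t < 2 * pi" using assms by (auto intro: less_trans[rotated])
    then have "arctan (- c / s) < arctan (tan ((t - pi) / 2))"
      unfolding base tn[OF t(2,3)] by auto
    then have "- c / s < tan ((t - pi) / 2)" by (simp only: arctan_less_iff)
    then have "0 < c + s * tan ((t - pi) / 2)" using s by (simp add: field_simps)
    then show "t \<in> range (strip_angle 1 \<theta>)" using t by (intro surj) auto
  qed
  show "range (strip_angle (-1) \<theta>) = {0 <..< 2 * pi * \<theta>}"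
  proof safe
    fix y
    have "(-1 * exp (- pi * y) - c) / s < - c / s" using s by (intro divide_strict_right_mono) auto
    then show "strip_angle (-1) \<theta> y \<in> {0 <..< 2 * pi * \<theta>}"
      using strip_angle_bounds[of "-1" \<theta> y] unfolding base strip_angle_def c_def s_def by (simp add: arctan_less_iff)
  next
    fix t assume t': "t \<in> {0 <..< 2 * pi * \<theta>}"
    then have t: "t < 2 * pi * \<theta>" "0 < t" by auto
    have "2 * pi * \<theta> < 2 * pi" using assms by simp
    then have t3: "t < 2 * pi" using t by linarith
    have "arctan (tan ((t - pi) / 2)) < arctan (- c / s)"
      using t unfolding base tn[OF t(2) t3] by auto
    then have "tan ((t - pi) / 2) < - c / s" by (simp only: arctan_less_iff)
    then have "0 < -1 * (c + s * tan ((t - pi) / 2))" using s by (simp add: field_simps)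
    then show "t \<in> range (strip_angle (-1) \<theta>)" using t t3 by (intro surj) auto
  qed
qed

lemma continuous_strip_angle:
  assumes "0 < \<theta>" "\<theta> < 1"
  shows "continuous_on A (strip_angle \<sigma> \<theta>)"
  unfolding strip_angle_def using sin_pi_pos[OF assms] by (intro continuous_intros) auto

lemma arc_integral_as_line_integral:
  fixes f g k :: "real \<Rightarrow> real"
  assumes f: "continuous_on {0..2*pi} f"
    and der: "\<And>y. (g has_real_derivative g' y) (at y)"
    and inj: "inj g" and rng: "range g = {a<..<b}" and ab: "0 \<le> a" "b \<le> 2 * pi"
    and k: "\<And>y. \<bar>g' y\<bar> = 2 * pi * k y" and km: "k \<in> borel_measurable borel"
  shows "integrable lborel (\<lambda>y. k y * f (g y))"
    and "integral {a..b} f = 2 * pi * (LBINT y. k y * f (g y))"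
proof -
  have sub: "{a..b} \<subseteq> {0..2*pi}" using ab by auto
  have "f absolutely_integrable_on {a..b}"
    by (intro absolutely_integrable_continuous_real continuous_on_subset[OF f] sub)
  then have 1: "f absolutely_integrable_on {a<..<b}"
    by (rule set_integrable_subset) auto
  have 2: "integral {a<..<b} f = integral {a..b} f" using integral_open_interval[of a b f] by (simp add: box_real)
  have "(\<lambda>x. \<bar>g' x\<bar> * f (g x)) absolutely_integrable_on UNIV \<and>
           integral UNIV (\<lambda>x. \<bar>g' x\<bar> * f (g x)) = integral {a..b} f"
    using 1 2 by (subst has_absolute_integral_change_of_variables_1'[where g = g])
       (auto simp: rng inj intro: der)
  then have 3: "integrable lebesgue (\<lambda>x. (2 * pi) * (k x * f (g x)))"
    and 4: "integral UNIV (\<lambda>x. (2 * pi) * (k x * f (g x))) = integral {a..b} f"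
    by (simp_all add: set_integrable_def k mult_ac)
  have cg: "continuous_on UNIV g" 
    by (rule DERIV_continuous_on) (rule der)
  have cfg: "continuous_on UNIV (\<lambda>y. f (g y))"
    by (rule continuous_on_compose2[OF f cg]) (use rng sub ab in \<open>auto simp: image_subset_iff\<close>)
  then have m: "(\<lambda>x. (2 * pi) * (k x * f (g x))) \<in> borel_measurable lborel"
    using km borel_measurable_continuous_onI[OF cfg] by simp
  have 5: "integrable lborel (\<lambda>x. (2 * pi) * (k x * f (g x)))"
    using 3 integrable_completion[OF m] by simp
  then show I: "integrable lborel (\<lambda>y. k y * f (g y))"
    by (simp only: integrable_mult_left_iff) simp
  show "integral {a..b} f = 2 * pi * (LBINT y. k y * f (g y))"
    using integral_lborel[OF 5] 4 by simp
qed

lemma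
  assumes \<theta>: "0 < \<theta>" "\<theta> < 1" and f: "continuous_on {0..2*pi} f"
  shows integrable_line1: "integrable lborel (\<lambda>y. half_poisson \<theta> y * f (strip_angle (-1) \<theta> y))"
    and line0: "integral {2 * pi * \<theta>..2*pi} f = 2 * pi * (LBINT y. half_poisson (1 - \<theta>) y * f (strip_angle 1 \<theta> y))"
    and line1: "integral {0..2 * pi * \<theta>} f = 2 * pi * (LBINT y. half_poisson \<theta> y * f (strip_angle (-1) \<theta> y))"
proof -
  have p: "0 \<le> half_poisson \<theta> y" "0 \<le> half_poisson (1 - \<theta>) y" for y
    using half_poisson_pos[of \<theta> y] half_poisson_pos[of "1 - \<theta>" y] \<theta> by auto
  show "integral {2 * pi * \<theta>..2*pi} f = 2 * pi * (LBINT y. half_poisson (1 - \<theta>) y * f (strip_angle 1 \<theta> y))"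
    using arc_integral_as_line_integral(2)[OF f strip_angle_deriv(1)[OF \<theta>] inj_strip_angle[OF \<theta>] range_strip_angle(1)[OF \<theta>],
      of "half_poisson (1 - \<theta>)"] \<theta> p by (auto simp: abs_mult)
  note 1 = arc_integral_as_line_integral[OF f strip_angle_deriv(2)[OF \<theta>] inj_strip_angle[OF \<theta>] range_strip_angle(2)[OF \<theta>],
      of "half_poisson \<theta>"]
  show "integrable lborel (\<lambda>y. half_poisson \<theta> y * f (strip_angle (-1) \<theta> y))"
    "integral {0..2 * pi * \<theta>} f = 2 * pi * (LBINT y. half_poisson \<theta> y * f (strip_angle (-1) \<theta> y))"
    using 1 \<theta> p by (auto simp: abs_mult)
qed

lemma half_poisson_mass:
  assumes \<theta>: "0 < \<theta>" "\<theta> < 1"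
  shows "integrable lborel (half_poisson \<theta>)" "integral\<^sup>L lborel (half_poisson \<theta>) = \<theta>"
  using integrable_line1[OF \<theta>, of "\<lambda>_. 1"] line1[OF \<theta>, of "\<lambda>_. 1"] \<theta> by auto

lemma circle_integral_as_line_integrals:
  assumes \<theta>: "0 < \<theta>" "\<theta> < 1" and f: "continuous_on {0..2*pi} f"
  shows "integral {0..2*pi} f = 2 * pi * ((LBINT y. half_poisson (1 - \<theta>) y * f (strip_angle 1 \<theta> y)) +
           (LBINT y. half_poisson \<theta> y * f (strip_angle (-1) \<theta> y)))"
proof -
  have "integral {0..2*pi} f = integral {0..2 * pi * \<theta>} f + integral {2 * pi * \<theta>..2*pi} f"
    using \<theta> by (intro Henstock_Kurzweil_Integration.integral_combine[symmetric] integrable_continuous_real f) auto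
  then show ?thesis using line0[OF assms] line1[OF assms] by (simp add: algebra_simps)
qed

lemma integrable_exp_minus_abs:
  fixes a :: real
  assumes "a > 0"
  shows "integrable lborel (\<lambda>y. exp (- a * \<bar>y\<bar>))"
proof -
  have "(\<lambda>y. exp (- a * y)) absolutely_integrable_on {0..}"
    using integrable_on_exp_minus_to_infinity[OF assms, of 0]
    by (intro nonnegative_absolutely_integrable_1) auto
  then have "integrable lebesgue (\<lambda>y. indicator {0..} y *\<^sub>R exp (- a * y))" by (simp add: set_integrable_def)
  then have 1: "integrable lborel (\<lambda>y. indicator {0..} y * exp (- a * y))"
    by (subst (asm) integrable_completion) auto
  have "integrable lborel (\<lambda>y. indicator {0..} (0 + (-1) * y) * exp (- a * (0 + (-1) * y)))"
    by (rule lborel_integrable_real_affine[OF 1]) auto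
  from Bochner_Integration.integrable_add[OF 1 this] show ?thesis
    by (rule Bochner_Integration.integrable_bound) (auto simp: indicator_def abs_if)
qed

lemma half_poisson_le_exp:
  assumes "0 < \<theta>" "\<theta> < 1"
  shows "half_poisson \<theta> y \<le> 1 / (1 - \<bar>cos (pi * \<theta>)\<bar>) * exp (- pi * \<bar>y\<bar>)"
proof -
  define c where "c = \<bar>cos (pi * \<theta>)\<bar>"
  have c: "0 \<le> c" "c < 1" using cos_less_cosh[OF assms, of 0] by (auto simp: c_def)
  have e: "exp (pi * \<bar>y\<bar>) / 2 \<le> cosh (pi * y)"
    by (cases "y \<ge> 0") (auto simp: cosh_def)
  have "(1 - c) * (exp (pi * \<bar>y\<bar>) / 2) \<le> (1 - c) * cosh (pi * y)"
    using c e by (intro mult_left_mono) auto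
  also have "\<dots> \<le> cosh (pi * y) - c" using cosh_real_ge_1[of "pi * y"] mult_left_mono[of 1 "cosh (pi * y)" c] c
    by (simp add: algebra_simps)
  also have "\<dots> \<le> cosh (pi * y) + cos (pi * \<theta>)" by (simp add: c_def)
  finally have L: "(1 - c) * (exp (pi * \<bar>y\<bar>) / 2) \<le> cosh (pi * y) + cos (pi * \<theta>)" .
  have pos: "0 < (1 - c) * (exp (pi * \<bar>y\<bar>) / 2)" using c by simp
  have "half_poisson \<theta> y \<le> 1/2 * (1 / ((1 - c) * (exp (pi * \<bar>y\<bar>) / 2)))"
    unfolding half_poisson_def using sin_pi_pos[OF assms] L pos
    by (intro mult_left_mono frac_le) auto
  also have "\<dots> = 1 / (1 - c) * exp (- pi * \<bar>y\<bar>)" using c by (simp add: exp_minus field_simps)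
  finally show ?thesis by (simp add: c_def)
qed

lemma integrable_half_poisson_exp:
  assumes \<theta>: "0 < \<theta>" "\<theta> < 1" and \<gamma>: "\<gamma> < pi"
  shows "integrable lborel (\<lambda>y. half_poisson \<theta> y * exp (\<gamma> * \<bar>y\<bar>))"
proof (rule Bochner_Integration.integrable_bound)
  show "integrable lborel (\<lambda>y. 1 / (1 - \<bar>cos (pi * \<theta>)\<bar>) * exp (- (pi - \<gamma>) * \<bar>y\<bar>))"
    using integrable_exp_minus_abs[of "pi - \<gamma>"] \<gamma> by simp
  show "AE y in lborel. norm (half_poisson \<theta> y * exp (\<gamma> * \<bar>y\<bar>)) \<le> norm (1 / (1 - \<bar>cos (pi * \<theta>)\<bar>) * exp (- (pi - \<gamma>) * \<bar>y\<bar>))"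
  proof (rule AE_I2)
    fix y
    have "half_poisson \<theta> y * exp (\<gamma> * \<bar>y\<bar>) \<le> 1 / (1 - \<bar>cos (pi * \<theta>)\<bar>) * exp (- pi * \<bar>y\<bar>) * exp (\<gamma> * \<bar>y\<bar>)"
      by (intro mult_right_mono half_poisson_le_exp \<theta>) auto
    also have "\<dots> = 1 / (1 - \<bar>cos (pi * \<theta>)\<bar>) * exp (- (pi - \<gamma>) * \<bar>y\<bar>)"
      by (simp add: exp_add[symmetric] algebra_simps)
    finally show "norm (half_poisson \<theta> y * exp (\<gamma> * \<bar>y\<bar>)) \<le> norm (1 / (1 - \<bar>cos (pi * \<theta>)\<bar>) * exp (- (pi - \<gamma>) * \<bar>y\<bar>))"
      using half_poisson_pos[OF \<theta>, of y] by simp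
  qed
qed simp

section \<open>The conformal map from the disc to the strip\<close>

text \<open>
  The inverse Cayley transform: the disc is mapped onto the upper half plane and \<open>0\<close> to
  \<open>exp (\<i> \<pi> \<theta>)\<close>. Composed with \<open>w \<mapsto> ln w / (\<i> \<pi>)\<close> it becomes a map onto the strip.
\<close>
definition disc_plane :: "real \<Rightarrow> complex \<Rightarrow> complex" where
  "disc_plane \<theta> \<zeta> = (cis (pi * \<theta>) - cnj (cis (pi * \<theta>)) * \<zeta>) / (1 - \<zeta>)"

text \<open>
  This is \<open>ln w / (\<i> \<pi>)\<close> on the upper half plane. Writing it with \<open>- \<i> w\<close> keeps the principal
  branch continuous on the whole boundary except at \<open>0\<close>, negative real numbers included.
\<close>
definition plane_strip :: "complex \<Rightarrow> complex" where
  "plane_strip w = 1 / 2 + Ln (- \<i> * w) / (\<i> * of_real pi)"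

lemma plane_strip_Re_Im:
  "Re (plane_strip w) = 1 / 2 + Im (Ln (- \<i> * w)) / pi"
  "w \<noteq> 0 \<Longrightarrow> Im (plane_strip w) = - ln (norm w) / pi"
proof -
  have eq: "plane_strip w = 1 / 2 + (- \<i> * Ln (- \<i> * w)) / of_real pi"
    by (simp add: plane_strip_def field_simps)
  show "Re (plane_strip w) = 1 / 2 + Im (Ln (- \<i> * w)) / pi"
    unfolding eq by (simp only: plus_complex.sel Re_divide_of_real) simp
  show "Im (plane_strip w) = - ln (norm w) / pi" if "w \<noteq> 0"
    unfolding eq using that by (simp only: plus_complex.sel Im_divide_of_real) (simp add: norm_mult)
qed

lemma plane_strip_boundary:
  "plane_strip (of_real (exp (- pi * y))) = \<i> * of_real y"
  "plane_strip (of_real (- exp (- pi * y))) = 1 + \<i> * of_real y"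
proof -
  have "- \<i> * of_real (exp (- pi * y)) = exp (of_real (- pi * y) - \<i> * of_real (pi / 2))"
    unfolding exp_diff exp_of_real cis_conv_exp[symmetric] by (simp add: field_simps)
  also have "Ln \<dots> = of_real (- pi * y) - \<i> * of_real (pi / 2)"
    by (rule Ln_exp) (simp_all, use pi_gt_zero in linarith)
  finally show "plane_strip (of_real (exp (- pi * y))) = \<i> * of_real y"
    by (simp add: plane_strip_def field_simps)
  have "- \<i> * of_real (- exp (- pi * y)) = exp (of_real (- pi * y) + \<i> * of_real (pi / 2))"
    unfolding exp_add exp_of_real cis_conv_exp[symmetric] by simp
  also have "Ln \<dots> = of_real (- pi * y) + \<i> * of_real (pi / 2)" by (rule Ln_exp) auto
  finally show "plane_strip (of_real (- exp (- pi * y))) = 1 + \<i> * of_real y"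
    by (simp add: plane_strip_def field_simps)
qed

definition disc_strip :: "real \<Rightarrow> complex \<Rightarrow> complex" where
  "disc_strip \<theta> \<zeta> = plane_strip (disc_plane \<theta> \<zeta>)"

lemma Im_disc_plane_pos:
  assumes "0 < \<theta>" "\<theta> < 1" "norm \<zeta> < 1"
  shows "0 < Im (disc_plane \<theta> \<zeta>)"
proof -
  define a where "a = cis (pi * \<theta>)"
  have ne: "1 - \<zeta> \<noteq> 0" using assms(3) by auto
  have "disc_plane \<theta> \<zeta> = ((a - cnj a * \<zeta>) * cnj (1 - \<zeta>)) / ((1 - \<zeta>) * cnj (1 - \<zeta>))"
    using ne by (simp add: disc_plane_def a_def)
  also have "(1 - \<zeta>) * cnj (1 - \<zeta>) = of_real ((norm (1 - \<zeta>))\<^sup>2)"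
    by (simp only: complex_norm_square)
  finally have "Im (disc_plane \<theta> \<zeta>) = Im ((a - cnj a * \<zeta>) * cnj (1 - \<zeta>)) / (norm (1 - \<zeta>))\<^sup>2"
    by (simp only: Im_divide_of_real)
  also have "Im ((a - cnj a * \<zeta>) * cnj (1 - \<zeta>)) = Im a * (1 - (norm \<zeta>)\<^sup>2)"
    unfolding cmod_power2 by (simp add: power2_eq_square algebra_simps)
  also have "\<dots> / (norm (1 - \<zeta>))\<^sup>2 > 0"
    using ne sin_pi_pos[OF assms(1,2)] assms(3) by (auto simp: a_def power_less_one_iff abs_square_less_1)
  finally show ?thesis .
qed

lemma disc_strip_mem:
  assumes "0 < \<theta>" "\<theta> < 1" "norm \<zeta> < 1"
  shows "disc_strip \<theta> \<zeta> \<in> open_strip"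
proof -
  define v where "v = - \<i> * disc_plane \<theta> \<zeta>"
  have v: "Re v > 0" using Im_disc_plane_pos[OF assms] by (simp add: v_def)
  then have "\<bar>Im (Ln v)\<bar> < pi / 2" by (rule Re_Ln_pos_lt_imp)
  then have "- 1 / 2 < Im (Ln v) / pi" "Im (Ln v) / pi < 1 / 2"
    by (auto simp: field_simps abs_less_iff)
  moreover have "Re (disc_strip \<theta> \<zeta>) = 1 / 2 + Im (Ln v) / pi"
    by (simp add: disc_strip_def v_def plane_strip_Re_Im(1))
  ultimately show ?thesis unfolding open_strip_def mem_Collect_eq by linarith
qed

lemma disc_strip_holomorphic:
  assumes "0 < \<theta>" "\<theta> < 1"
  shows "disc_strip \<theta> holomorphic_on ball 0 1"
proof -
  have "- \<i> * disc_plane \<theta> \<zeta> \<notin> \<real>\<^sub>\<le>\<^sub>0" if "norm \<zeta> < 1" for \<zeta>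
    using Im_disc_plane_pos[OF assms that] by (auto simp: complex_nonpos_Reals_iff)
  moreover have "(\<lambda>\<zeta>. disc_plane \<theta> \<zeta>) holomorphic_on ball 0 1"
    unfolding disc_plane_def by (intro holomorphic_intros) auto
  ultimately show ?thesis
    unfolding disc_strip_def[abs_def] plane_strip_def by (intro holomorphic_intros) auto
qed

lemma disc_strip_0:
  assumes "0 < \<theta>" "\<theta> < 1"
  shows "disc_strip \<theta> 0 = of_real \<theta>"
proof -
  have "- \<i> * disc_plane \<theta> 0 = exp (\<i> * of_real (pi * \<theta> - pi / 2))"
    unfolding cis_conv_exp[symmetric] by (simp add: disc_plane_def complex_eq_iff cos_diff sin_diff)
  also have "Ln \<dots> = \<i> * of_real (pi * \<theta> - pi / 2)"
    by (rule Ln_exp) (use assms mult_pos_pos[OF pi_gt_zero assms(1)] mult_strict_left_mono[OF assms(2) pi_gt_zero] pi_gt_zero in \<open>simp_all, linarith+\<close>)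
  finally show ?thesis by (simp add: disc_strip_def plane_strip_def field_simps)
qed

lemma cis_strip_angle:
  assumes "0 < \<theta>" "\<theta> < 1"
  shows "cis (strip_angle \<sigma> \<theta> y) * (of_real (\<sigma> * exp (- pi * y)) - cnj (cis (pi * \<theta>))) = of_real (\<sigma> * exp (- pi * y)) - cis (pi * \<theta>)"
proof -
  define c s v where "c = cos (pi * \<theta>)" and "s = sin (pi * \<theta>)" and "v = \<sigma> * exp (- pi * y)"
  define x where "x = (v - c) / s"
  have s: "s > 0" using sin_pi_pos[OF assms] by (simp add: s_def)
  have xs: "x * s = v - c" using s by (simp add: x_def)
  define P where "P = 1 + x\<^sup>2"
  have P: "P > 0" by (simp add: P_def add_pos_nonneg)
  have sq: "sqrt P * sqrt P = P" using P by simp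
  have C: "cos (strip_angle \<sigma> \<theta> y) * P = x\<^sup>2 - 1"
  proof -
    have "cos (strip_angle \<sigma> \<theta> y) = 1 - 2 * (cos (arctan x))\<^sup>2"
      by (simp add: strip_angle_def x_def v_def c_def s_def cos_double_cos)
    also have "\<dots> = 1 - 2 / P" using P by (simp add: cos_arctan P_def power_divide)
    finally show ?thesis using P by (simp add: left_diff_distrib) (simp add: P_def)
  qed
  have S: "sin (strip_angle \<sigma> \<theta> y) * P = - 2 * x"
  proof -
    have "sin (strip_angle \<sigma> \<theta> y) = - 2 * (sin (arctan x) * cos (arctan x))"
      by (simp add: strip_angle_def x_def v_def c_def s_def sin_double)
    also have "\<dots> = - 2 * (x / P)" using P sq by (simp add: cos_arctan sin_arctan P_def)
    finally show ?thesis using P by simp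
  qed
  have "P * (cos (strip_angle \<sigma> \<theta> y) * (x * s) - sin (strip_angle \<sigma> \<theta> y) * s) = (cos (strip_angle \<sigma> \<theta> y) * P) * (x * s) - (sin (strip_angle \<sigma> \<theta> y) * P) * s"
    by (simp add: algebra_simps)
  also have "\<dots> = P * (x * s)" unfolding C S by (simp add: P_def algebra_simps power2_eq_square)
  finally have R: "cos (strip_angle \<sigma> \<theta> y) * (x * s) - sin (strip_angle \<sigma> \<theta> y) * s = x * s" using P by simp
  have "P * (cos (strip_angle \<sigma> \<theta> y) * s + sin (strip_angle \<sigma> \<theta> y) * (x * s)) = (cos (strip_angle \<sigma> \<theta> y) * P) * s + (sin (strip_angle \<sigma> \<theta> y) * P) * (x * s)"
    by (simp add: algebra_simps)
  also have "\<dots> = P * (- s)" unfolding C S by (simp add: P_def algebra_simps power2_eq_square)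
  finally have I: "cos (strip_angle \<sigma> \<theta> y) * s + sin (strip_angle \<sigma> \<theta> y) * (x * s) = - s" using P by (subst (asm) mult_left_cancel) auto
  have v: "v = x * s + c" using xs by simp
  have "cis (strip_angle \<sigma> \<theta> y) * (of_real v - cnj (cis (pi * \<theta>))) = of_real v - cis (pi * \<theta>)"
    using R I unfolding v by (simp add: complex_eq_iff c_def[symmetric] s_def[symmetric])
  then show ?thesis by (simp add: v_def)
qed


lemma cis_strip_angle_ne_1: "cis (strip_angle \<sigma> \<theta> y) \<noteq> 1"
proof
  assume "cis (strip_angle \<sigma> \<theta> y) = 1"
  then have "cos (strip_angle \<sigma> \<theta> y) = 1" by (metis cis.sel(1) one_complex.sel(1))
  then have "(sin (strip_angle \<sigma> \<theta> y / 2))\<^sup>2 = 0"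
    using cos_double_sin[of "strip_angle \<sigma> \<theta> y / 2"] by simp
  moreover have "0 < sin (strip_angle \<sigma> \<theta> y / 2)"
    using strip_angle_bounds[of \<sigma> \<theta> y] by (intro sin_gt_zero) auto
  ultimately show False by simp
qed

lemma
  assumes "0 < \<theta>" "\<theta> < 1"
  shows disc_plane_cis_strip_angle: "disc_plane \<theta> (cis (strip_angle \<sigma> \<theta> y)) = of_real (\<sigma> * exp (- pi * y))"
    and norm_one_minus_cis: "norm (1 - cis (strip_angle \<sigma> \<theta> y)) * (\<bar>\<sigma>\<bar> * exp (- pi * y) + 1) \<ge> 2 * sin (pi * \<theta>)"
    and norm_plane_numerator: "norm (cis (pi * \<theta>) - cnj (cis (pi * \<theta>)) * cis (strip_angle \<sigma> \<theta> y)) = \<bar>\<sigma>\<bar> * exp (- pi * y) * norm (1 - cis (strip_angle \<sigma> \<theta> y))"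
proof -
  define a \<zeta> s where "a = cis (pi * \<theta>)" and "\<zeta> = cis (strip_angle \<sigma> \<theta> y)" and "s = complex_of_real (\<sigma> * exp (- pi * y))"
  have eq: "\<zeta> * (s - cnj a) = s - a" using cis_strip_angle[OF assms, of \<sigma> y] by (simp add: a_def s_def \<zeta>_def)
  have ne: "1 - \<zeta> \<noteq> 0" using cis_strip_angle_ne_1[of \<sigma> \<theta> y] by (simp add: \<zeta>_def)
  have eq2: "a - cnj a * \<zeta> = s * (1 - \<zeta>)" using eq by (simp add: algebra_simps)
  show "disc_plane \<theta> (cis (strip_angle \<sigma> \<theta> y)) = of_real (\<sigma> * exp (- pi * y))"
    using eq2 ne unfolding disc_plane_def a_def[symmetric] \<zeta>_def[symmetric] s_def[symmetric] by simp
  have ns: "norm s = \<bar>\<sigma>\<bar> * exp (- pi * y)" unfolding s_def norm_of_real by (simp add: abs_mult)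
  show "norm (cis (pi * \<theta>) - cnj (cis (pi * \<theta>)) * cis (strip_angle \<sigma> \<theta> y)) = \<bar>\<sigma>\<bar> * exp (- pi * y) * norm (1 - cis (strip_angle \<sigma> \<theta> y))"
    using eq2 ns unfolding a_def[symmetric] \<zeta>_def[symmetric] by (simp add: norm_mult)
  have "2 * sin (pi * \<theta>) = norm (a - cnj a)"
  proof -
    have "a - cnj a = \<i> * of_real (2 * sin (pi * \<theta>))" by (simp add: a_def complex_eq_iff)
    then show ?thesis using sin_pi_pos[OF assms] by (simp only: norm_mult norm_of_real) simp
  qed
  also have "a - cnj a = (1 - \<zeta>) * (s - cnj a)" using eq by (simp add: algebra_simps)
  also have "norm \<dots> \<le> norm (1 - \<zeta>) * (norm s + norm (cnj a))"
    unfolding norm_mult by (intro mult_left_mono norm_triangle_ineq4) auto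
  finally show "norm (1 - cis (strip_angle \<sigma> \<theta> y)) * (\<bar>\<sigma>\<bar> * exp (- pi * y) + 1) \<ge> 2 * sin (pi * \<theta>)"
    by (simp add: ns a_def \<zeta>_def)
qed

section \<open>Hirschman's lemma\<close>

lemma norm_one_minus_scaled_ge:
  fixes \<zeta> a b :: complex
  assumes "norm \<zeta> = 1" "0 \<le> \<rho>" "\<rho> \<le> 1" "norm a = 1" "norm b = 1"
  shows "norm (a - b * \<zeta>) / 2 \<le> norm (a - b * (of_real \<rho> * \<zeta>))"
proof -
  have "norm (a - b * \<zeta>) \<le> norm (a - b * (of_real \<rho> * \<zeta>)) + norm (b * (of_real \<rho> * \<zeta>) - b * \<zeta>)"
    using norm_triangle_ineq[of "a - b * (of_real \<rho> * \<zeta>)" "b * (of_real \<rho> * \<zeta>) - b * \<zeta>"] by simp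
  also have "norm (b * (of_real \<rho> * \<zeta>) - b * \<zeta>) = 1 - \<rho>"
  proof -
    have "b * (of_real \<rho> * \<zeta>) - b * \<zeta> = b * \<zeta> * of_real (\<rho> - 1)" by (simp add: algebra_simps)
    then show ?thesis using assms by (simp only: norm_mult norm_of_real) simp
  qed
  also have "1 - \<rho> \<le> norm (a - b * (of_real \<rho> * \<zeta>))"
    using norm_triangle_ineq2[of a "b * (of_real \<rho> * \<zeta>)"] assms by (simp add: norm_mult)
  finally show ?thesis by simp
qed

text \<open>
  Along a radius the absolute value of the imaginary part exceeds that of its boundary value
  \<open>y\<close> at most by a constant. Hence the growth bound on the strip yields a majorant on the
  edges that is independent of the radius. The reason is that \<open>\<bar>a - b \<rho> \<zeta>\<bar> \<ge> \<bar>a - b \<zeta>\<bar> / 2\<close>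
  for unimodular \<open>a, b, \<zeta>\<close>, applied to numerator and denominator of the inverse Cayley
  transform.
\<close>
lemma abs_Im_disc_strip_le:
  assumes \<theta>: "0 < \<theta>" "\<theta> < 1" and \<sigma>: "\<bar>\<sigma>\<bar> = 1" and \<rho>: "0 \<le> \<rho>" "\<rho> < 1"
  shows "\<bar>Im (disc_strip \<theta> (of_real \<rho> * cis (strip_angle \<sigma> \<theta> y)))\<bar> \<le> \<bar>y\<bar> + ln (4 / sin (pi * \<theta>)) / pi"
proof -
  define a \<zeta> e where "a = cis (pi * \<theta>)" and "\<zeta> = cis (strip_angle \<sigma> \<theta> y)" and "e = exp (- pi * y)"
  define w where "w = disc_plane \<theta> (of_real \<rho> * \<zeta>)"
  define N D where "N = norm (a - cnj a * (of_real \<rho> * \<zeta>))" and "D = norm (1 - of_real \<rho> * \<zeta>)"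
  define S where "S = sin (pi * \<theta>)"
  have S: "S > 0" using sin_pi_pos[OF \<theta>] by (simp add: S_def)
  have na: "norm a = 1" "norm (cnj a) = 1" "norm \<zeta> = 1" by (auto simp: a_def \<zeta>_def)
  have e: "e > 0" by (simp add: e_def)
  have e2: "e \<le> exp (pi * \<bar>y\<bar>)" "1 / e \<le> exp (pi * \<bar>y\<bar>)" "1 \<le> exp (pi * \<bar>y\<bar>)"
    by (auto simp: e_def exp_minus[symmetric] inverse_eq_divide[symmetric] abs_if zero_le_mult_iff)
  have 1: "2 * S \<le> norm (1 - \<zeta>) * (e + 1)"
    using norm_one_minus_cis[OF \<theta>, of \<sigma> y] \<sigma> by (simp add: S_def \<zeta>_def e_def)
  have 2: "norm (a - cnj a * \<zeta>) = e * norm (1 - \<zeta>)"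
    using norm_plane_numerator[OF \<theta>, of \<sigma> y] \<sigma> by (simp add: a_def \<zeta>_def e_def)
  have N: "N \<ge> e * norm (1 - \<zeta>) / 2" 
    using norm_one_minus_scaled_ge[of \<zeta> \<rho> a "cnj a"] na \<rho> 2 by (simp add: N_def)
  have D: "D \<ge> norm (1 - \<zeta>) / 2"
    using norm_one_minus_scaled_ge[of \<zeta> \<rho> 1 1] na \<rho> by (simp add: D_def)
  have z1: "norm (1 - \<zeta>) \<ge> 2 * S / (e + 1)" using 1 e by (simp add: field_simps)
  have zpos: "0 < 2 * S / (e + 1)" using S e by simp
  have D1: "S / (e + 1) \<le> D" using D z1 by simp
  have "e * S / (e + 1) = e * (2 * S / (e + 1)) / 2" using e by (simp add: field_simps)
  also have "\<dots> \<le> e * norm (1 - \<zeta>) / 2" using z1 e by (intro divide_right_mono mult_left_mono) auto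
  finally have N1: "e * S / (e + 1) \<le> N" using N by (rule order_trans)
  have N2: "N \<le> 2"
  proof -
    have "N \<le> norm a + norm (cnj a * (of_real \<rho> * \<zeta>))" unfolding N_def by (rule norm_triangle_ineq4)
    also have "\<dots> \<le> 2" unfolding norm_mult na norm_of_real using \<rho> by simp
    finally show ?thesis .
  qed
  have D2: "D \<le> 2"
  proof -
    have "D \<le> norm (1::complex) + norm (of_real \<rho> * \<zeta>)" unfolding D_def by (rule norm_triangle_ineq4)
    also have "\<dots> \<le> 2" unfolding norm_mult na norm_of_real using \<rho> by simp
    finally show ?thesis .
  qed
  have nw: "norm w = N / D" by (simp add: w_def disc_plane_def N_def D_def norm_divide a_def)
  have pos: "0 < S / (e + 1)" "0 < e * S / (e + 1)" using S e by auto
  have Np: "N > 0" and Dp: "D > 0" using N1 D1 pos by linarith+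
  have "norm w \<le> 2 / (S / (e + 1))" unfolding nw using N2 D1 pos Np by (intro frac_le) auto
  also have "\<dots> = 2 / S * (e + 1)" using S e by simp
  also have "\<dots> \<le> 2 / S * (2 * exp (pi * \<bar>y\<bar>))" using S add_mono[OF e2(1,3)] add_mono[OF e2(3,2)] by (intro mult_left_mono) auto
  finally have w1: "norm w \<le> 4 / S * exp (pi * \<bar>y\<bar>)" by simp
  have "1 / norm w = D / N" by (simp add: nw)
  also have "\<dots> \<le> 2 / (e * S / (e + 1))" using D2 N1 pos Dp by (intro frac_le) auto
  also have "\<dots> = 2 / S * (1 + 1 / e)" using S e by (simp add: field_simps)
  also have "\<dots> \<le> 2 / S * (2 * exp (pi * \<bar>y\<bar>))" using S add_mono[OF e2(1,3)] add_mono[OF e2(3,2)] by (intro mult_left_mono) auto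
  finally have w2: "1 / norm w \<le> 4 / S * exp (pi * \<bar>y\<bar>)" by simp
  have wpos: "norm w > 0" using Np Dp nw by simp
  have L: "ln (4 / S * exp (pi * \<bar>y\<bar>)) = ln (4 / S) + pi * \<bar>y\<bar>"
    using S by (subst ln_mult_pos) auto
  have "ln (norm w) \<le> ln (4 / S * exp (pi * \<bar>y\<bar>))"
    using w1 wpos by (intro ln_mono) auto
  moreover have "ln (1 / norm w) \<le> ln (4 / S * exp (pi * \<bar>y\<bar>))"
    using w2 wpos S by (intro ln_mono) auto
  moreover have "ln (1 / norm w) = - ln (norm w)" using wpos by (simp add: ln_div)
  ultimately have "\<bar>ln (norm w)\<bar> \<le> ln (4 / S) + pi * \<bar>y\<bar>"
    unfolding L by linarith
  then have "\<bar>ln (norm w)\<bar> / pi \<le> (ln (4 / S) + pi * \<bar>y\<bar>) / pi" by (intro divide_right_mono) auto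
  then show ?thesis
    using wpos unfolding disc_strip_def w_def[symmetric] \<zeta>_def[symmetric] S_def[symmetric]
    by (subst plane_strip_Re_Im(2)) (auto simp: add_divide_distrib)
qed

lemma disc_strip_radial_limit:
  assumes \<theta>: "0 < \<theta>" "\<theta> < 1" and \<sigma>: "\<bar>\<sigma>\<bar> = 1" and lim: "\<rho> \<longlonglongrightarrow> 1"
  shows "(\<lambda>n. disc_strip \<theta> (of_real (\<rho> n) * cis (strip_angle \<sigma> \<theta> y))) \<longlonglongrightarrow> plane_strip (of_real (\<sigma> * exp (- pi * y)))"
proof -
  have ne: "1 - of_real 1 * cis (strip_angle \<sigma> \<theta> y) \<noteq> 0" using cis_strip_angle_ne_1[of \<sigma> \<theta> y] by simp
  have "(\<lambda>n. disc_plane \<theta> (of_real (\<rho> n) * cis (strip_angle \<sigma> \<theta> y))) \<longlonglongrightarrow> disc_plane \<theta> (of_real 1 * cis (strip_angle \<sigma> \<theta> y))"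
    unfolding disc_plane_def using ne lim by (intro tendsto_intros) auto
  then have L: "(\<lambda>n. disc_plane \<theta> (of_real (\<rho> n) * cis (strip_angle \<sigma> \<theta> y))) \<longlonglongrightarrow> of_real (\<sigma> * exp (- pi * y))"
    using disc_plane_cis_strip_angle[OF \<theta>, of \<sigma> y] by simp
  have "- \<i> * of_real (\<sigma> * exp (- pi * y)) \<notin> \<real>\<^sub>\<le>\<^sub>0"
    using \<sigma> by (auto simp: complex_nonpos_Reals_iff)
  then show ?thesis
    unfolding disc_strip_def plane_strip_def using L by (intro tendsto_intros) auto
qed

text \<open>
  Jensen's inequality on the circles of radius \<open>\<rho> < 1\<close>, transported to the edges, and
  dominated convergence as \<open>\<rho> \<rightarrow> 1\<close>. The truncated logarithm is bounded below by \<open>ln \<eta>\<close> and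
  above by the growth bound.
\<close>
lemma hirschman_lemma:
  fixes F :: "complex \<Rightarrow> complex"
  assumes \<theta>: "0 < \<theta>" "\<theta> < 1" and hol: "F holomorphic_on open_strip" and cont: "continuous_on (closure open_strip) F"
    and \<gamma>: "0 \<le> \<gamma>" "\<gamma> < pi" and growth: "\<And>z. z \<in> closure open_strip \<Longrightarrow> norm (F z) \<le> exp (C * exp (\<gamma> * \<bar>Im z\<bar>))"
    and nz: "F (of_real \<theta>) \<noteq> 0" and \<eta>: "\<eta> > 0"
  shows "integrable lborel (\<lambda>y. half_poisson (1 - \<theta>) y * ln (max (norm (F (\<i> * of_real y))) \<eta>))"
    and "integrable lborel (\<lambda>y. half_poisson \<theta> y * ln (max (norm (F (1 + \<i> * of_real y))) \<eta>))"
    and "ln (norm (F (of_real \<theta>))) \<le>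
      (LBINT y. half_poisson (1 - \<theta>) y * ln (max (norm (F (\<i> * of_real y))) \<eta>)) +
      (LBINT y. half_poisson \<theta> y * ln (max (norm (F (1 + \<i> * of_real y))) \<eta>))"
proof -
  have \<theta>': "0 < 1 - \<theta>" "1 - \<theta> < 1" using \<theta> by auto
  define G where "G = (\<lambda>\<zeta>. F (disc_strip \<theta> \<zeta>))"
  define u where "u = (\<lambda>z. ln (max (norm (F z)) \<eta>))"
  define K where "K = ln (4 / sin (pi * \<theta>)) / pi"
  define E where "E = \<bar>ln \<eta>\<bar> + \<bar>C\<bar> * exp (\<gamma> * K)"
  have Gh: "G holomorphic_on ball 0 1"
    unfolding G_def using holomorphic_on_compose_gen[OF disc_strip_holomorphic[OF \<theta>] hol] disc_strip_mem[OF \<theta>]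
    by (force simp: o_def)
  have uc: "continuous_on (closure open_strip) u"
    unfolding u_def using \<eta> by (intro continuous_on_ln continuous_on_max continuous_intros cont) (auto simp: max_def)
  have ub: "\<bar>u z\<bar> \<le> \<bar>ln \<eta>\<bar> + \<bar>C\<bar> * exp (\<gamma> * \<bar>Im z\<bar>)" if "z \<in> closure open_strip" for z
  proof -
    have "ln \<eta> \<le> u z" using \<eta> by (simp add: u_def)
    moreover have "u z \<le> \<bar>ln \<eta>\<bar> + \<bar>C\<bar> * exp (\<gamma> * \<bar>Im z\<bar>)"
    proof (cases "norm (F z) \<le> \<eta>")
      case True
      then have "u z = ln \<eta>" by (simp add: u_def)
      then show ?thesis by (simp add: add_increasing2)
    next
      case False
      then have "norm (F z) > 0" using \<eta> by linarith
      then have "ln (norm (F z)) \<le> ln (exp (C * exp (\<gamma> * \<bar>Im z\<bar>)))" using growth[OF that] by (intro ln_mono) auto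
      then have "u z \<le> ln (exp (C * exp (\<gamma> * \<bar>Im z\<bar>)))" using False by (simp add: u_def max_def)
      also have "\<dots> \<le> \<bar>C\<bar> * exp (\<gamma> * \<bar>Im z\<bar>)" by (simp add: mult_right_mono)
      finally show ?thesis by simp
    qed
    ultimately show ?thesis by (auto simp: abs_le_iff add_increasing2 intro: order_trans)
  qed
  \<comment> \<open>Radii increasing to \<open>1\<close>; \<open>v n\<close> is the truncated logarithm on the circle of radius
    \<open>\<rho> n\<close>, seen from the edges, and \<open>w\<close> is its boundary value.\<close>
  define \<rho> :: "nat \<Rightarrow> real" where "\<rho> = (\<lambda>n. 1 - 1 / (real n + 1))"
  have \<rho>: "0 \<le> \<rho> n" "\<rho> n < 1" for n by (auto simp: \<rho>_def)
  have \<rho>lim: "\<rho> \<longlonglongrightarrow> 1"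
    unfolding \<rho>_def by real_asymp
  define v where "v = (\<lambda>n \<sigma> y. u (disc_strip \<theta> (of_real (\<rho> n) * cis (strip_angle \<sigma> \<theta> y))))"
  have mem: "norm (of_real (\<rho> n) * \<zeta>) < 1" if "norm \<zeta> \<le> 1" for n and \<zeta> :: complex
  proof -
    have "norm (of_real (\<rho> n) * \<zeta>) \<le> \<rho> n * 1"
      unfolding norm_mult using \<rho>[of n] that by (intro mult_mono) auto
    then show ?thesis using \<rho>[of n] by simp
  qed
  have vb: "\<bar>v n \<sigma> y\<bar> \<le> E * exp (\<gamma> * \<bar>y\<bar>)" if \<sigma>: "\<bar>\<sigma>\<bar> = 1" for n \<sigma> y
  proof -
    let ?z = "disc_strip \<theta> (of_real (\<rho> n) * cis (strip_angle \<sigma> \<theta> y))"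
    have "?z \<in> closure open_strip" using subsetD[OF closure_subset disc_strip_mem[OF \<theta> mem]] by simp
    then have "\<bar>v n \<sigma> y\<bar> \<le> \<bar>ln \<eta>\<bar> + \<bar>C\<bar> * exp (\<gamma> * \<bar>Im ?z\<bar>)" unfolding v_def by (rule ub)
    also have "\<dots> \<le> \<bar>ln \<eta>\<bar> * exp (\<gamma> * \<bar>y\<bar>) + \<bar>C\<bar> * exp (\<gamma> * (\<bar>y\<bar> + K))"
    proof (rule add_mono)
      show "\<bar>ln \<eta>\<bar> \<le> \<bar>ln \<eta>\<bar> * exp (\<gamma> * \<bar>y\<bar>)" using \<gamma> by (intro mult_le_cancel_left1[THEN iffD2]) auto
      show "\<bar>C\<bar> * exp (\<gamma> * \<bar>Im ?z\<bar>) \<le> \<bar>C\<bar> * exp (\<gamma> * (\<bar>y\<bar> + K))"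
        using abs_Im_disc_strip_le[OF \<theta> \<sigma> \<rho>, of n y] \<gamma> unfolding K_def
        by (intro mult_left_mono) (auto intro!: mult_left_mono)
    qed
    also have "\<dots> = E * exp (\<gamma> * \<bar>y\<bar>)" by (simp add: E_def distrib_left exp_add algebra_simps)
    finally show ?thesis .
  qed
  have cv: "continuous_on UNIV (v n \<sigma>)" for n \<sigma>
    unfolding v_def
  proof (rule continuous_on_compose2[OF uc])
    show "continuous_on UNIV (\<lambda>y. disc_strip \<theta> (of_real (\<rho> n) * cis (strip_angle \<sigma> \<theta> y)))"
      by (rule continuous_on_compose2[OF holomorphic_on_imp_continuous_on[OF disc_strip_holomorphic[OF \<theta>]]])
         (auto intro!: continuous_intros continuous_strip_angle[OF \<theta>] mem[simplified])
  qed (use subsetD[OF closure_subset disc_strip_mem[OF \<theta> mem]] in auto)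
  define w where "w = (\<lambda>\<sigma> y. u (plane_strip (of_real (\<sigma> * exp (- pi * y)))))"
  have w1: "w 1 y = u (\<i> * of_real y)" and w2: "w (-1) y = u (1 + \<i> * of_real y)" for y
    using plane_strip_boundary[of y] by (simp_all add: w_def)
  have mw: "w 1 \<in> borel_measurable borel" "w (-1) \<in> borel_measurable borel"
  proof -
    have "continuous_on UNIV (\<lambda>y. u (\<i> * of_real y))" "continuous_on UNIV (\<lambda>y. u (1 + \<i> * of_real y))"
      by (rule continuous_on_compose2[OF uc]; auto intro!: continuous_intros simp: closure_open_strip)+
    then show "w 1 \<in> borel_measurable borel" "w (-1) \<in> borel_measurable borel"
      unfolding w1[abs_def] w2[abs_def] by (auto intro: borel_measurable_continuous_onI)
  qed
  have mv: "v n \<sigma> \<in> borel_measurable borel" for n \<sigma> by (intro borel_measurable_continuous_onI cv)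
  have vlim: "(\<lambda>n. v n \<sigma> y) \<longlonglongrightarrow> w \<sigma> y" if \<sigma>: "\<sigma> = 1 \<or> \<sigma> = -1" for \<sigma> y
  proof -
    have "plane_strip (of_real (\<sigma> * exp (- pi * y))) \<in> closure open_strip"
      using \<sigma> plane_strip_boundary[of y] by (auto simp: closure_open_strip)
    then show ?thesis
      unfolding v_def w_def
      by (intro continuous_on_tendsto_compose[OF uc disc_strip_radial_limit[OF \<theta> _ \<rho>lim]])
         (use \<sigma> subsetD[OF closure_subset disc_strip_mem[OF \<theta> mem]] in auto)
  qed
  have dom: "integrable lborel (\<lambda>y. half_poisson t y * (E * exp (\<gamma> * \<bar>y\<bar>)))" if "0 < t" "t < 1" for t
    using integrable_half_poisson_exp[OF that \<gamma>(2)] by (simp add: mult.left_commute)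
  have DC: "integrable lborel (\<lambda>y. half_poisson t y * w \<sigma> y) \<and>
      (\<lambda>n. LBINT y. half_poisson t y * v n \<sigma> y) \<longlonglongrightarrow> (LBINT y. half_poisson t y * w \<sigma> y)"
    if t: "0 < t" "t < 1" and \<sigma>: "\<sigma> = 1 \<or> \<sigma> = -1" for t \<sigma>
  proof -
    have m: "(\<lambda>y. half_poisson t y * w \<sigma> y) \<in> borel_measurable lborel"
      "(\<lambda>y. half_poisson t y * v n \<sigma> y) \<in> borel_measurable lborel" for n
      using \<sigma> mw mv by auto
    have l: "AE y in lborel. (\<lambda>n. half_poisson t y * v n \<sigma> y) \<longlonglongrightarrow> half_poisson t y * w \<sigma> y"
      using vlim[OF \<sigma>] by (auto intro!: tendsto_intros)
    have b: "AE y in lborel. norm (half_poisson t y * v n \<sigma> y) \<le> half_poisson t y * (E * exp (\<gamma> * \<bar>y\<bar>))" for n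
    proof (rule AE_I2)
      fix y
      have "\<bar>v n \<sigma> y\<bar> \<le> E * exp (\<gamma> * \<bar>y\<bar>)" using vb[of \<sigma> n y] \<sigma> by auto
      then show "norm (half_poisson t y * v n \<sigma> y) \<le> half_poisson t y * (E * exp (\<gamma> * \<bar>y\<bar>))"
        using half_poisson_pos[OF t, of y] by (simp add: abs_mult)
    qed
    show ?thesis
      using integrable_dominated_convergence[OF m(1) m(2) dom[OF t] l b]
        integral_dominated_convergence[OF m(1) m(2) dom[OF t] l b] by blast
  qed
  show "integrable lborel (\<lambda>y. half_poisson (1 - \<theta>) y * ln (max (norm (F (\<i> * of_real y))) \<eta>))"
    using DC[OF \<theta>', of 1] by (simp add: w1 u_def)
  show "integrable lborel (\<lambda>y. half_poisson \<theta> y * ln (max (norm (F (1 + \<i> * of_real y))) \<eta>))"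
    using DC[OF \<theta>, of "-1"] by (simp add: w2 u_def)
  have J: "ln (norm (F (of_real \<theta>))) \<le> (LBINT y. half_poisson (1 - \<theta>) y * v n 1 y) + (LBINT y. half_poisson \<theta> y * v n (-1) y)" for n
  proof -
    define H where "H = (\<lambda>\<zeta>. G (of_real (\<rho> n) * \<zeta>))"
    have Hh: "H holomorphic_on cball 0 1"
      unfolding H_def
      by (rule holomorphic_on_compose_gen[OF _ Gh, unfolded o_def]) (auto intro!: holomorphic_intros mem[simplified])
    have H0: "H 0 = F (of_real \<theta>)" by (simp add: H_def G_def disc_strip_0[OF \<theta>])
    have Hc: "continuous_on (cball 0 1) H" using Hh by (rule holomorphic_on_imp_continuous_on)
    have "2 * pi * ln (norm (H 0)) \<le> integral {0..2*pi} (\<lambda>t. ln (max (norm (H (cis t))) \<eta>))"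
      by (rule jensen_inequality_disc) (use Hh Hc H0 nz \<eta> in \<open>auto intro: holomorphic_on_subset\<close>)
    also have "\<dots> = 2 * pi * ((LBINT y. half_poisson (1 - \<theta>) y * ln (max (norm (H (cis (strip_angle 1 \<theta> y)))) \<eta>)) +
           (LBINT y. half_poisson \<theta> y * ln (max (norm (H (cis (strip_angle (-1) \<theta> y)))) \<eta>)))"
    proof (rule circle_integral_as_line_integrals[OF \<theta>])
      have "continuous_on {0..2*pi} (\<lambda>t. H (cis t))"
        by (rule continuous_on_compose2[OF Hc]) (auto intro!: continuous_intros)
      then show "continuous_on {0..2*pi} (\<lambda>t. ln (max (norm (H (cis t))) \<eta>))"
        using \<eta> by (intro continuous_on_ln continuous_on_max continuous_intros) (auto simp: max_def)
    qed
    also have "\<dots> = 2 * pi * ((LBINT y. half_poisson (1 - \<theta>) y * v n 1 y) + (LBINT y. half_poisson \<theta> y * v n (-1) y))"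
      by (simp add: v_def u_def H_def G_def)
    finally show ?thesis by (simp add: H0)
  qed
  have "(\<lambda>n. (LBINT y. half_poisson (1 - \<theta>) y * v n 1 y) + (LBINT y. half_poisson \<theta> y * v n (-1) y)) \<longlonglongrightarrow>
    (LBINT y. half_poisson (1 - \<theta>) y * w 1 y) + (LBINT y. half_poisson \<theta> y * w (-1) y)"
    using DC[OF \<theta>', of 1] DC[OF \<theta>, of "-1"] by (intro tendsto_add) auto
  then have "ln (norm (F (of_real \<theta>))) \<le> (LBINT y. half_poisson (1 - \<theta>) y * w 1 y) + (LBINT y. half_poisson \<theta> y * w (-1) y)"
    by (rule LIMSEQ_le_const) (use J in auto)
  then show "ln (norm (F (of_real \<theta>))) \<le>
      (LBINT y. half_poisson (1 - \<theta>) y * ln (max (norm (F (\<i> * of_real y))) \<eta>)) +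
      (LBINT y. half_poisson \<theta> y * ln (max (norm (F (1 + \<i> * of_real y))) \<eta>))"
    by (simp add: w1 w2 u_def)
qed

section \<open>Averages over finite partitions\<close>

text \<open>
  Null cells are discarded, so that all means are honest averages; therefore the cells cover
  the space only up to a null set.
\<close>
definition cell_partition :: "'a measure \<Rightarrow> 'a set set \<Rightarrow> bool" where
  "cell_partition \<nu> P \<longleftrightarrow> finite P \<and> P \<subseteq> sets \<nu> \<and> disjoint P \<and> (\<forall>A\<in>P. 0 < measure \<nu> A) \<and> (AE x in \<nu>. x \<in> \<Union>P)"

definition cell_mean :: "'a measure \<Rightarrow> ('a \<Rightarrow> complex) \<Rightarrow> 'a set \<Rightarrow> complex" where
  "cell_mean \<nu> f A = (LINT x|\<nu>. indicator A x *\<^sub>R f x) / of_real (measure \<nu> A)"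

definition cell_average :: "'a measure \<Rightarrow> 'a set set \<Rightarrow> ('a \<Rightarrow> complex) \<Rightarrow> 'a \<Rightarrow> complex" where
  "cell_average \<nu> P f x = (\<Sum>A\<in>P. indicator A x *\<^sub>R cell_mean \<nu> f A)"

lemma indicator_sum_disjoint:
  fixes h :: "'a set \<Rightarrow> 'b::real_vector"
  assumes "finite P" "disjoint P" "A \<in> P" "x \<in> A"
  shows "(\<Sum>B\<in>P. indicator B x *\<^sub>R h B) = h A"
proof -
  have "(\<Sum>B\<in>P. indicator B x *\<^sub>R h B) = (\<Sum>B\<in>P. if B = A then h A else 0)"
  proof (rule sum.cong[OF refl])
    fix B assume "B \<in> P"
    then show "indicator B x *\<^sub>R h B = (if B = A then h A else 0)"
      using assms disjointD[OF assms(2), of A B] by (auto simp: indicator_def)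
  qed
  then show ?thesis using assms by simp
qed

context finite_measure
begin

lemma integrable_indicator_scaleR:
  fixes f :: "'a \<Rightarrow> 'b::{banach,second_countable_topology}"
  assumes "integrable M f" "A \<in> sets M"
  shows "integrable M (\<lambda>x. indicator A x *\<^sub>R f x)"
  using integrable_mult_indicator[OF assms(2,1)] .

lemma integrable_indicator_finite: "A \<in> sets M \<Longrightarrow> integrable M (indicator A :: 'a \<Rightarrow> real)"
  using emeasure_finite[of A] by (intro integrable_real_indicator) (auto simp: less_top[symmetric])

lemma integral_cells:
  fixes g :: "'a \<Rightarrow> 'b::{banach,second_countable_topology}"
  assumes P: "cell_partition M P" and g: "integrable M g"
  shows "(LINT x|M. g x) = (\<Sum>A\<in>P. LINT x|M. indicator A x *\<^sub>R g x)"
proof -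
  have P': "finite P" "P \<subseteq> sets M" "disjoint P" and AE: "AE x in M. x \<in> \<Union>P"
    using P by (auto simp: cell_partition_def)
  have "(LINT x|M. g x) = (LINT x|M. (\<Sum>A\<in>P. indicator A x *\<^sub>R g x))"
  proof (rule integral_cong_AE)
    show "AE x in M. g x = (\<Sum>A\<in>P. indicator A x *\<^sub>R g x)"
      using AE
    proof eventually_elim
      case (elim x)
      then obtain A where "A \<in> P" "x \<in> A" by auto
      then show ?case using indicator_sum_disjoint[OF P'(1,3), of A x "\<lambda>_. g x"] by simp
    qed
  qed (use g P'(2) in \<open>auto intro!: borel_measurable_sum borel_measurable_scaleR\<close>)
  also have "\<dots> = (\<Sum>A\<in>P. LINT x|M. indicator A x *\<^sub>R g x)"
    using g P' by (intro Bochner_Integration.integral_sum integrable_indicator_scaleR) auto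
  finally show ?thesis .
qed

lemma integral_fun_cell_average:
  fixes h :: "complex \<Rightarrow> real"
  assumes P: "cell_partition M P"
  shows "has_bochner_integral M (\<lambda>x. \<Sum>A\<in>P. indicator A x *\<^sub>R h (cell_mean M f A)) (\<Sum>A\<in>P. measure M A * h (cell_mean M f A))"
    and "AE x in M. h (cell_average M P f x) = (\<Sum>A\<in>P. indicator A x *\<^sub>R h (cell_mean M f A))"
proof -
  have P': "finite P" "P \<subseteq> sets M" "disjoint P" and AE: "AE x in M. x \<in> \<Union>P"
    using P by (auto simp: cell_partition_def)
  show "has_bochner_integral M (\<lambda>x. \<Sum>A\<in>P. indicator A x *\<^sub>R h (cell_mean M f A)) (\<Sum>A\<in>P. measure M A * h (cell_mean M f A))"
  proof (rule has_bochner_integral_sum)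
    fix A assume "A \<in> P"
    then have "A \<in> sets M" using P' by auto
    then have "has_bochner_integral M (indicator A) (measure M A)"
      using emeasure_finite[of A] by (intro has_bochner_integral_real_indicator) (auto simp: less_top[symmetric])
    from has_bochner_integral_scaleR_left[OF this, of "h (cell_mean M f A)"]
    show "has_bochner_integral M (\<lambda>x. indicator A x *\<^sub>R h (cell_mean M f A)) (measure M A * h (cell_mean M f A))"
      by (simp only: real_scaleR_def)
  qed
  show "AE x in M. h (cell_average M P f x) = (\<Sum>A\<in>P. indicator A x *\<^sub>R h (cell_mean M f A))"
    using AE
  proof eventually_elim
    case (elim x)
    then obtain A where A: "A \<in> P" "x \<in> A" by auto
    then show ?case unfolding cell_average_def
      by (simp only: indicator_sum_disjoint[OF P'(1,3) A])
  qed
qed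

lemma cell_average_measurable [measurable]:
  assumes P: "cell_partition M P"
  shows "cell_average M P f \<in> borel_measurable M"
  unfolding cell_average_def[abs_def]
  by (intro borel_measurable_sum borel_measurable_scaleR) (use P in \<open>auto simp: cell_partition_def\<close>)

lemma
  fixes h :: "complex \<Rightarrow> real"
  assumes P: "cell_partition M P" and h[measurable]: "h \<in> borel_measurable borel"
  shows integrable_fun_cell_average: "integrable M (\<lambda>x. h (cell_average M P f x))"
    and lint_fun_cell_average: "(LINT x|M. h (cell_average M P f x)) = (\<Sum>A\<in>P. measure M A * h (cell_mean M f A))"
proof -
  note [measurable] = cell_average_measurable[OF P, of f]
  note hb = integral_fun_cell_average[OF P, of h f]
  have m: "(\<lambda>x. h (cell_average M P f x)) \<in> borel_measurable M" by measurable
  have "has_bochner_integral M (\<lambda>x. h (cell_average M P f x)) (\<Sum>A\<in>P. measure M A * h (cell_mean M f A))"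
    using hb(1) has_bochner_integral_cong_AE[OF m borel_measurable_has_bochner_integral[OF hb(1)] hb(2)] by blast
  then show "integrable M (\<lambda>x. h (cell_average M P f x))"
    "(LINT x|M. h (cell_average M P f x)) = (\<Sum>A\<in>P. measure M A * h (cell_mean M f A))"
    by (auto simp: has_bochner_integral_iff)
qed

lemma integrable_cell_average:
  assumes P: "cell_partition M P"
  shows "integrable M (cell_average M P f)"
  using integrable_fun_cell_average[OF P, of norm f] cell_average_measurable[OF P, of f]
  by (simp add: integrable_norm_iff)

lemma measure_norm_cell_mean_le:
  assumes P: "cell_partition M P" "A \<in> P" and f: "integrable M f"
  shows "measure M A * norm (cell_mean M f A) \<le> (LINT x|M. indicator A x *\<^sub>R norm (f x))"
proof -
  have A: "A \<in> sets M" "0 < measure M A" using P by (auto simp: cell_partition_def)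
  have "measure M A * norm (cell_mean M f A) = norm (LINT x|M. indicator A x *\<^sub>R f x)"
    using A by (simp add: cell_mean_def norm_divide)
  also have "\<dots> \<le> (LINT x|M. norm (indicator A x *\<^sub>R f x))" by (rule integral_norm_bound)
  also have "\<dots> = (LINT x|M. indicator A x *\<^sub>R norm (f x))" by simp
  finally show ?thesis .
qed

lemma cell_average_L1_le:
  assumes P: "cell_partition M P" and f: "integrable M f"
  shows "(LINT x|M. norm (cell_average M P f x)) \<le> (LINT x|M. norm (f x))"
proof -
  have "(LINT x|M. norm (cell_average M P f x)) = (\<Sum>A\<in>P. measure M A * norm (cell_mean M f A))"
    by (rule lint_fun_cell_average[OF P]) simp
  also have "\<dots> \<le> (\<Sum>A\<in>P. (LINT x|M. indicator A x *\<^sub>R norm (f x)))"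
    by (intro sum_mono measure_norm_cell_mean_le[OF P _ f])
  also have "\<dots> = (LINT x|M. norm (f x))"
    using integral_cells[OF P, of "\<lambda>x. norm (f x)"] f by simp
  finally show ?thesis .
qed

lemma cell_average_diff:
  assumes P: "cell_partition M P" and f: "integrable M f" and g: "integrable M g"
  shows "cell_average M P (\<lambda>x. f x - g x) x = cell_average M P f x - cell_average M P g x"
proof -
  have "cell_mean M (\<lambda>x. f x - g x) A = cell_mean M f A - cell_mean M g A" if "A \<in> P" for A
  proof -
    have "A \<in> sets M" using P that by (auto simp: cell_partition_def)
    then show ?thesis
      using integrable_indicator_scaleR[OF f] integrable_indicator_scaleR[OF g]
      by (simp add: cell_mean_def scaleR_diff_right Bochner_Integration.integral_diff diff_divide_distrib)
  qed
  then show ?thesis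
    by (simp add: cell_average_def scaleR_diff_right sum_subtractf)
qed

text \<open>
  Averaging is linear and contracts the \<open>L\<^sup>1\<close> norm, so the functions whose averages converge
  form a closed subspace.
\<close>
lemma cell_average_error_le:
  assumes P: "cell_partition M P" and f: "integrable M f" and g: "integrable M g"
  shows "(LINT x|M. norm (cell_average M P f x - f x)) \<le>
    2 * (LINT x|M. norm (f x - g x)) + (LINT x|M. norm (cell_average M P g x - g x))"
proof -
  note ia = integrable_cell_average[OF P]
  have "(LINT x|M. norm (cell_average M P f x - f x)) \<le>
    (LINT x|M. norm (cell_average M P (\<lambda>x. f x - g x) x) + (norm (f x - g x) + norm (cell_average M P g x - g x)))"
  proof (rule integral_mono)
    fix x
    have "cell_average M P f x - f x = cell_average M P (\<lambda>x. f x - g x) x - (f x - g x) + (cell_average M P g x - g x)"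
      by (simp add: cell_average_diff[OF P f g])
    also have "norm \<dots> \<le> norm (cell_average M P (\<lambda>x. f x - g x) x) + norm (f x - g x) + norm (cell_average M P g x - g x)"
      by (rule order_trans[OF norm_triangle_ineq add_right_mono[OF norm_triangle_ineq4]])
    finally show "norm (cell_average M P f x - f x) \<le> norm (cell_average M P (\<lambda>x. f x - g x) x) + (norm (f x - g x) + norm (cell_average M P g x - g x))"
      by simp
  qed (use f g ia in \<open>auto intro!: Bochner_Integration.integrable_add integrable_norm Bochner_Integration.integrable_diff\<close>)
  also have "\<dots> = (LINT x|M. norm (cell_average M P (\<lambda>x. f x - g x) x)) + ((LINT x|M. norm (f x - g x)) + (LINT x|M. norm (cell_average M P g x - g x)))"
    using f g ia by (subst Bochner_Integration.integral_add; simp)+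
  also have "(LINT x|M. norm (cell_average M P (\<lambda>x. f x - g x) x)) \<le> (LINT x|M. norm (f x - g x))"
    by (rule cell_average_L1_le[OF P]) (use f g in auto)
  finally show ?thesis by simp
qed

text \<open>
  Let \<open>V\<close> be the union of the cells that meet \<open>C\<close>. Averaging does not change the indicator of
  \<open>V\<close>, and \<open>V\<close> differs from \<open>C\<close> by at most \<open>U - C\<close>.
\<close>
lemma cell_average_indicator_error_le:
  assumes P: "cell_partition M P" and C: "C \<in> sets M"
    and U: "U \<in> sets M" "\<And>A x. A \<in> P \<Longrightarrow> A \<inter> C \<noteq> {} \<Longrightarrow> A \<subseteq> U"
  shows "(LINT x|M. norm (cell_average M P (\<lambda>x. indicator C x *\<^sub>R c) x - indicator C x *\<^sub>R c)) \<le> 2 * norm c * measure M (U - C)"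
proof -
  define V where "V = \<Union>{A\<in>P. A \<inter> C \<noteq> {}}"
  have P': "finite P" "P \<subseteq> sets M" "disjoint P" "\<And>A. A \<in> P \<Longrightarrow> 0 < measure M A" and AE: "AE x in M. x \<in> \<Union>P"
    using P by (auto simp: cell_partition_def)
  have V: "V \<in> sets M" unfolding V_def using P' by (intro sets.finite_Union) auto
  have VU: "V \<subseteq> U" using U(2) by (auto simp: V_def)
  have i: "integrable M (\<lambda>x. indicator S x *\<^sub>R c)" if "S \<in> sets M" for S
    using that by (intro integrable_indicator_scaleR) auto
  have fix_V: "AE x in M. cell_average M P (\<lambda>x. indicator V x *\<^sub>R c) x = indicator V x *\<^sub>R c"
    using AE
  proof eventually_elim
    case (elim x)
    then obtain A where A: "A \<in> P" "x \<in> A" by auto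
    have AV: "indicator A y *\<^sub>R indicator V y *\<^sub>R c = indicator A y *\<^sub>R (indicator V x *\<^sub>R c)" for y
    proof (cases "y \<in> A")
      case True
      have "z \<in> V \<longleftrightarrow> A \<inter> C \<noteq> {}" if "z \<in> A" for z
        using that A disjointD[OF P'(3), of A] by (auto simp: V_def)
      then have "y \<in> V \<longleftrightarrow> x \<in> V" using True A by auto
      then show ?thesis by (simp add: indicator_def)
    qed simp
    have "cell_average M P (\<lambda>x. indicator V x *\<^sub>R c) x = cell_mean M (\<lambda>x. indicator V x *\<^sub>R c) A"
      unfolding cell_average_def by (rule indicator_sum_disjoint[OF P'(1,3) A])
    also have "\<dots> = (measure M A *\<^sub>R (indicator V x *\<^sub>R c)) / of_real (measure M A)"
      unfolding cell_mean_def AV using A P' integrable_indicator_finite[of A]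
      by (subst integral_scaleR_left) auto
    also have "\<dots> = indicator V x *\<^sub>R c" using P'(4)[OF A(1)] by (simp add: scaleR_conv_of_real)
    finally show ?case .
  qed
  have "(LINT x|M. norm (cell_average M P (\<lambda>x. indicator C x *\<^sub>R c) x - indicator C x *\<^sub>R c)) \<le>
    2 * (LINT x|M. norm (indicator C x *\<^sub>R c - indicator V x *\<^sub>R c)) + (LINT x|M. norm (cell_average M P (\<lambda>x. indicator V x *\<^sub>R c) x - indicator V x *\<^sub>R c))"
    by (rule cell_average_error_le[OF P i[OF C] i[OF V]])
  also have "(LINT x|M. norm (cell_average M P (\<lambda>x. indicator V x *\<^sub>R c) x - indicator V x *\<^sub>R c)) = 0"
    by (rule integral_eq_zero_AE) (use fix_V in auto)
  also have "(LINT x|M. norm (indicator C x *\<^sub>R c - indicator V x *\<^sub>R c)) \<le> (LINT x|M. indicator (U - C) x *\<^sub>R norm c)"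
  proof (rule integral_mono_AE)
    show "AE x in M. norm (indicator C x *\<^sub>R c - indicator V x *\<^sub>R c) \<le> indicator (U - C) x *\<^sub>R norm c"
      using AE
    proof eventually_elim
      case (elim x)
      then have "x \<in> C \<Longrightarrow> x \<in> V" by (auto simp: V_def)
      then show ?case using VU by (auto simp: indicator_def)
    qed
  qed (use i[OF C] i[OF V] C U integrable_indicator_finite[OF sets.Diff[OF U(1) C]] in \<open>auto intro!: integrable_indicator_scaleR\<close>)
  also have "\<dots> = norm c * measure M (U - C)" using integrable_indicator_finite[OF sets.Diff[OF U(1) C]] C U by (subst integral_scaleR_left) auto
  finally show ?thesis by simp
qed

text \<open>
  Bernoulli's inequality for real exponents: the tangent at \<open>1\<close> lies below the convex function
  \<open>u powr q\<close>. It yields Jensen's inequality for the means over a cell.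
\<close>
lemma powr_ge_tangent:
  fixes q u :: real
  assumes q: "1 \<le> q" and u: "0 \<le> u"
  shows "1 + q * (u - 1) \<le> u powr q"
proof (cases "u = 0")
  case True then show ?thesis using q by simp
next
  case False
  have d: "((\<lambda>x. x powr q - q * x) has_real_derivative q * x powr (q - 1) - q) (at x)" if "x > 0" for x
    using that by (auto intro!: derivative_eq_intros)
  have "1 powr q - q * 1 \<le> u powr q - q * u"
  proof (cases "1 \<le> u")
    case True
    show ?thesis
    proof (rule DERIV_nonneg_imp_nondecreasing[OF True, where f = "\<lambda>x. x powr q - q * x"])
      fix x assume "1 \<le> x" "x \<le> u"
      moreover have "1 \<le> x powr (q - 1)" using \<open>1 \<le> x\<close> q by (intro ge_one_powr_ge_zero) auto
      ultimately show "\<exists>y. ((\<lambda>x. x powr q - q * x) has_real_derivative y) (at x) \<and> 0 \<le> y"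
        using d[of x] q by (intro exI[of _ "q * x powr (q - 1) - q"]) auto
    qed
  next
    case False
    then have "u \<le> 1" by simp
    then show ?thesis
    proof (rule DERIV_nonpos_imp_nonincreasing[where f = "\<lambda>x. x powr q - q * x"])
      fix x assume x: "u \<le> x" "x \<le> 1"
      moreover have "x > 0" using x u \<open>u \<noteq> 0\<close> by linarith
      moreover have "x powr (q - 1) \<le> 1" using powr_mono2[of "q - 1" x 1] \<open>x > 0\<close> x q by auto
      ultimately show "\<exists>y. ((\<lambda>x. x powr q - q * x) has_real_derivative y) (at x) \<and> y \<le> 0"
        using d[of x] q by (intro exI[of _ "q * x powr (q - 1) - q"]) auto
    qed
  qed
  then show ?thesis by (simp add: algebra_simps)
qed

lemma cell_mean_powr_le:
  assumes P: "cell_partition M P" and f: "integrable M f" and q: "1 \<le> q"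
    and fq: "integrable M (\<lambda>x. norm (f x) powr q)"
  shows "(\<Sum>A\<in>P. measure M A * norm (cell_mean M f A) powr q) \<le> (LINT x|M. norm (f x) powr q)"
proof -
  have "measure M A * norm (cell_mean M f A) powr q \<le> (LINT x|M. indicator A x *\<^sub>R norm (f x) powr q)" if A: "A \<in> P" for A
  proof (cases "cell_mean M f A = 0")
    case True
    then show ?thesis using q by (auto intro!: integral_nonneg_AE)
  next
    case False
    define m where "m = norm (cell_mean M f A)"
    have m: "m > 0" using False by (simp add: m_def)
    have A': "A \<in> sets M" "0 < measure M A" using P A by (auto simp: cell_partition_def)
    \<comment> \<open>The tangent of \<open>t powr q\<close> at the modulus \<open>m\<close> of the mean.\<close>
    have *: "m powr q * (1 - q) + (m powr q * q / m) * t \<le> t powr q" if "t \<ge> 0" for t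
    proof -
      have "m powr q * (1 + q * (t / m - 1)) \<le> m powr q * (t / m) powr q"
        using m that q by (intro mult_left_mono powr_ge_tangent) auto
      also have "\<dots> = t powr q" using m that by (simp add: powr_divide)
      finally show ?thesis using m by (simp add: field_simps)
    qed
    have iA: "integrable M (indicator A :: 'a \<Rightarrow> real)" using A' by (intro integrable_indicator_finite) auto
    have if1: "integrable M (\<lambda>x. indicator A x *\<^sub>R norm (f x))"
      by (rule integrable_indicator_scaleR) (use f A' in auto)
    have i1: "integrable M (\<lambda>x. (m powr q * (1 - q)) * indicator A x)" "integrable M (\<lambda>x. (m powr q * q / m) * (indicator A x *\<^sub>R norm (f x)))"
      using iA if1 by (auto intro!: integrable_mult_right)
    have "measure M A * m powr q = m powr q * (1 - q) * measure M A + m powr q * q / m * (measure M A * m)"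
      using m by (simp add: field_simps)
    also have "\<dots> \<le> m powr q * (1 - q) * measure M A + m powr q * q / m * (LINT x|M. indicator A x *\<^sub>R norm (f x))"
      using measure_norm_cell_mean_le[OF P A f] m q unfolding m_def[symmetric]
      by (intro add_left_mono mult_left_mono) auto
    also have "\<dots> = (LINT x|M. (m powr q * (1 - q)) * indicator A x + (m powr q * q / m) * (indicator A x *\<^sub>R norm (f x)))"
      using i1 A' iA if1 by (subst Bochner_Integration.integral_add) auto
    also have "\<dots> \<le> (LINT x|M. indicator A x *\<^sub>R norm (f x) powr q)"
    proof (rule integral_mono)
      show "integrable M (\<lambda>x. (m powr q * (1 - q)) * indicator A x + (m powr q * q / m) * (indicator A x *\<^sub>R norm (f x)))"
        using i1 by (rule Bochner_Integration.integrable_add)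
      show "integrable M (\<lambda>x. indicator A x *\<^sub>R norm (f x) powr q)"
        using fq A'(1) by (rule integrable_indicator_scaleR)
      show "(m powr q * (1 - q)) * indicator A x + (m powr q * q / m) * (indicator A x *\<^sub>R norm (f x)) \<le> indicator A x *\<^sub>R norm (f x) powr q" for x
        using *[of "norm (f x)"] by (simp split: split_indicator)
    qed
    finally show ?thesis by (simp add: m_def)
  qed
  then have "(\<Sum>A\<in>P. measure M A * norm (cell_mean M f A) powr q) \<le> (\<Sum>A\<in>P. (LINT x|M. indicator A x *\<^sub>R norm (f x) powr q))"
    by (rule sum_mono)
  also have "\<dots> = (LINT x|M. norm (f x) powr q)"
    using integral_cells[OF P fq] by simp
  finally show ?thesis .
qed

text \<open>
  The partitions have to work for all integrable functions at once: they are later applied to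
  a different function at every point of the edges.
\<close>
definition resolving :: "(nat \<Rightarrow> 'a set set) \<Rightarrow> bool" where
  "resolving P \<longleftrightarrow> (\<forall>n. cell_partition M (P n)) \<and>
     (\<forall>f. integrable M f \<longrightarrow> (\<lambda>n. LINT x|M. norm (cell_average M (P n) f x - f x)) \<longlonglongrightarrow> 0)"

lemma cell_average_tendsto_approx:
  assumes P: "\<And>n. cell_partition M (P n)" and f: "integrable M f"
    and ex: "\<And>e. e > 0 \<Longrightarrow> \<exists>g. integrable M g \<and> (LINT x|M. norm (f x - g x)) < e \<and>
        (\<lambda>n. LINT x|M. norm (cell_average M (P n) g x - g x)) \<longlonglongrightarrow> 0"
  shows "(\<lambda>n. LINT x|M. norm (cell_average M (P n) f x - f x)) \<longlonglongrightarrow> 0"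
proof (rule LIMSEQ_I)
  fix e :: real assume e: "e > 0"
  obtain g where g: "integrable M g" "(LINT x|M. norm (f x - g x)) < e / 4"
     "(\<lambda>n. LINT x|M. norm (cell_average M (P n) g x - g x)) \<longlonglongrightarrow> 0"
    using ex[of "e/4"] e by auto
  obtain N where N: "\<And>n. n \<ge> N \<Longrightarrow> norm ((LINT x|M. norm (cell_average M (P n) g x - g x)) - 0) < e / 2"
    using LIMSEQ_D[OF g(3), of "e/2"] e by auto
  show "\<exists>no. \<forall>n\<ge>no. norm ((LINT x|M. norm (cell_average M (P n) f x - f x)) - 0) < e"
  proof (intro exI allI impI)
    fix n assume "n \<ge> N"
    have "0 \<le> (LINT x|M. norm (cell_average M (P n) f x - f x))" by simp
    moreover have "(LINT x|M. norm (cell_average M (P n) f x - f x)) \<le> 2 * (LINT x|M. norm (f x - g x)) + (LINT x|M. norm (cell_average M (P n) g x - g x))"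
      by (rule cell_average_error_le[OF P f g(1)])
    ultimately show "norm ((LINT x|M. norm (cell_average M (P n) f x - f x)) - 0) < e"
      using g(2) N[OF \<open>n \<ge> N\<close>] by simp
  qed
qed

lemma resolvingI:
  assumes P: "\<And>n. cell_partition M (P n)"
    and ex: "\<And>A e. A \<in> sets M \<Longrightarrow> e > 0 \<Longrightarrow> \<exists>C\<in>sets M. C \<subseteq> A \<and> measure M (A - C) < e \<and>
      (\<forall>c. (\<lambda>n. LINT x|M. norm (cell_average M (P n) (\<lambda>x. indicator C x *\<^sub>R c) x - indicator C x *\<^sub>R c)) \<longlonglongrightarrow> 0)"
  shows "resolving P"
  unfolding resolving_def
proof (intro conjI allI impI P)
  fix f :: "'a \<Rightarrow> complex" assume "integrable M f"
  then show "(\<lambda>n. LINT x|M. norm (cell_average M (P n) f x - f x)) \<longlonglongrightarrow> 0"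
  proof (induction f rule: integrable_induct)
    case (base A c)
    show ?case
    proof (rule cell_average_tendsto_approx[OF P])
      show "integrable M (\<lambda>x. indicator A x *\<^sub>R c)" using base by (intro integrable_indicator_scaleR) auto
      fix e :: real assume e: "e > 0"
      define d where "d = e / (norm c + 1)"
      have n1: "norm c + 1 > 0" by (simp add: add_nonneg_pos)
      have d: "d > 0" "norm c * d < e" using e n1 by (auto simp: d_def pos_divide_less_eq algebra_simps)
      obtain C where C: "C \<in> sets M" "C \<subseteq> A" "measure M (A - C) < d"
        "\<forall>c. (\<lambda>n. LINT x|M. norm (cell_average M (P n) (\<lambda>x. indicator C x *\<^sub>R c) x - indicator C x *\<^sub>R c)) \<longlonglongrightarrow> 0"
        using ex[OF base(1) d(1)] by auto
      have "norm (indicator A x *\<^sub>R c - indicator C x *\<^sub>R c) = indicator (A - C) x *\<^sub>R norm c" for x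
        using C(2) by (auto simp: indicator_def)
      then have "(LINT x|M. norm (indicator A x *\<^sub>R c - indicator C x *\<^sub>R c)) = measure M (A - C) * norm c"
        using integrable_indicator_finite[OF sets.Diff[OF base(1) C(1)]] C base by simp
      also have "\<dots> \<le> d * norm c" using C by (intro mult_right_mono) auto
      finally have "(LINT x|M. norm (indicator A x *\<^sub>R c - indicator C x *\<^sub>R c)) < e" using d by (simp add: mult.commute)
      then show "\<exists>g. integrable M g \<and> (LINT x|M. norm (indicator A x *\<^sub>R c - g x)) < e \<and>
         (\<lambda>n. LINT x|M. norm (cell_average M (P n) g x - g x)) \<longlonglongrightarrow> 0"
        using C by (intro exI[of _ "\<lambda>x. indicator C x *\<^sub>R c"]) (auto intro: integrable_indicator_scaleR)
    qed
  next
    case (add f g)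
    have eq: "cell_average M (P n) (\<lambda>x. f x + g x) x = cell_average M (P n) f x + cell_average M (P n) g x" for n x
      using cell_average_diff[OF P, of "\<lambda>x. f x + g x" g n x] add by simp
    have *: "norm (cell_average M (P n) (\<lambda>x. f x + g x) x - (f x + g x)) \<le>
        norm (cell_average M (P n) f x - f x) + norm (cell_average M (P n) g x - g x)" for n x
      unfolding eq by (rule norm_diff_triangle_ineq)
    have "(LINT x|M. norm (cell_average M (P n) (\<lambda>x. f x + g x) x - (f x + g x))) \<le>
       (LINT x|M. norm (cell_average M (P n) f x - f x)) + (LINT x|M. norm (cell_average M (P n) g x - g x))" for n
    proof -
      have i: "integrable M (\<lambda>x. norm (cell_average M (P n) h x - h x))" if "integrable M h" for h
        using that integrable_cell_average[OF P] by auto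
      have "(LINT x|M. norm (cell_average M (P n) (\<lambda>x. f x + g x) x - (f x + g x))) \<le>
        (LINT x|M. norm (cell_average M (P n) f x - f x) + norm (cell_average M (P n) g x - g x))"
        using add by (intro integral_mono * i Bochner_Integration.integrable_add)
      then show ?thesis using i add by simp
    qed
    note le = this
    have lim0: "(\<lambda>n. (LINT x|M. norm (cell_average M (P n) f x - f x)) + (LINT x|M. norm (cell_average M (P n) g x - g x))) \<longlonglongrightarrow> 0"
      using tendsto_add[OF add.IH] by simp
    show ?case
    proof (rule tendsto_sandwich[OF _ _ tendsto_const lim0])
      show "\<forall>\<^sub>F n in sequentially. 0 \<le> (LINT x|M. norm (cell_average M (P n) (\<lambda>x. f x + g x) x - (f x + g x)))"
        by (intro always_eventually allI integral_nonneg_AE AE_I2 norm_ge_zero)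
    qed (intro always_eventually allI le)
  next
    case (lim f s)
    show ?case
    proof (rule cell_average_tendsto_approx[OF P lim.hyps(4)])
      fix e :: real assume e: "e > 0"
      have "(\<lambda>i. LINT x|M. norm (f x - s i x)) \<longlonglongrightarrow> (LINT x|M. 0)"
      proof (rule integral_dominated_convergence[where w = "\<lambda>x. 3 * norm (f x)"])
        show "AE x in M. (\<lambda>i. norm (f x - s i x)) \<longlonglongrightarrow> 0"
        proof (rule AE_I2)
          fix x assume "x \<in> space M"
          from tendsto_norm[OF tendsto_diff[OF tendsto_const[of "f x"] lim.hyps(2)[OF this]]]
          show "(\<lambda>i. norm (f x - s i x)) \<longlonglongrightarrow> 0" by simp
        qed
        show "AE x in M. norm (norm (f x - s i x)) \<le> 3 * norm (f x)" for i
        proof (rule AE_I2)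
          fix x assume "x \<in> space M"
          from lim.hyps(3)[OF this, of i] norm_triangle_ineq4[of "f x" "s i x"]
          show "norm (norm (f x - s i x)) \<le> 3 * norm (f x)" by simp
        qed
      qed (use lim.hyps(1,4) in auto)
      from LIMSEQ_D[OF this e] obtain i where "(LINT x|M. norm (f x - s i x)) < e" by auto
      then show "\<exists>g. integrable M g \<and> (LINT x|M. norm (f x - g x)) < e \<and>
        (\<lambda>n. LINT x|M. norm (cell_average M (P n) g x - g x)) \<longlonglongrightarrow> 0"
        using lim.hyps(1) lim.IH by blast
    qed
  qed
qed

end

section \<open>Compact sets in metric measure spaces\<close>

lemma mms_openin: "metric_measure_space X \<mu> \<Longrightarrow> openin (mtopology_of X) U \<Longrightarrow> U \<in> sets \<mu>"
  by (auto simp: metric_measure_space_def)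

lemma mms_space: "metric_measure_space X \<mu> \<Longrightarrow> space \<mu> = mspace X"
  by (auto simp: metric_measure_space_def)

lemma mms_closedin:
  assumes "metric_measure_space X \<mu>" "closedin (mtopology_of X) C"
  shows "C \<in> sets \<mu>"
proof -
  have "mspace X - C \<in> sets \<mu>"
    using assms by (intro mms_openin[OF assms(1)]) (auto simp: closedin_def)
  then have "space \<mu> - (mspace X - C) \<in> sets \<mu>" by auto
  moreover have "space \<mu> - (mspace X - C) = C"
    using closedin_subset[OF assms(2)] mms_space[OF assms(1)] by auto
  ultimately show ?thesis by simp
qed

lemma Hausdorff_mtopology_of: "Hausdorff_space (mtopology_of X)"
  unfolding mtopology_of_def by (rule Metric_space.Hausdorff_space_mtopology) simp

lemma openin_mball_of: "openin (mtopology_of X) (mball_of X x r)"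
  unfolding mtopology_of_def mball_of_def by (rule Metric_space.openin_mball) simp

lemma mms_compact_sets:
  assumes "metric_measure_space X \<mu>" "compactin (mtopology_of X) K"
  shows "K \<in> sets \<mu>"
  using mms_closedin[OF assms(1) compactin_imp_closedin[OF Hausdorff_mtopology_of assms(2)]] .

lemma mms_compact_finite:
  assumes "metric_measure_space X \<mu>" "compactin (mtopology_of X) K"
  shows "emeasure \<mu> K < \<infinity>"
proof (cases "K = {}")
  case False
  have Ks: "K \<subseteq> mspace X" using compactin_subset_topspace[OF assms(2)] by simp
  interpret M: Metric_space "mspace X" "mdist X" by simp
  have "M.mbounded K" using assms(2) by (intro M.compactin_imp_mbounded) (simp add: mtopology_of_def)
  then obtain x r where xr: "K \<subseteq> M.mcball x r" unfolding M.mbounded_def by blast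
  define R where "R = max r 0 + 1"
  have "K \<subseteq> mball_of X x R"
    using xr by (force simp: R_def)
  moreover have "x \<in> mspace X" using xr False by (auto simp: M.mcball_def)
  then have "emeasure \<mu> (mball_of X x R) < \<infinity>"
    using assms(1) by (auto simp: metric_measure_space_def R_def)
  ultimately show ?thesis
    using emeasure_mono[of K "mball_of X x R" \<mu>] mms_openin[OF assms(1) openin_mball_of] by (auto intro: le_less_trans)
qed simp

lemma mms_inner_regular:
  assumes mms: "metric_measure_space X \<mu>" and A: "A \<in> sets \<mu>" "emeasure \<mu> A < \<infinity>" and e: "e > (0::real)"
  obtains C where "compactin (mtopology_of X) C" "C \<subseteq> A" "measure \<mu> (A - C) < e"
proof -
  have sup: "emeasure \<mu> A = (SUP K\<in>{K. K \<subseteq> A \<and> compactin (mtopology_of X) K}. emeasure \<mu> K)"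
    using mms A by (auto simp: metric_measure_space_def)
  have eA: "emeasure \<mu> A = ennreal (measure \<mu> A)" using A by (auto intro!: emeasure_eq_ennreal_measure)
  have "\<exists>C. C \<subseteq> A \<and> compactin (mtopology_of X) C \<and> measure \<mu> A - e < measure \<mu> C"
  proof (rule ccontr)
    assume neg: "\<not> ?thesis"
    have le: "measure \<mu> C \<le> measure \<mu> A - e" if "C \<subseteq> A" "compactin (mtopology_of X) C" for C
      using neg that by force
    have pos: "0 \<le> measure \<mu> A - e" using le[of "{}"] by simp
    have "emeasure \<mu> C \<le> ennreal (measure \<mu> A - e)" if C: "C \<subseteq> A" "compactin (mtopology_of X) C" for C
    proof -
      have "emeasure \<mu> C = ennreal (measure \<mu> C)"
        using mms_compact_finite[OF mms C(2)] by (auto intro!: emeasure_eq_ennreal_measure)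
      then show ?thesis using le[OF C] by (simp add: ennreal_leI)
    qed
    then have "emeasure \<mu> A \<le> ennreal (measure \<mu> A - e)"
      by (subst sup, intro SUP_least) auto
    then show False using pos e by (simp add: eA)
  qed
  then obtain C where C: "C \<subseteq> A" "compactin (mtopology_of X) C" "measure \<mu> A < measure \<mu> C + e" by auto
  have Cs: "C \<in> sets \<mu>" using mms_compact_sets[OF mms C(2)] .
  have fC: "emeasure \<mu> C < \<infinity>" using mms_compact_finite[OF mms C(2)] .
  note C(3)
  moreover have "measure \<mu> (A - C) = measure \<mu> A - measure \<mu> C"
    using A Cs C(1) fC by (intro measure_Diff) auto
  ultimately show ?thesis using that[of C] C by auto
qed

text \<open>
  Balls have finite measure, so inner regularity fills each ball with compact sets up to a
  null set. This is what allows locally integrable functions to be studied on compact sets.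
\<close>
lemma mms_exhaustion:
  assumes mms: "metric_measure_space X \<mu>"
  obtains K where "\<And>n::nat. compactin (mtopology_of X) (K n)" "incseq K" "AE x in \<mu>. x \<in> (\<Union>n. K n)"
proof (cases "mspace X = {}")
  case True
  then have "AE x in \<mu>. x \<in> (\<Union>n::nat. {})" using mms_space[OF mms] by (auto intro: AE_I2)
  then show ?thesis using that[of "\<lambda>_. {}"] by (auto simp: incseq_def)
next
  case False
  then obtain x0 where x0: "x0 \<in> mspace X" by auto
  define B where "B n = mball_of X x0 (real n + 1)" for n
  have Bs: "B n \<in> sets \<mu>" for n unfolding B_def by (rule mms_openin[OF mms openin_mball_of])
  have Bf: "emeasure \<mu> (B n) < \<infinity>" for n using mms x0 by (auto simp: metric_measure_space_def B_def)
  have "\<forall>n. \<forall>k. \<exists>C. compactin (mtopology_of X) C \<and> C \<subseteq> B n \<and> measure \<mu> (B n - C) < 1 / (real k + 1)"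
    using mms_inner_regular[OF mms Bs Bf] by (metis divide_pos_pos of_nat_0_le_iff add_nonneg_pos zero_less_one)
  then obtain C where C: "\<And>n k. compactin (mtopology_of X) (C n k)" "\<And>n k. C n k \<subseteq> B n" "\<And>n k. measure \<mu> (B n - C n k) < 1 / (real k + 1)"
    by metis
  define K where "K N = (\<Union>n\<le>N. \<Union>k\<le>N. C n k)" for N
  have Kc: "compactin (mtopology_of X) (K N)" for N
    unfolding K_def using C(1) by (auto intro!: compactin_Union)
  have Ki: "incseq K" unfolding incseq_def K_def
    by (intro allI impI UN_mono) auto
  have CK: "C n k \<subseteq> (\<Union>N. K N)" for n k
  proof -
    have "C n k \<subseteq> K (max n k)" unfolding K_def by (intro subsetI UN_I[of n] UN_I[of k]) auto
    then show ?thesis by auto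
  qed
  have Cs: "C n k \<in> sets \<mu>" for n k using mms_compact_sets[OF mms C(1)] .
  have null: "B n - (\<Union>k. C n k) \<in> null_sets \<mu>" for n
  proof -
    have s: "B n - (\<Union>k. C n k) \<in> sets \<mu>" using Bs Cs by auto
    have f: "emeasure \<mu> (B n - C n k) < \<infinity>" for k
      using Bf[of n] emeasure_mono[of "B n - C n k" "B n" \<mu>] Bs by (auto intro: le_less_trans)
    have "measure \<mu> (B n - (\<Union>k. C n k)) \<le> 1 / (real k + 1)" for k
    proof -
      have "measure \<mu> (B n - (\<Union>k. C n k)) \<le> measure \<mu> (B n - C n k)"
        using Bs Cs f[of k] by (intro measure_mono_fmeasurable) (auto simp: fmeasurable_def)
      then show ?thesis using C(3)[of n k] by linarith
    qed
    then have "measure \<mu> (B n - (\<Union>k. C n k)) \<le> 0"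
      by (intro LIMSEQ_le_const[of "\<lambda>k. 1 / (real k + 1)"]) (real_asymp, auto)
    then have "measure \<mu> (B n - (\<Union>k. C n k)) = 0" by (simp add: measure_le_0_iff)
    moreover have "emeasure \<mu> (B n - (\<Union>k. C n k)) < \<infinity>"
      using Bf[of n] emeasure_mono[of "B n - (\<Union>k. C n k)" "B n" \<mu>] Bs by (auto intro: le_less_trans)
    ultimately show ?thesis using s by (auto simp: null_sets_def emeasure_eq_ennreal_measure)
  qed
  have "AE x in \<mu>. \<forall>n. x \<notin> B n - (\<Union>k. C n k)"
    unfolding AE_all_countable using null AE_not_in by blast
  then have "AE x in \<mu>. x \<in> (\<Union>n. K n)"
  proof (rule AE_mp, intro AE_I2 impI)
    fix x assume x: "x \<in> space \<mu>" "\<forall>n. x \<notin> B n - (\<Union>k. C n k)"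
    obtain n where "mdist X x0 x < real n + 1"
      using reals_Archimedean2[of "mdist X x0 x"] by (metis add.commute add_strict_increasing zero_less_one less_imp_le)
    then have "x \<in> B n" using x x0 mms_space[OF mms] by (auto simp: B_def)
    then obtain k where "x \<in> C n k" using x(2) by auto
    then show "x \<in> (\<Union>n. K n)" using CK by blast
  qed
  then show ?thesis using that Kc Ki by blast
qed

lemma finite_measure_restrict_compact:
  assumes mms: "metric_measure_space X \<mu>" and K: "compactin (mtopology_of X) K"
  shows "finite_measure (restrict_space \<mu> K)"
proof
  have "K \<in> sets \<mu>" "K \<subseteq> space \<mu>" using mms_compact_sets[OF mms K] sets.sets_into_space by auto
  then show "emeasure (restrict_space \<mu> K) (space (restrict_space \<mu> K)) \<noteq> \<infinity>"
    using mms_compact_finite[OF mms K]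
    by (simp add: space_restrict_space emeasure_restrict_space Int_absorb2)
qed

lemma compact_small_cells:
  assumes mms: "metric_measure_space X \<mu>" and K: "compactin (mtopology_of X) K" and e: "e > 0"
  obtains P where "cell_partition (restrict_space \<mu> K) P"
    "\<And>A x y. A \<in> P \<Longrightarrow> x \<in> A \<Longrightarrow> y \<in> A \<Longrightarrow> mdist X x y < e"
proof -
  have Ks: "K \<in> sets \<mu>" and Ksp: "K \<subseteq> mspace X"
    using mms_compact_sets[OF mms K] compactin_subset_topspace[OF K] by auto
  define \<nu> where "\<nu> = restrict_space \<mu> K"
  interpret finite_measure \<nu> unfolding \<nu>_def by (rule finite_measure_restrict_compact[OF mms K])
  have sn: "space \<nu> = K" using Ksp mms_space[OF mms] by (auto simp: \<nu>_def space_restrict_space)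
  have "\<Union>((\<lambda>x. mball_of X x (e/2)) ` K) \<supseteq> K"
  proof
    fix x assume "x \<in> K"
    moreover then have "x \<in> mspace X" using Ksp by auto
    then have "mdist X x x = 0" by simp
    then have "x \<in> mball_of X x (e/2)" using e \<open>x \<in> mspace X\<close> by (simp del: mdist_zero)
    ultimately show "x \<in> \<Union>((\<lambda>x. mball_of X x (e/2)) ` K)" by blast
  qed
  moreover have "\<forall>U\<in>(\<lambda>x. mball_of X x (e/2)) ` K. openin (mtopology_of X) U" using openin_mball_of[of X] by auto
  ultimately have "\<exists>F. finite F \<and> F \<subseteq> (\<lambda>x. mball_of X x (e/2)) ` K \<and> K \<subseteq> \<Union>F"
    using K unfolding compactin_def by meson
  then obtain F where F: "finite F" "F \<subseteq> (\<lambda>x. mball_of X x (e/2)) ` K" "K \<subseteq> \<Union>F" by auto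
  obtain fs where fs: "set fs = F" using finite_list[OF F(1)] by auto
  \<comment> \<open>A finite cover by small balls is made disjoint, then the null cells are removed.\<close>
  define c where "c i = (fs ! i \<inter> K) - (\<Union>j<i. fs ! j)" for i
  define P where "P = {A \<in> c ` {..<length fs}. 0 < measure \<nu> A}"
  have fo: "fs ! i \<in> sets \<mu>" if "i < length fs" for i
    using that fs F(2) nth_mem[OF that] mms_openin[OF mms openin_mball_of[of X]] by auto
  have cs: "c i \<in> sets \<nu>" if "i < length fs" for i
  proof -
    have "c i \<in> sets \<mu>" unfolding c_def using fo that Ks by (intro sets.Diff sets.Int sets.finite_UN) auto
    moreover have "c i \<subseteq> K" by (auto simp: c_def)
    ultimately show ?thesis unfolding \<nu>_def by (subst sets_restrict_space_iff) (use Ks in auto)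
  qed
  have cd: "c i \<inter> c j = {}" if "i < j" for i j using that by (auto simp: c_def)
  have dis: "disjoint P"
  proof (rule disjointI)
    fix A B assume AB: "A \<in> P" "B \<in> P" "A \<noteq> B"
    then obtain i j where ij: "A = c i" "B = c j" by (auto simp: P_def)
    then have "i < j \<or> j < i" using AB by (metis nat_neq_iff)
    then show "A \<inter> B = {}" using cd ij by blast
  qed
  have cover: "x \<in> (\<Union>i<length fs. c i)" if x: "x \<in> K" for x
  proof -
    have "\<exists>i. i < length fs \<and> x \<in> fs ! i" using F(3) x fs by (metis UnionE in_set_conv_nth subsetD)
    then obtain i where i: "i < length fs \<and> x \<in> fs ! i" and m: "\<And>j. j < i \<Longrightarrow> \<not> (j < length fs \<and> x \<in> fs ! j)"
      using exists_least_iff[of "\<lambda>i. i < length fs \<and> x \<in> fs ! i"] by auto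
    then have "x \<in> c i" using x by (auto simp: c_def)
    then show ?thesis using i by auto
  qed
  have "AE x in \<nu>. \<forall>i\<in>{..<length fs}. measure \<nu> (c i) = 0 \<longrightarrow> x \<notin> c i"
  proof (rule AE_finite_allI)
    fix i assume i: "i \<in> {..<length fs}"
    show "AE x in \<nu>. measure \<nu> (c i) = 0 \<longrightarrow> x \<notin> c i"
    proof (cases "measure \<nu> (c i) = 0")
      case True
      then have "c i \<in> null_sets \<nu>" using cs i by (auto simp: null_sets_def emeasure_eq_measure)
      then show ?thesis by (auto dest: AE_not_in)
    qed auto
  qed simp
  then have ae: "AE x in \<nu>. x \<in> \<Union>P"
  proof (rule AE_mp, intro AE_I2 impI)
    fix x assume x: "x \<in> space \<nu>" "\<forall>i\<in>{..<length fs}. measure \<nu> (c i) = 0 \<longrightarrow> x \<notin> c i"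
    then obtain i where "i < length fs" "x \<in> c i" using cover sn by auto
    moreover then have "measure \<nu> (c i) > 0" using x(2) by (metis lessThan_iff zero_less_measure_iff)
    ultimately show "x \<in> \<Union>P" by (auto simp: P_def)
  qed
  have "cell_partition \<nu> P"
    unfolding cell_partition_def using cs dis ae by (auto simp: P_def)
  moreover have "mdist X x y < e" if A: "A \<in> P" "x \<in> A" "y \<in> A" for A x y
  proof -
    obtain i where i: "i < length fs" "A = c i" using A by (auto simp: P_def)
    then obtain z where z: "fs ! i = mball_of X z (e/2)" using fs F(2) nth_mem[OF i(1)] by auto
    have "x \<in> mball_of X z (e/2)" "y \<in> mball_of X z (e/2)" using A i z by (auto simp: c_def)
    then have "mdist X z x < e/2" "mdist X z y < e/2" "x \<in> mspace X" "y \<in> mspace X" "z \<in> mspace X" by auto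
    then show ?thesis using mdist_triangle[of x X z y] mdist_commute[of X x z] by auto
  qed
  ultimately show ?thesis using that unfolding \<nu>_def by blast
qed

text \<open>
  Cells of diameter at most \<open>1 / (n + 1)\<close> that meet a compact set \<open>C\<close> lie in a neighbourhood
  of \<open>C\<close> which shrinks to \<open>C\<close>; indicators of compact sets span a dense subspace by inner
  regularity.
\<close>
lemma compact_resolving_partitions:
  assumes mms: "metric_measure_space X \<mu>" and K: "compactin (mtopology_of X) K"
  obtains P where "finite_measure.resolving (restrict_space \<mu> K) P"
proof -
  have Ks: "K \<in> sets \<mu>" and Ksp: "K \<subseteq> mspace X"
    using mms_compact_sets[OF mms K] compactin_subset_topspace[OF K] by auto
  define \<nu> where "\<nu> = restrict_space \<mu> K"
  interpret finite_measure \<nu> unfolding \<nu>_def by (rule finite_measure_restrict_compact[OF mms K])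
  have sn: "space \<nu> = K" using Ksp mms_space[OF mms] by (auto simp: \<nu>_def space_restrict_space)
  have sets_nu: "A \<in> sets \<nu> \<longleftrightarrow> A \<in> sets \<mu> \<and> A \<subseteq> K" for A
    unfolding \<nu>_def by (subst sets_restrict_space_iff) (use Ks in auto)
  have meas_nu: "measure \<nu> A = measure \<mu> A" if "A \<subseteq> K" for A
    unfolding \<nu>_def using that Ks by (intro measure_restrict_space) auto
  have "\<forall>n::nat. \<exists>P. cell_partition \<nu> P \<and> (\<forall>A\<in>P. \<forall>x\<in>A. \<forall>y\<in>A. mdist X x y < 1 / (real n + 1))"
    unfolding \<nu>_def by (intro allI, rule compact_small_cells[OF mms K, of "1 / (real n + 1)" for n]) auto
  then obtain P where P: "\<And>n. cell_partition \<nu> (P n)"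
    "\<And>n A x y. A \<in> P n \<Longrightarrow> x \<in> A \<Longrightarrow> y \<in> A \<Longrightarrow> mdist X x y < 1 / (real n + 1)" by metis
  have "resolving P"
  proof (rule resolvingI[OF P(1)])
    fix A and e :: real assume A: "A \<in> sets \<nu>" and e: "e > 0"
    have A': "A \<in> sets \<mu>" "A \<subseteq> K" using A sets_nu by auto
    have "emeasure \<mu> A < \<infinity>" using mms_compact_finite[OF mms K] emeasure_mono[OF A'(2) Ks] by (rule le_less_trans[rotated])
    then obtain C where C: "compactin (mtopology_of X) C" "C \<subseteq> A" "measure \<mu> (A - C) < e"
      using mms_inner_regular[OF mms A'(1) _ e] by auto
    have CK: "C \<subseteq> K" using C A' by auto
    have Cs: "C \<in> sets \<nu>" using mms_compact_sets[OF mms C(1)] CK sets_nu by auto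
    define U where "U n = K \<inter> (\<Union>x\<in>C. mball_of X x (1 / (real n + 1)))" for n :: nat
    have Us: "U n \<in> sets \<nu>" for n
    proof -
      have "openin (mtopology_of X) (\<Union>x\<in>C. mball_of X x (1 / (real n + 1)))"
        using openin_mball_of[of X] by (intro openin_Union) auto
      then show ?thesis unfolding sets_nu U_def using Ks mms_openin[OF mms] by auto
    qed
    have Udec: "decseq U"
    proof (rule decseq_SucI)
      fix n
      have "1 / (real (Suc n) + 1) \<le> 1 / (real n + 1)" by (simp add: frac_le)
      then show "U (Suc n) \<subseteq> U n" by (fastforce simp: U_def)
    qed
    have UC: "(\<Inter>n. U n) = C"
    proof
      have "x \<in> mtopology_of X closure_of C" if x: "x \<in> (\<Inter>n. U n)" for x
        unfolding mtopology_of_def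
      proof (subst Metric_space.metric_closure_of, simp, intro CollectI conjI allI impI)
        show "x \<in> mspace X" using x Ksp by (auto simp: U_def)
        fix r :: real assume "0 < r"
        then obtain n :: nat where n: "1 / (real n + 1) < r" by (metis nat_approx_posE of_nat_Suc add.commute)
        from x obtain y where "y \<in> C" "x \<in> mball_of X y (1 / (real n + 1))" by (auto simp: U_def)
        then show "\<exists>y\<in>C. y \<in> Metric_space.mball (mspace X) (mdist X) x r"
          using n by (intro bexI[of _ y]) (auto simp: mdist_commute Metric_space.in_mball)
      qed
      moreover have "mtopology_of X closure_of C = C"
        using compactin_imp_closedin[OF Hausdorff_mtopology_of C(1)] by (simp add: closure_of_closedin)
      ultimately show "(\<Inter>n. U n) \<subseteq> C" by auto
      show "C \<subseteq> (\<Inter>n. U n)"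
      proof
        fix x assume x: "x \<in> C"
        then have "x \<in> mspace X" "x \<in> K" using CK Ksp by auto
        then have "mdist X x x = 0" by simp
        then have "x \<in> mball_of X x (1 / (real n + 1))" for n using \<open>x \<in> mspace X\<close> by (simp del: mdist_zero)
        then show "x \<in> (\<Inter>n. U n)" using x \<open>x \<in> K\<close> unfolding U_def by blast
      qed
    qed
    have lim: "(\<lambda>n. measure \<nu> (U n - C)) \<longlonglongrightarrow> 0"
    proof -
      have "(\<lambda>n. measure \<nu> (U n)) \<longlonglongrightarrow> measure \<nu> (\<Inter>n. U n)"
        using Us Udec by (intro finite_Lim_measure_decseq) auto
      then have "(\<lambda>n. measure \<nu> (U n) - measure \<nu> C) \<longlonglongrightarrow> measure \<nu> C - measure \<nu> C"
        unfolding UC by (intro tendsto_intros)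
      moreover have "measure \<nu> (U n - C) = measure \<nu> (U n) - measure \<nu> C" for n
        using Us Cs UC by (intro finite_measure_Diff) auto
      ultimately show ?thesis by simp
    qed
    show "\<exists>C\<in>sets \<nu>. C \<subseteq> A \<and> measure \<nu> (A - C) < e \<and>
      (\<forall>c. (\<lambda>n. LINT x|\<nu>. norm (cell_average \<nu> (P n) (\<lambda>x. indicator C x *\<^sub>R c) x - indicator C x *\<^sub>R c)) \<longlonglongrightarrow> 0)"
    proof (intro bexI[OF _ Cs] conjI allI)
      show "C \<subseteq> A" by fact
      show "measure \<nu> (A - C) < e" using meas_nu[of "A - C"] A'(2) C(3) by (simp add: Diff_subset[THEN order_trans])
      fix c :: complex
      have b: "(LINT x|\<nu>. norm (cell_average \<nu> (P n) (\<lambda>x. indicator C x *\<^sub>R c) x - indicator C x *\<^sub>R c)) \<le> 2 * norm c * measure \<nu> (U n - C)" for n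
      proof (rule cell_average_indicator_error_le[OF P(1) Cs Us])
        fix B x assume B: "B \<in> P n" "B \<inter> C \<noteq> {}"
        then obtain y where y: "y \<in> B" "y \<in> C" by auto
        have BK: "B \<subseteq> K" using P(1)[of n] B(1) sets_nu unfolding cell_partition_def by blast
        show "B \<subseteq> U n"
        proof
          fix x assume x: "x \<in> B"
          then have "x \<in> mball_of X y (1 / (real n + 1))" using P(2)[OF B(1) y(1) x] BK Ksp y by auto
          then show "x \<in> U n" unfolding U_def using x BK y(2) by blast
        qed
      qed
      have lim0: "(\<lambda>n. 2 * norm c * measure \<nu> (U n - C)) \<longlonglongrightarrow> 0" using tendsto_mult_left[OF lim, of "2 * norm c"] by simp
      show "(\<lambda>n. LINT x|\<nu>. norm (cell_average \<nu> (P n) (\<lambda>x. indicator C x *\<^sub>R c) x - indicator C x *\<^sub>R c)) \<longlonglongrightarrow> 0"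
      proof (rule tendsto_sandwich[OF _ _ tendsto_const lim0])
        show "\<forall>\<^sub>F n in sequentially. 0 \<le> (LINT x|\<nu>. norm (cell_average \<nu> (P n) (\<lambda>x. indicator C x *\<^sub>R c) x - indicator C x *\<^sub>R c))"
          by (intro always_eventually allI integral_nonneg_AE AE_I2 norm_ge_zero)
      qed (intro always_eventually allI b)
    qed
  qed
  then show ?thesis using that unfolding \<nu>_def by blast
qed

section \<open>Interpolation in finite dimension\<close>

text \<open>
  Exponents enter through their reciprocal \<open>r\<close>, so that the exponent \<open>\<infinity>\<close> becomes \<open>r = 0\<close> and
  the relation between the three exponents becomes affine.
\<close>
definition weighted_norm_le :: "real \<Rightarrow> ('i \<Rightarrow> real) \<Rightarrow> 'i set \<Rightarrow> ('i \<Rightarrow> real) \<Rightarrow> real \<Rightarrow> bool" where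
  "weighted_norm_le r w P b V \<longleftrightarrow>
     (if r = 0 then \<forall>A\<in>P. b A \<le> V else (\<Sum>A\<in>P. w A * b A powr (1 / r)) \<le> V powr (1 / r))"

lemma sum_weighted_ln_le:
  fixes x :: "'i \<Rightarrow> real"
  assumes "finite Q" "\<And>A. A \<in> Q \<Longrightarrow> 0 < l A" "sum l Q = 1" "\<And>A. A \<in> Q \<Longrightarrow> 0 < x A"
  shows "(\<Sum>A\<in>Q. l A * ln (x A)) \<le> ln (\<Sum>A\<in>Q. l A * x A)"
proof -
  define S where "S = (\<Sum>A\<in>Q. l A * x A)"
  have ne: "Q \<noteq> {}" using assms(3) by auto
  have S: "S > 0" unfolding S_def using assms ne by (intro sum_pos) auto
  have "(\<Sum>A\<in>Q. l A * ln (x A)) \<le> (\<Sum>A\<in>Q. l A * (ln S + (x A / S - 1)))"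
  proof (intro sum_mono mult_left_mono)
    fix A assume A: "A \<in> Q"
    have "ln (x A / S) \<le> x A / S - 1" using S assms(4)[OF A] by (intro ln_le_minus_one) auto
    then show "ln (x A) \<le> ln S + (x A / S - 1)" using S assms(4)[OF A] by (simp add: ln_div)
    show "0 \<le> l A" using assms(2)[OF A] by simp
  qed
  also have "\<dots> = (\<Sum>A\<in>Q. l A * (ln S - 1)) + (\<Sum>A\<in>Q. (l A * x A) / S)"
    by (simp add: sum.distrib[symmetric] algebra_simps)
  also have "\<dots> = ln S" using S assms(3) by (simp add: sum_distrib_right[symmetric] sum_divide_distrib[symmetric] S_def[symmetric])
  finally show ?thesis by (simp add: S_def)
qed

text \<open>
  The concavity of \<open>ln\<close> applied to \<open>w\<^sub>A b\<^sub>A\<^bsup>1/r\<^esup> / l\<^sub>A\<close>. The correction is \<open>r\<close> times an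
  entropy that does not depend on \<open>r\<close> or \<open>b\<close>; this is why it cancels in the interpolation.
\<close>
lemma weighted_norm_le_ln:
  assumes "finite P" "Q \<subseteq> P" and w: "\<And>A. A \<in> P \<Longrightarrow> 0 < w A" and r: "0 \<le> r"
    and l: "\<And>A. A \<in> Q \<Longrightarrow> 0 < l A" "sum l Q = 1"
    and b: "\<And>A. A \<in> P \<Longrightarrow> 0 < b A" and V: "0 < V" "weighted_norm_le r w P b V"
  shows "(\<Sum>A\<in>Q. l A * ln (b A)) \<le> ln V + r * (\<Sum>A\<in>Q. l A * ln (l A / w A))"
proof (cases "r = 0")
  case True
  have "(\<Sum>A\<in>Q. l A * ln (b A)) \<le> (\<Sum>A\<in>Q. l A * ln V)"
    using assms True by (intro sum_mono mult_left_mono) (auto simp: weighted_norm_le_def subset_iff less_imp_le)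
  then show ?thesis using True l by (simp add: sum_distrib_right[symmetric])
next
  case False
  then have r: "r > 0" using r by simp
  have fQ: "finite Q" using assms finite_subset by auto
  have ne: "Q \<noteq> {}" using l by auto
  define x where "x A = w A * b A powr (1 / r) / l A" for A
  have x: "0 < x A" if A: "A \<in> Q" for A
  proof -
    have "A \<in> P" using A assms(2) by auto
    then show ?thesis using w[of A] b[of A] l(1)[OF A] by (simp add: x_def)
  qed
  have "(\<Sum>A\<in>Q. l A * ln (x A)) \<le> ln (\<Sum>A\<in>Q. l A * x A)"
    by (rule sum_weighted_ln_le[OF fQ l x])
  also have "(\<Sum>A\<in>Q. l A * x A) = (\<Sum>A\<in>Q. w A * b A powr (1 / r))"
    using l by (intro sum.cong) (auto simp: x_def less_imp_neq[symmetric] dest: l(1))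
  also have "ln \<dots> \<le> ln (V powr (1 / r))"
  proof (rule ln_mono)
    show "0 < (\<Sum>A\<in>Q. w A * b A powr (1 / r))"
      using assms fQ ne by (intro sum_pos mult_pos_pos) (auto simp: subset_iff b less_imp_neq[symmetric])
    have "(\<Sum>A\<in>Q. w A * b A powr (1 / r)) \<le> (\<Sum>A\<in>P. w A * b A powr (1 / r))"
      using assms by (intro sum_mono2) (auto simp: less_imp_le)
    then show "(\<Sum>A\<in>Q. w A * b A powr (1 / r)) \<le> V powr (1 / r)"
      using V False by (auto simp: weighted_norm_le_def)
  qed
  also have "\<dots> = ln V / r" using V by (simp add: ln_powr)
  finally have 1: "(\<Sum>A\<in>Q. l A * ln (x A)) \<le> ln V / r" .
  have "(\<Sum>A\<in>Q. l A * ln (x A)) = (\<Sum>A\<in>Q. l A * ln (b A) / r - l A * ln (l A / w A))"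
  proof (rule sum.cong[OF refl])
    fix A assume A: "A \<in> Q"
    then have p: "0 < w A" "0 < b A" "0 < l A" using assms by (auto simp: subset_iff)
    then have "ln (x A) = ln (w A) + ln (b A) / r - ln (l A)"
      by (simp add: x_def ln_div ln_mult_pos ln_powr)
    moreover have "ln (l A / w A) = ln (l A) - ln (w A)" using p by (simp add: ln_div)
    ultimately show "l A * ln (x A) = l A * ln (b A) / r - l A * ln (l A / w A)"
      by (simp only:) (simp add: algebra_simps)
  qed
  also have "\<dots> = (\<Sum>A\<in>Q. l A * ln (b A)) / r - (\<Sum>A\<in>Q. l A * ln (l A / w A))"
    by (simp add: sum_subtractf sum_divide_distrib)
  finally have "(\<Sum>A\<in>Q. l A * ln (b A)) / r \<le> ln V / r + (\<Sum>A\<in>Q. l A * ln (l A / w A))" using 1 by simp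
  then have "(\<Sum>A\<in>Q. l A * ln (b A)) / r * r \<le> (ln V / r + (\<Sum>A\<in>Q. l A * ln (l A / w A))) * r"
    using r by (intro mult_right_mono) auto
  then show ?thesis using r by (simp add: algebra_simps)
qed

text \<open>
  The scalar inequalities for the single coordinates are averaged with probability weights \<open>l\<close>
  and then estimated on each edge by \<open>weighted_norm_le_ln\<close>. For \<open>r > 0\<close> the weights
  proportional to \<open>w\<^sub>A \<bar>c\<^sub>A(\<theta>)\<bar>\<^bsup>1/r\<^esup>\<close> turn the left side into the norm at \<open>\<theta>\<close>. Coordinates
  that vanish at \<open>\<theta>\<close> are left out, because Hirschman's lemma says nothing about them.
\<close>
lemma finite_interpolation:
  fixes c :: "'i \<Rightarrow> complex \<Rightarrow> complex" and V0 V1 :: "real \<Rightarrow> real"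
  assumes \<theta>: "0 < \<theta>" "\<theta> < 1" and P: "finite P" and w: "\<And>A. A \<in> P \<Longrightarrow> 0 < w A"
    and r0: "0 \<le> r0" and r1: "0 \<le> r1" and \<gamma>: "0 \<le> \<gamma>" "\<gamma> < pi" and \<eta>: "\<eta> > 0"
    and hol: "\<And>A. A \<in> P \<Longrightarrow> c A holomorphic_on open_strip"
    and cont: "\<And>A. A \<in> P \<Longrightarrow> continuous_on (closure open_strip) (c A)"
    and growth: "\<And>A z. A \<in> P \<Longrightarrow> z \<in> closure open_strip \<Longrightarrow> norm (c A z) \<le> exp (C A * exp (\<gamma> * \<bar>Im z\<bar>))"
    and V0: "\<And>y. 0 < V0 y" "\<And>y. weighted_norm_le r0 w P (\<lambda>A. max (norm (c A (\<i> * of_real y))) \<eta>) (V0 y)"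
    and V1: "\<And>y. 0 < V1 y" "\<And>y. weighted_norm_le r1 w P (\<lambda>A. max (norm (c A (1 + \<i> * of_real y))) \<eta>) (V1 y)"
    and i0: "integrable lborel (\<lambda>y. half_poisson (1 - \<theta>) y * ln (V0 y))"
    and i1: "integrable lborel (\<lambda>y. half_poisson \<theta> y * ln (V1 y))"
    and I: "I = (LBINT y. half_poisson (1 - \<theta>) y * ln (V0 y)) + (LBINT y. half_poisson \<theta> y * ln (V1 y))"
  shows "weighted_norm_le ((1 - \<theta>) * r0 + \<theta> * r1) w P (\<lambda>A. norm (c A (of_real \<theta>))) (exp I)"
proof -
  define r where "r = (1 - \<theta>) * r0 + \<theta> * r1"
  have \<theta>': "0 < 1 - \<theta>" "1 - \<theta> < 1" using \<theta> by auto
  define a where "a A = norm (c A (of_real \<theta>))" for A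
  define Q where "Q = {A\<in>P. a A \<noteq> 0}"
  have fQ: "finite Q" using P by (simp add: Q_def)
  have aQ: "a A > 0" if "A \<in> Q" for A using that by (auto simp: Q_def a_def)
  define u0 where "u0 A y = ln (max (norm (c A (\<i> * of_real y))) \<eta>)" for A y
  define u1 where "u1 A y = ln (max (norm (c A (1 + \<i> * of_real y))) \<eta>)" for A y
  have H: "integrable lborel (\<lambda>y. half_poisson (1 - \<theta>) y * u0 A y)"
    "integrable lborel (\<lambda>y. half_poisson \<theta> y * u1 A y)"
    "ln (a A) \<le> (LBINT y. half_poisson (1 - \<theta>) y * u0 A y) + (LBINT y. half_poisson \<theta> y * u1 A y)" if "A \<in> Q" for A
    using hirschman_lemma[OF \<theta> hol cont \<gamma> growth _ \<eta>, of A] that unfolding Q_def a_def u0_def u1_def by auto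
  have main: "(\<Sum>A\<in>Q. l A * ln (a A)) \<le> I + r * (\<Sum>A\<in>Q. l A * ln (l A / w A))"
    if l: "\<And>A. A \<in> Q \<Longrightarrow> 0 < l A" "sum l Q = 1" for l
  proof -
    define E where "E = (\<Sum>A\<in>Q. l A * ln (l A / w A))"
    have b0: "(\<Sum>A\<in>Q. l A * u0 A y) \<le> ln (V0 y) + r0 * E" for y
      unfolding u0_def E_def using l w r0 V0 P \<eta> by (intro weighted_norm_le_ln[OF P]) (auto simp: Q_def less_max_iff_disj)
    have b1: "(\<Sum>A\<in>Q. l A * u1 A y) \<le> ln (V1 y) + r1 * E" for y
      unfolding u1_def E_def using l w r1 V1 P \<eta> by (intro weighted_norm_le_ln[OF P]) (auto simp: Q_def less_max_iff_disj)
    have pull: "(\<Sum>A\<in>Q. l A * (LBINT y. half_poisson t y * u A y)) \<le> (LBINT y. half_poisson t y * ln (V y)) + t * s * E"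
      if t: "0 < t" "t < 1" and iu: "\<And>A. A \<in> Q \<Longrightarrow> integrable lborel (\<lambda>y. half_poisson t y * u A y)"
        and b: "\<And>y. (\<Sum>A\<in>Q. l A * u A y) \<le> ln (V y) + s * E"
        and iV: "integrable lborel (\<lambda>y. half_poisson t y * ln (V y))" for t s u and V :: "real \<Rightarrow> real"
    proof -
      have eq: "half_poisson t y * (\<Sum>A\<in>Q. l A * u A y) = (\<Sum>A\<in>Q. l A * (half_poisson t y * u A y))" for y
        by (simp add: sum_distrib_left mult_ac)
      have "(\<Sum>A\<in>Q. l A * (LBINT y. half_poisson t y * u A y)) = (LBINT y. half_poisson t y * (\<Sum>A\<in>Q. l A * u A y))"
        unfolding eq using iu by (subst Bochner_Integration.integral_sum) auto
      also have "\<dots> \<le> (LBINT y. half_poisson t y * ln (V y) + s * E * half_poisson t y)"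
      proof (rule integral_mono)
        show "integrable lborel (\<lambda>y. half_poisson t y * (\<Sum>A\<in>Q. l A * u A y))"
          unfolding eq using iu by auto
        show "integrable lborel (\<lambda>y. half_poisson t y * ln (V y) + s * E * half_poisson t y)"
          using iV half_poisson_mass[OF t] by auto
        fix y
        have "half_poisson t y * (\<Sum>A\<in>Q. l A * u A y) \<le> half_poisson t y * (ln (V y) + s * E)"
          using b half_poisson_pos[OF t, of y] by (intro mult_left_mono) auto
        then show "half_poisson t y * (\<Sum>A\<in>Q. l A * u A y) \<le> half_poisson t y * ln (V y) + s * E * half_poisson t y"
          by (simp add: algebra_simps)
      qed
      also have "\<dots> = (LBINT y. half_poisson t y * ln (V y)) + t * s * E"
        using iV half_poisson_mass[OF t] by simp
      finally show ?thesis .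
    qed
    have "(\<Sum>A\<in>Q. l A * ln (a A)) \<le> (\<Sum>A\<in>Q. l A * ((LBINT y. half_poisson (1 - \<theta>) y * u0 A y) + (LBINT y. half_poisson \<theta> y * u1 A y)))"
      using H(3) l(1) by (intro sum_mono mult_left_mono) (auto simp: less_imp_le)
    also have "\<dots> = (\<Sum>A\<in>Q. l A * (LBINT y. half_poisson (1 - \<theta>) y * u0 A y)) + (\<Sum>A\<in>Q. l A * (LBINT y. half_poisson \<theta> y * u1 A y))"
      by (simp add: distrib_left sum.distrib)
    also have "\<dots> \<le> ((LBINT y. half_poisson (1 - \<theta>) y * ln (V0 y)) + (1 - \<theta>) * r0 * E) + ((LBINT y. half_poisson \<theta> y * ln (V1 y)) + \<theta> * r1 * E)"
      by (intro add_mono pull \<theta> \<theta>' H b0 b1 i0 i1)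
    finally show ?thesis by (simp add: I r_def E_def algebra_simps)
  qed
  show ?thesis
  proof (cases "r = 0")
    case True
    have "a A \<le> exp I" if "A \<in> P" for A
    proof (cases "A \<in> Q")
      case AQ: True
      have z: "r0 = 0" "r1 = 0"
        using True \<theta> r0 r1 by (auto simp: r_def add_nonneg_eq_0_iff)
      have "ln (a A) \<le> (LBINT y. half_poisson (1 - \<theta>) y * u0 A y) + (LBINT y. half_poisson \<theta> y * u1 A y)"
        by (rule H(3)[OF AQ])
      also have "\<dots> \<le> I"
        unfolding I
      proof (intro add_mono integral_mono H AQ i0 i1 mult_left_mono)
        fix y
        show "u0 A y \<le> ln (V0 y)" "u1 A y \<le> ln (V1 y)"
          unfolding u0_def u1_def using V0(2)[of y] V1(2)[of y] z that \<eta>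
          by (auto intro!: ln_mono simp: weighted_norm_le_def less_max_iff_disj)
      qed (use half_poisson_pos[OF \<theta>] half_poisson_pos[OF \<theta>'] in \<open>auto simp: less_imp_le\<close>)
      finally show ?thesis using aQ[OF AQ] by (metis exp_le_cancel_iff exp_ln)
    next
      case False
      then show ?thesis using that by (auto simp: Q_def)
    qed
    then show ?thesis using True by (simp add: weighted_norm_le_def r_def[symmetric] a_def)
  next
    case False
    then have rp: "r > 0" using \<theta> r0 r1 by (simp add: r_def order_less_le)
    define S where "S = (\<Sum>A\<in>Q. w A * a A powr (1 / r))"
    have Seq: "(\<Sum>A\<in>P. w A * a A powr (1 / r)) = S"
      unfolding S_def using P by (intro sum.mono_neutral_right) (auto simp: Q_def)
    have "S \<le> exp I powr (1 / r)"
    proof (cases "Q = {}")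
      case True
      then show ?thesis by (simp add: S_def)
    next
      case ne: False
      have S: "S > 0" unfolding S_def using fQ ne w aQ by (intro sum_pos mult_pos_pos) (auto simp: Q_def)
      \<comment> \<open>For these weights \<open>ln (a A) = r ln S + r ln (l A / w A)\<close>, so the same entropy term
        appears on both sides and cancels.\<close>
      define l where "l A = w A * a A powr (1 / r) / S" for A
      have l: "0 < l A" if "A \<in> Q" for A using that S w aQ[OF that] by (auto simp: l_def Q_def)
      have l1: "sum l Q = 1" using S by (simp add: l_def S_def[symmetric] sum_divide_distrib[symmetric])
      have la: "ln (a A) = r * ln S + r * ln (l A / w A)" if A: "A \<in> Q" for A
      proof -
        have "l A / w A = a A powr (1 / r) / S" using A w[of A] by (auto simp: l_def Q_def)
        then have "ln (l A / w A) = ln (a A) / r - ln S" using aQ[OF A] S by (simp add: ln_div ln_powr)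
        then have "r * (ln S + ln (l A / w A)) = ln (a A)" using rp by simp
        then show ?thesis by (simp add: distrib_left)
      qed
      have "(\<Sum>A\<in>Q. l A * ln (a A)) = r * ln S + r * (\<Sum>A\<in>Q. l A * ln (l A / w A))"
      proof -
        have "(\<Sum>A\<in>Q. l A * ln (a A)) = (\<Sum>A\<in>Q. l A * (r * ln S) + r * (l A * ln (l A / w A)))"
          using la by (intro sum.cong) (auto simp: algebra_simps)
        then show ?thesis using l1 by (simp add: sum.distrib sum_distrib_left[symmetric] sum_distrib_right[symmetric])
      qed
      then have "r * ln S \<le> I" using main[OF l l1] by simp
      then have "ln S \<le> I / r" using rp by (simp add: field_simps)
      then have "S \<le> exp (I / r)" using S by (metis exp_le_cancel_iff exp_ln)
      then show ?thesis by (simp add: powr_def)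
    qed
    then show ?thesis using False by (simp add: weighted_norm_le_def r_def[symmetric] a_def[symmetric] Seq)
  qed
qed

section \<open>Limits under integrals that may be minus infinity\<close>

text \<open>
  Fatou's lemma for the nonnegative functions \<open>D - a n\<close>. Upper bounds for \<open>limsup\<close> are
  expressed by eventual inequalities \<open>a n y < t\<close>, which also make sense when the limiting
  function takes the value \<open>- \<infinity>\<close>.
\<close>
lemma
  fixes a :: "nat \<Rightarrow> 'a \<Rightarrow> real" and D :: "'a \<Rightarrow> real" and A :: "'a \<Rightarrow> ereal"
  assumes A[measurable]: "A \<in> borel_measurable M" and D: "integrable M D" and AD: "\<And>y. A y \<le> ereal (D y)"
  shows ereal_integral_less_top: "ereal_integral M A < \<infinity>"
    and reverse_Fatou_ereal: "\<lbrakk>\<And>n. integrable M (a n); \<And>n y. a n y \<le> D y;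
       \<And>y t. A y < ereal t \<Longrightarrow> eventually (\<lambda>n. a n y < t) sequentially; \<And>n. L \<le> integral\<^sup>L M (a n)\<rbrakk>
      \<Longrightarrow> ereal L \<le> ereal_integral M A"
proof -
  note [measurable] = borel_measurable_integrable[OF D]
  define dp dm ap am where "dp = (\<integral>\<^sup>+x. ennreal (D x) \<partial>M)" and "dm = (\<integral>\<^sup>+x. ennreal (- D x) \<partial>M)"
    and "ap = (\<integral>\<^sup>+x. e2ennreal (A x) \<partial>M)" and "am = (\<integral>\<^sup>+x. e2ennreal (- A x) \<partial>M)"
  have dfin: "dp < \<infinity>" "dm < \<infinity>" using D by (auto simp: real_integrable_def dp_def dm_def less_top)
  have "ap \<le> dp" unfolding ap_def dp_def
  proof (intro nn_integral_mono)
    fix x show "e2ennreal (A x) \<le> ennreal (D x)" using e2ennreal_mono[OF AD[of x]] by (simp add: e2ennreal_ereal)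
  qed
  then have apfin: "ap < \<infinity>" using dfin by (auto intro: le_less_trans)
  show "ereal_integral M A < \<infinity>"
    unfolding ereal_integral_def ap_def[symmetric] am_def[symmetric]
    using apfin by (cases ap; cases am) auto
  assume a: "\<And>n. integrable M (a n)" and aD: "\<And>n y. a n y \<le> D y"
    and ev: "\<And>y t. A y < ereal t \<Longrightarrow> eventually (\<lambda>n. a n y < t) sequentially" and L: "\<And>n. L \<le> integral\<^sup>L M (a n)"
  note [measurable] = borel_measurable_integrable[OF a]
  define K where "K = (\<integral>\<^sup>+x. e2ennreal (ereal (D x) - A x) \<partial>M)"
  have "K \<le> (\<integral>\<^sup>+x. liminf (\<lambda>n. ennreal (D x - a n x)) \<partial>M)"
    unfolding K_def
  proof (intro nn_integral_mono)
    fix x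
    show "e2ennreal (ereal (D x) - A x) \<le> liminf (\<lambda>n. ennreal (D x - a n x))"
      unfolding le_Liminf_iff
    proof (intro allI impI)
      fix y assume y: "y < e2ennreal (ereal (D x) - A x)"
      then obtain s where s: "y = ennreal s" "0 \<le> s" by (cases y) auto
      have "A x < ereal (D x - s)"
      proof (cases "A x")
        case (real r)
        then have "ennreal s < ennreal (D x - r)" using y s by (simp add: e2ennreal_ereal)
        then show ?thesis using real s by (simp add: ennreal_less_iff)
      qed (use AD[of x] in auto)
      then show "eventually (\<lambda>n. y < ennreal (D x - a n x)) sequentially"
        by (rule eventually_mono[OF ev]) (use s in \<open>auto simp: ennreal_less_iff\<close>)
    qed
  qed
  also have "\<dots> \<le> liminf (\<lambda>n. \<integral>\<^sup>+x. ennreal (D x - a n x) \<partial>M)"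
    by (rule nn_integral_liminf) measurable
  also have "\<dots> \<le> liminf (\<lambda>n::nat. ennreal (integral\<^sup>L M D - L))"
  proof (rule Liminf_mono, rule always_eventually, rule allI)
    fix n
    have "(\<integral>\<^sup>+x. ennreal (D x - a n x) \<partial>M) = ennreal (LINT x|M. D x - a n x)"
      using D a aD by (intro nn_integral_eq_integral) auto
    also have "\<dots> \<le> ennreal (integral\<^sup>L M D - L)" using D a L[of n] by (auto intro!: ennreal_leI)
    finally show "(\<integral>\<^sup>+x. ennreal (D x - a n x) \<partial>M) \<le> ennreal (integral\<^sup>L M D - L)" .
  qed
  also have "\<dots> = ennreal (integral\<^sup>L M D - L)" by (simp add: Liminf_const)
  finally have K: "K \<le> ennreal (integral\<^sup>L M D - L)" .
  have DL: "0 \<le> integral\<^sup>L M D - L"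
    using integral_mono[OF a D, of 0] aD L[of 0] by auto
  have "am + dp = ap + dm + K"
  proof -
    have pw: "e2ennreal (- A x) + ennreal (D x) = e2ennreal (A x) + ennreal (- D x) + e2ennreal (ereal (D x) - A x)" for x
    proof (cases "A x")
      case (real r)
      then have rD: "r \<le> D x" using AD[of x] by simp
      have "ennreal (- r) + ennreal (D x) = ennreal r + ennreal (- D x) + ennreal (D x - r)"
        using rD by (cases "r \<ge> 0"; cases "D x \<ge> 0") (auto simp: ennreal_neg simp flip: ennreal_plus)
      then show ?thesis using real by (simp add: e2ennreal_ereal)
    qed (use AD[of x] in auto)
    show ?thesis unfolding am_def dp_def ap_def dm_def K_def
      by (simp add: nn_integral_add[symmetric] pw)
  qed
  then have le: "am + dp \<le> ap + dm + ennreal (integral\<^sup>L M D - L)" using K by (simp add: add_left_mono)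
  have "ap + dm + ennreal (integral\<^sup>L M D - L) < \<infinity>" using apfin dfin by (simp add: less_top)
  then have amfin: "am < \<infinity>" using le by (metis add_lessD1 ennreal_add_less_top infinity_ennreal_def le_less_trans)
  have ID: "integral\<^sup>L M D = enn2real dp - enn2real dm"
    using real_lebesgue_integral_def[OF D] by (simp add: dp_def dm_def)
  obtain p where p: "dp = ennreal p" "0 \<le> p" using dfin by (cases dp) auto
  obtain m where m: "dm = ennreal m" "0 \<le> m" using dfin by (cases dm) auto
  obtain p' where p': "ap = ennreal p'" "0 \<le> p'" using apfin by (cases ap) auto
  obtain m' where m': "am = ennreal m'" "0 \<le> m'" using amfin by (cases am) auto
  have "m' + p \<le> p' + m + (integral\<^sup>L M D - L)"
    using le p m p' m' DL by (simp flip: ennreal_plus)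
  then have "L \<le> p' - m'" using ID p m by simp
  then show "ereal L \<le> ereal_integral M A"
    unfolding ereal_integral_def ap_def[symmetric] am_def[symmetric] using p' m' by (simp add: enn2ereal_ennreal)
qed

section \<open>Edge norms of cell averages\<close>

text \<open>
  The continuous counterpart of \<open>weighted_norm_le\<close>: \<open>\<parallel>f\<parallel> \<le> B\<close> for the exponent \<open>1 / r\<close>.
\<close>
definition Lp_le :: "real \<Rightarrow> 'a measure \<Rightarrow> ('a \<Rightarrow> complex) \<Rightarrow> real \<Rightarrow> bool" where
  "Lp_le r \<mu> f B \<longleftrightarrow>
     (if r = 0 then AE x in \<mu>. norm (f x) \<le> B
      else (\<integral>\<^sup>+x. ennreal (norm (f x) powr (1 / r)) \<partial>\<mu>) \<le> ennreal (B powr (1 / r)))"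

lemma powr_max_le:
  fixes a b q :: real
  assumes "0 \<le> a" "0 \<le> b"
  shows "max a b powr q \<le> a powr q + b powr q"
  by (auto simp: max_def)

lemma powr_le_linear:
  fixes t e q :: real
  assumes "0 \<le> t" "0 < e" "0 < q" "q \<le> 1"
  shows "t powr q \<le> e powr q + e powr (q - 1) * t"
proof (cases "t \<le> e")
  case True
  then have "t powr q \<le> e powr q" using assms by (intro powr_mono2) auto
  moreover have "0 \<le> e powr (q - 1) * t" using assms by simp
  ultimately show ?thesis by linarith
next
  case False
  then have t: "t > e" "t > 0" using assms by auto
  have "t powr q = t powr (q - 1) * t" using t powr_add[of t "q - 1" 1] by simp
  also have "\<dots> \<le> e powr (q - 1) * t" using t assms by (intro mult_right_mono powr_mono2') auto
  finally show ?thesis using powr_ge_zero[of e q] by linarith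
qed

lemma powr_add_le:
  fixes a b q :: real
  assumes "0 \<le> a" "0 \<le> b" "0 < q" "q \<le> 1"
  shows "(a + b) powr q \<le> a powr q + b powr q"
proof (cases "a + b = 0")
  case True
  then show ?thesis using assms by simp
next
  case False
  then have s: "a + b > 0" using assms by simp
  have *: "x / (a + b) \<le> (x / (a + b)) powr q" if "0 \<le> x" "x \<le> a + b" for x
  proof (cases "x = 0")
    case False
    then have "(x / (a + b)) powr 1 \<le> (x / (a + b)) powr q"
      using that s assms by (intro powr_mono') auto
    then show ?thesis using that s False by simp
  qed simp
  have "1 = a / (a + b) + b / (a + b)" using s by (simp add: add_divide_distrib[symmetric])
  also have "\<dots> \<le> (a / (a + b)) powr q + (b / (a + b)) powr q" using assms by (intro add_mono *) auto
  also have "\<dots> = (a powr q + b powr q) / (a + b) powr q"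
    using assms s by (simp add: powr_divide add_divide_distrib)
  finally show ?thesis using s by (simp add: field_simps)
qed

context finite_measure
begin

lemma cell_partition_sum_measure_le:
  assumes P: "cell_partition M P"
  shows "(\<Sum>A\<in>P. measure M A) \<le> measure M (space M)"
proof -
  have "finite P" "P \<subseteq> sets M" "disjoint P" using P by (auto simp: cell_partition_def)
  then have "(\<Sum>A\<in>P. measure M A) = measure M (\<Union>P)"
    by (intro measure_Union'[symmetric]) (auto simp: pairwise_def disjnt_def disjoint_def fmeasurable_eq_sets)
  also have "\<dots> \<le> measure M (space M)" by (rule bounded_measure)
  finally show ?thesis .
qed

lemma sum_cell_max_powr_le:
  assumes P: "cell_partition M P" and "0 \<le> \<eta>"
  shows "(\<Sum>A\<in>P. measure M A * max (norm (d A)) \<eta> powr q) \<le>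
    (\<Sum>A\<in>P. measure M A * norm (d A) powr q) + \<eta> powr q * measure M (space M)"
proof -
  have "(\<Sum>A\<in>P. measure M A * max (norm (d A)) \<eta> powr q) \<le> (\<Sum>A\<in>P. measure M A * norm (d A) powr q + \<eta> powr q * measure M A)"
  proof (intro sum_mono)
    fix A
    have "measure M A * max (norm (d A)) \<eta> powr q \<le> measure M A * (norm (d A) powr q + \<eta> powr q)"
      using assms(2) by (intro mult_left_mono powr_max_le) auto
    then show "measure M A * max (norm (d A)) \<eta> powr q \<le> measure M A * norm (d A) powr q + \<eta> powr q * measure M A"
      by (simp add: algebra_simps)
  qed
  also have "\<dots> \<le> (\<Sum>A\<in>P. measure M A * norm (d A) powr q) + \<eta> powr q * measure M (space M)"
    using cell_partition_sum_measure_le[OF P] by (auto simp: sum.distrib sum_distrib_left[symmetric] intro!: mult_left_mono)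
  finally show ?thesis .
qed

lemma Lp_le_imp_integrable:
  assumes r: "r > 0" and f: "f \<in> borel_measurable M" and le: "Lp_le r M f B" and B: "0 \<le> B"
  shows "integrable M (\<lambda>x. norm (f x) powr (1 / r))" "(LINT x|M. norm (f x) powr (1 / r)) \<le> B powr (1 / r)"
proof -
  note [measurable] = f
  have le': "(\<integral>\<^sup>+x. ennreal (norm (f x) powr (1 / r)) \<partial>M) \<le> ennreal (B powr (1 / r))"
    using le r by (simp add: Lp_le_def)
  show i: "integrable M (\<lambda>x. norm (f x) powr (1 / r))"
    unfolding integrable_iff_bounded using le' by (auto intro: le_less_trans)
  have "ennreal (LINT x|M. norm (f x) powr (1 / r)) \<le> ennreal (B powr (1 / r))"
    using le' i by (subst (asm) nn_integral_eq_integral) auto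
  then show "(LINT x|M. norm (f x) powr (1 / r)) \<le> B powr (1 / r)" by (simp add: ennreal_le_iff)
qed

text \<open>
  \<open>V n\<close> bounds the truncated edge norms of the \<open>n\<close>-th cell averages of \<open>F\<close>, is continuous and
  bounded away from \<open>0\<close>, so that \<open>ln (V n)\<close> can be integrated, grows uniformly in \<open>n\<close>, and is
  asymptotically at most \<open>B\<close>, the bound for the edge norms of \<open>F\<close> itself. The truncation level
  \<open>1 / (n + 1)\<close> is the number \<open>\<eta>\<close> of Hirschman's lemma.
\<close>
definition majorants :: "(nat \<Rightarrow> 'a set set) \<Rightarrow> real \<Rightarrow> (real \<Rightarrow> 'a \<Rightarrow> complex) \<Rightarrow> (real \<Rightarrow> real) \<Rightarrow> real \<Rightarrow> (nat \<Rightarrow> real \<Rightarrow> real) \<Rightarrow> bool" where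
  "majorants P r F B g V \<longleftrightarrow>
     (\<forall>n. continuous_on UNIV (V n)) \<and>
     (\<forall>n. \<exists>d>0. \<forall>y. d \<le> V n y) \<and>
     (\<exists>D\<ge>0. \<forall>n y. ln (V n y) \<le> D * exp (g * \<bar>y\<bar>)) \<and>
     (\<forall>n y. weighted_norm_le r (measure M) (P n) (\<lambda>A. max (norm (cell_mean M (F y) A)) (1 / (real n + 1))) (V n y)) \<and>
     (\<forall>y t. B y < t \<longrightarrow> eventually (\<lambda>n. V n y < t) sequentially)"

text \<open>
  For a finite exponent it suffices to control the sums of powers \<open>S\<close>; the truncation
  contributes at most \<open>(1 / (n + 1)) powr (1 / r)\<close> times the total measure. One more multiple
  of that number keeps the majorant positive.
\<close>
lemma majorants_from_sums:
  assumes r: "r > 0" and P: "\<And>n. cell_partition M (P n)" and g: "0 \<le> g"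
    and B: "\<And>y. 0 \<le> B y"
    and S0: "\<And>n y. 0 \<le> S n y" and Sc: "\<And>n. continuous_on UNIV (S n)"
    and Sg: "K \<ge> 0" "\<And>n y. S n y \<le> K * exp (D * exp (g * \<bar>y\<bar>))" and D: "0 \<le> D"
    and Sw: "\<And>n y. (\<Sum>A\<in>P n. measure M A * norm (cell_mean M (F y) A) powr (1 / r)) \<le> S n y"
    and Sl: "\<And>y t. B y powr (1 / r) < t \<Longrightarrow> eventually (\<lambda>n. S n y < t) sequentially"
  shows "\<exists>V. majorants P r F B g V"
proof -
  define \<kappa> where "\<kappa> = measure M (space M)"
  have \<kappa>: "0 \<le> \<kappa>" by (simp add: \<kappa>_def)
  define h where "h n = (1 / (real n + 1)) powr (1 / r) * (\<kappa> + 1)" for n :: nat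
  have h: "0 < h n" for n using \<kappa> by (simp add: h_def)
  have h1: "h n \<le> \<kappa> + 1" for n
    unfolding h_def using \<kappa> r powr_mono2[of "1 / r" "1 / (real n + 1)" 1] by (intro mult_left_le_one_le) auto
  have hl: "h \<longlonglongrightarrow> 0"
  proof -
    have "(\<lambda>n. 1 / (real n + 1)) \<longlonglongrightarrow> 0" by real_asymp
    then have "(\<lambda>n. (1 / (real n + 1)) powr (1 / r)) \<longlonglongrightarrow> 0 powr (1 / r)"
      using r by (rule_tac tendsto_powr'[OF _ tendsto_const]) (auto intro!: always_eventually)
    then have "(\<lambda>n. (1 / (real n + 1)) powr (1 / r) * (\<kappa> + 1)) \<longlonglongrightarrow> 0 powr (1 / r) * (\<kappa> + 1)"
      by (rule tendsto_mult_right)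
    then show ?thesis by (simp add: h_def[abs_def])
  qed
  define V where "V n y = (S n y + h n) powr r" for n y
  have pos: "0 < S n y + h n" for n y using S0[of n y] h[of n] by linarith
  have Vq: "V n y powr (1 / r) = S n y + h n" for n y
    using pos[of n y] r by (simp add: V_def powr_powr)
  have "continuous_on UNIV (V n)" for n
    unfolding V_def using pos by (intro continuous_intros Sc) (metis less_irrefl)
  moreover have "\<exists>d>0. \<forall>y. d \<le> V n y" for n
    using h[of n] S0 r by (intro exI[of _ "h n powr r"]) (auto simp: V_def intro!: powr_mono2)
  moreover have "\<exists>D\<ge>0. \<forall>n y. ln (V n y) \<le> D * exp (g * \<bar>y\<bar>)"
  proof (intro exI conjI allI)
    show "0 \<le> r * (\<bar>ln (K + \<kappa> + 1)\<bar> + D)" using r D by simp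
    fix n y
    have e1: "1 \<le> exp (D * exp (g * \<bar>y\<bar>))" "1 \<le> exp (g * \<bar>y\<bar>)" using D g by auto
    have "S n y + h n \<le> K * exp (D * exp (g * \<bar>y\<bar>)) + (\<kappa> + 1) * exp (D * exp (g * \<bar>y\<bar>))"
    proof (rule add_mono[OF Sg(2)])
      have "h n \<le> (\<kappa> + 1) * 1" using h1[of n] by simp
      also have "\<dots> \<le> (\<kappa> + 1) * exp (D * exp (g * \<bar>y\<bar>))" using e1(1) \<kappa> by (intro mult_left_mono) auto
      finally show "h n \<le> (\<kappa> + 1) * exp (D * exp (g * \<bar>y\<bar>))" .
    qed
    then have "S n y + h n \<le> (K + \<kappa> + 1) * exp (D * exp (g * \<bar>y\<bar>))" by (simp add: algebra_simps)
    then have "ln (S n y + h n) \<le> ln ((K + \<kappa> + 1) * exp (D * exp (g * \<bar>y\<bar>)))"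
      using pos by (intro ln_mono) auto
    also have "\<dots> = ln (K + \<kappa> + 1) + D * exp (g * \<bar>y\<bar>)" using Sg(1) \<kappa> by (subst ln_mult_pos) auto
    also have "\<dots> \<le> \<bar>ln (K + \<kappa> + 1)\<bar> * exp (g * \<bar>y\<bar>) + D * exp (g * \<bar>y\<bar>)"
      using mult_left_mono[OF e1(2), of "\<bar>ln (K + \<kappa> + 1)\<bar>"] by linarith
    finally have "r * ln (S n y + h n) \<le> r * (\<bar>ln (K + \<kappa> + 1)\<bar> * exp (g * \<bar>y\<bar>) + D * exp (g * \<bar>y\<bar>))"
      using r by (intro mult_left_mono) auto
    then show "ln (V n y) \<le> r * (\<bar>ln (K + \<kappa> + 1)\<bar> + D) * exp (g * \<bar>y\<bar>)"
      using pos[of n y] by (simp add: V_def ln_powr algebra_simps)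
  qed
  moreover have "weighted_norm_le r (measure M) (P n) (\<lambda>A. max (norm (cell_mean M (F y) A)) (1 / (real n + 1))) (V n y)" for n y
  proof -
    have "(\<Sum>A\<in>P n. measure M A * max (norm (cell_mean M (F y) A)) (1 / (real n + 1)) powr (1 / r)) \<le>
      (\<Sum>A\<in>P n. measure M A * norm (cell_mean M (F y) A) powr (1 / r)) + (1 / (real n + 1)) powr (1 / r) * \<kappa>"
      unfolding \<kappa>_def by (rule sum_cell_max_powr_le[OF P]) simp
    also have "\<dots> \<le> S n y + h n" unfolding h_def by (intro add_mono Sw mult_left_mono) auto
    finally show ?thesis using r by (simp add: weighted_norm_le_def Vq)
  qed
  moreover have "eventually (\<lambda>n. V n y < t) sequentially" if t: "B y < t" for y t
  proof -
    have tp: "0 < t" using t B[of y] by linarith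
    have "B y powr (1 / r) < t powr (1 / r)" using t B r by (intro powr_less_mono2) auto
    then obtain s where s: "B y powr (1 / r) < s" "s < t powr (1 / r)" using dense by blast
    have "eventually (\<lambda>n. h n < t powr (1 / r) - s) sequentially"
      using hl s by (intro order_tendstoD) auto
    with Sl[OF s(1)] show ?thesis
    proof eventually_elim
      case (elim n)
      then have "V n y < (t powr (1 / r)) powr r"
        unfolding V_def using pos[of n y] r by (intro powr_less_mono2) auto
      then show ?case using tp r by (simp add: powr_powr)
    qed
  qed
  ultimately show ?thesis unfolding majorants_def by blast
qed

text \<open>
  Three cases. For the exponent \<open>\<infinity>\<close> and for exponents in \<open>[1, \<infinity>)\<close> averaging is a contraction,
  and \<open>B\<close> itself is the majorant up to the truncation. For exponents below \<open>1\<close> averaging may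
  increase the norm; then \<open>(a + b) powr q \<le> a powr q + b powr q\<close> compares the average with
  \<open>F\<close>, and convergence in \<open>L\<^sup>1\<close> makes the difference small.
\<close>
lemma majorants_exist:
  assumes res: "resolving P" and r: "0 \<le> r" and g: "0 \<le> g"
    and F: "\<And>y. integrable M (F y)" and Fc: "\<And>n A. A \<in> P n \<Longrightarrow> continuous_on UNIV (\<lambda>y. cell_mean M (F y) A)"
    and C: "0 \<le> C" "\<And>y. (LINT x|M. norm (F y x)) \<le> exp (C * exp (g * \<bar>y\<bar>))"
    and B: "continuous_on UNIV B" "\<And>y. 0 \<le> B y" "0 \<le> c" "\<And>y. B y \<le> exp (c * exp (g * \<bar>y\<bar>))"
    and le: "\<And>y. Lp_le r M (F y) (B y)"
  shows "\<exists>V. majorants P r F B g V"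
proof (cases "r = 0")
  case True
  have P: "cell_partition M (P n)" for n using res by (simp add: resolving_def)
  define V where "V n y = max (B y) (1 / (real n + 1))" for n y
  have "continuous_on UNIV (V n)" for n unfolding V_def by (intro continuous_on_max continuous_intros B)
  moreover have "\<exists>d>0. \<forall>y. d \<le> V n y" for n by (intro exI[of _ "1 / (real n + 1)"]) (auto simp: V_def)
  moreover have "\<exists>D\<ge>0. \<forall>n y. ln (V n y) \<le> D * exp (g * \<bar>y\<bar>)"
  proof (intro exI[of _ c] conjI allI B)
    fix n y
    have "1 / (real n + 1) \<le> exp (c * exp (g * \<bar>y\<bar>))"
      using B(3) by (rule_tac order_trans[of _ 1]) auto
    then have "ln (V n y) \<le> ln (exp (c * exp (g * \<bar>y\<bar>)))"
      using B(4)[of y] by (intro ln_mono) (auto simp: V_def less_max_iff_disj)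
    then show "ln (V n y) \<le> c * exp (g * \<bar>y\<bar>)" by simp
  qed
  moreover have "weighted_norm_le r (measure M) (P n) (\<lambda>A. max (norm (cell_mean M (F y) A)) (1 / (real n + 1))) (V n y)" for n y
  proof -
    have "norm (cell_mean M (F y) A) \<le> B y" if A: "A \<in> P n" for A
    proof -
      have A': "A \<in> sets M" "0 < measure M A" using P[of n] A by (auto simp: cell_partition_def)
      have "measure M A * norm (cell_mean M (F y) A) \<le> (LINT x|M. indicator A x *\<^sub>R norm (F y x))"
        by (rule measure_norm_cell_mean_le[OF P A F])
      also have "\<dots> \<le> (LINT x|M. indicator A x *\<^sub>R B y)"
      proof (rule integral_mono_AE)
        show "AE x in M. indicator A x *\<^sub>R norm (F y x) \<le> indicator A x *\<^sub>R B y"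
          using le[of y] True by (auto simp: Lp_le_def indicator_def)
        show "integrable M (\<lambda>x. indicator A x *\<^sub>R norm (F y x))" "integrable M (\<lambda>x. indicator A x *\<^sub>R B y)"
          using A' F[of y] by (intro integrable_indicator_scaleR; simp)+
      qed
      also have "\<dots> = measure M A * B y" using integrable_indicator_finite[OF A'(1)] A' by simp
      finally show ?thesis using A' by simp
    qed
    then show ?thesis using True by (auto simp: weighted_norm_le_def V_def intro: max.coboundedI1)
  qed
  moreover have "eventually (\<lambda>n. V n y < t) sequentially" if t: "B y < t" for y t
  proof -
    have "(\<lambda>n. 1 / (real n + 1)) \<longlonglongrightarrow> 0" by real_asymp
    then have "eventually (\<lambda>n. 1 / (real n + 1) < t) sequentially"
      by (rule order_tendstoD(2)) (use t B(2)[of y] in linarith)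
    then show ?thesis by eventually_elim (use t in \<open>auto simp: V_def\<close>)
  qed
  ultimately show ?thesis unfolding majorants_def by blast
next
  case False
  then have rp: "r > 0" using r by simp
  have P: "cell_partition M (P n)" for n using res by (simp add: resolving_def)
  note Li = Lp_le_imp_integrable[OF rp borel_measurable_integrable[OF F] le B(2)]
  show ?thesis
  proof (cases "r \<le> 1")
    case True
    show ?thesis
    proof (rule majorants_from_sums[OF rp P g B(2), where S = "\<lambda>n y. B y powr (1 / r)" and K = 1 and D = "c / r"])
      show "continuous_on UNIV (\<lambda>y. B y powr (1 / r))"
        using B rp by (intro continuous_on_powr' continuous_intros) auto
      show "B y powr (1 / r) \<le> 1 * exp (c / r * exp (g * \<bar>y\<bar>))" for y
      proof -
        have "B y powr (1 / r) \<le> exp (c * exp (g * \<bar>y\<bar>)) powr (1 / r)"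
          using B rp by (intro powr_mono2) auto
        then show ?thesis by (simp add: powr_def)
      qed
      show "(\<Sum>A\<in>P n. measure M A * norm (cell_mean M (F y) A) powr (1 / r)) \<le> B y powr (1 / r)" for n y
        using cell_mean_powr_le[OF P F _ Li(1)] Li(2)[of y] True rp by (meson le_divide_eq_1_pos order_trans)
    qed (use B rp in auto)
  next
    case False
    define q where "q = 1 / r"
    have q: "0 < q" "q \<le> 1" using False rp by (auto simp: q_def)
    define \<kappa> where "\<kappa> = measure M (space M)"
    have mq: "(\<lambda>z::complex. norm z powr q) \<in> borel_measurable borel" by measurable
    have Seq: "(\<Sum>A\<in>P n. measure M A * norm (cell_mean M (F y) A) powr q) = (LINT x|M. norm (cell_average M (P n) (F y) x) powr q)" for n y
      by (rule lint_fun_cell_average[OF P mq, symmetric])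
    show ?thesis
    proof (rule majorants_from_sums[OF rp P g B(2), where S = "\<lambda>n y. \<Sum>A\<in>P n. measure M A * norm (cell_mean M (F y) A) powr q" and K = "\<kappa> + 1" and D = C])
      show "continuous_on UNIV (\<lambda>y. \<Sum>A\<in>P n. measure M A * norm (cell_mean M (F y) A) powr q)" for n
        using q Fc by (intro continuous_on_sum continuous_intros continuous_on_powr') auto
      show "(\<Sum>A\<in>P n. measure M A * norm (cell_mean M (F y) A) powr q) \<le> (\<kappa> + 1) * exp (C * exp (g * \<bar>y\<bar>))" for n y
      proof -
        have "(\<Sum>A\<in>P n. measure M A * norm (cell_mean M (F y) A) powr q) \<le> (\<Sum>A\<in>P n. measure M A + measure M A * norm (cell_mean M (F y) A))"
        proof (intro sum_mono)
          fix A
          have "measure M A * norm (cell_mean M (F y) A) powr q \<le> measure M A * (1 powr q + 1 powr (q - 1) * norm (cell_mean M (F y) A))"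
            using q by (intro mult_left_mono powr_le_linear) auto
          then show "measure M A * norm (cell_mean M (F y) A) powr q \<le> measure M A + measure M A * norm (cell_mean M (F y) A)"
            by (simp add: distrib_left)
        qed
        also have "\<dots> = (\<Sum>A\<in>P n. measure M A) + (LINT x|M. norm (cell_average M (P n) (F y) x))"
          using lint_fun_cell_average[OF P, of norm n "F y"] by (simp add: sum.distrib)
        also have "\<dots> \<le> \<kappa> + exp (C * exp (g * \<bar>y\<bar>))"
          unfolding \<kappa>_def
          by (intro add_mono cell_partition_sum_measure_le[OF P] order_trans[OF cell_average_L1_le[OF P F] C(2)])
        also have "\<dots> \<le> (\<kappa> + 1) * exp (C * exp (g * \<bar>y\<bar>))"
          using C(1) mult_left_mono[of 1 "exp (C * exp (g * \<bar>y\<bar>))" \<kappa>] by (simp add: \<kappa>_def algebra_simps)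
        finally show ?thesis .
      qed
      show "eventually (\<lambda>n. (\<Sum>A\<in>P n. measure M A * norm (cell_mean M (F y) A) powr q) < t) sequentially"
        if t: "B y powr (1 / r) < t" for y t
      proof -
        define d where "d = t - B y powr (1 / r)"
        have d: "d > 0" using t by (simp add: d_def)
        \<comment> \<open>Half of the room \<open>d\<close> is split between the error \<open>e powr q\<close> of the linear bound
          for \<open>t powr q\<close>, integrated over the space, and the convergence in \<open>L\<^sup>1\<close>.\<close>
        define e where "e = (d / (4 * (\<kappa> + 1))) powr (1 / q)"
        have \<kappa>0: "\<kappa> \<ge> 0" by (simp add: \<kappa>_def)
        have e: "e > 0" using d \<kappa>0 by (simp add: e_def)
        have eq: "e powr q = d / (4 * (\<kappa> + 1))" using d \<kappa>0 q by (simp add: e_def powr_powr)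
        have "e powr q * \<kappa> \<le> d / (4 * (\<kappa> + 1)) * (\<kappa> + 1)" unfolding eq using d \<kappa>0 by (intro mult_left_mono) auto
        also have "\<dots> = d / 4" using \<kappa>0 by (simp add: field_simps)
        finally have e1: "e powr q * \<kappa> \<le> d / 4" .
        have "(\<lambda>n. e powr (q - 1) * (LINT x|M. norm (cell_average M (P n) (F y) x - F y x))) \<longlonglongrightarrow> e powr (q - 1) * 0"
          using res F by (intro tendsto_mult_left) (auto simp: resolving_def)
        then have "eventually (\<lambda>n. e powr (q - 1) * (LINT x|M. norm (cell_average M (P n) (F y) x - F y x)) < d / 4) sequentially"
          using d by (intro order_tendstoD) auto
        then show ?thesis
        proof eventually_elim
          case (elim n)
          let ?h = "\<lambda>x. norm (cell_average M (P n) (F y) x - F y x)"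
          have ih: "integrable M ?h" using integrable_cell_average[OF P] F by auto
          have iq: "integrable M (\<lambda>x. norm (F y x) powr q)" using Li(1)[of y] by (simp add: q_def)
          have "(LINT x|M. norm (cell_average M (P n) (F y) x) powr q) \<le> (LINT x|M. norm (F y x) powr q + (e powr q + e powr (q - 1) * ?h x))"
          proof (rule integral_mono)
            show "integrable M (\<lambda>x. norm (cell_average M (P n) (F y) x) powr q)"
              by (rule integrable_fun_cell_average[OF P mq])
            show "integrable M (\<lambda>x. norm (F y x) powr q + (e powr q + e powr (q - 1) * ?h x))"
              using ih iq by auto
            fix x
            have "norm (cell_average M (P n) (F y) x) powr q \<le> (norm (F y x) + ?h x) powr q"
              using q norm_triangle_ineq[of "F y x" "cell_average M (P n) (F y) x - F y x"] by (intro powr_mono2) auto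
            also have "\<dots> \<le> norm (F y x) powr q + ?h x powr q" using q by (intro powr_add_le) auto
            also have "?h x powr q \<le> e powr q + e powr (q - 1) * ?h x" using q e by (intro powr_le_linear) auto
            finally show "norm (cell_average M (P n) (F y) x) powr q \<le> norm (F y x) powr q + (e powr q + e powr (q - 1) * ?h x)" by simp
          qed
          also have "\<dots> = (LINT x|M. norm (F y x) powr q) + (e powr q * \<kappa> + e powr (q - 1) * (LINT x|M. ?h x))"
            using ih iq by (simp add: \<kappa>_def mult.commute)
          also have "\<dots> \<le> B y powr (1 / r) + (d / 4 + d / 4)"
            using Li(2)[of y] e1 elim by (intro add_mono) (auto simp: q_def)
          also have "\<dots> < t" using t by (simp add: d_def field_simps)
          finally show ?case unfolding Seq .
        qed
      qed
      show "\<kappa> + 1 \<ge> 0" by (simp add: \<kappa>_def)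
    qed (use C in \<open>auto simp: q_def intro!: sum_nonneg\<close>)
  qed
qed

end

lemma elog_less_ereal_iff:
  assumes "0 \<le> B"
  shows "elog (ennreal B) < ereal s \<longleftrightarrow> B < exp s"
proof (cases "B = 0")
  case False
  then have "B > 0" using assms by simp
  then have "ln B < s \<longleftrightarrow> B < exp s" by (metis exp_less_cancel_iff exp_ln)
  then show ?thesis using \<open>B > 0\<close> by (simp add: elog_def)
qed (simp add: elog_def)

lemma elog_measurable [measurable]: "elog \<in> borel_measurable borel"
  unfolding elog_def[abs_def] by measurable

lemma ereal_split_bound:
  assumes k: "0 < k0" "0 < k1" and E: "E0 < \<infinity>" "E1 < \<infinity>" and t: "ereal k0 * E0 + ereal k1 * E1 < ereal t"
  obtains s0 s1 where "E0 < ereal s0" "E1 < ereal s1" "k0 * s0 + k1 * s1 \<le> t"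
proof (cases E0; cases E1)
  fix e0 e1 assume e: "E0 = ereal e0" "E1 = ereal e1"
  define d where "d = (t - (k0 * e0 + k1 * e1)) / (k0 + k1)"
  have "k0 * e0 + k1 * e1 < t" using t e by simp
  then have d: "d > 0" using k by (simp add: d_def)
  have "k0 * (e0 + d) + k1 * (e1 + d) = k0 * e0 + k1 * e1 + (k0 + k1) * d" by (simp add: algebra_simps)
  also have "(k0 + k1) * d = t - (k0 * e0 + k1 * e1)" using k by (simp add: d_def)
  finally show ?thesis using that[of "e0 + d" "e1 + d"] e d by simp
next
  fix e0 assume e: "E0 = ereal e0" "E1 = - \<infinity>"
  show ?thesis using that[of "e0 + 1" "(t - k0 * (e0 + 1)) / k1"] e k by simp
next
  fix e1 assume e: "E0 = - \<infinity>" "E1 = ereal e1"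
  show ?thesis using that[of "(t - k1 * (e1 + 1)) / k0" "e1 + 1"] e k by simp
next
  assume e: "E0 = - \<infinity>" "E1 = - \<infinity>"
  show ?thesis using that[of "t / k0" 0] e k by simp
qed (use E in auto)

text \<open>
  The exponent of \<open>interp_const\<close>, a number in \<open>[- \<infinity>, \<infinity>)\<close> under the growth assumptions.
\<close>
definition log_average :: "(real \<Rightarrow> real) \<Rightarrow> (real \<Rightarrow> real) \<Rightarrow> real \<Rightarrow> ereal" where
  "log_average M0 M1 \<theta> = ereal_integral lborel (\<lambda>y.
     ereal (half_poisson (1 - \<theta>) y) * elog (ennreal (M0 y)) +
     ereal (half_poisson \<theta> y) * elog (ennreal (M1 y)))"

lemma interp_const_eq: "interp_const M0 M1 \<theta> = eexp (log_average M0 M1 \<theta>)"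
  by (simp add: interp_const_def log_average_def)

lemma elog_le_growth:
  assumes "0 \<le> B" "B \<le> exp x"
  shows "elog (ennreal B) \<le> ereal x"
proof (cases "B = 0")
  case False
  then have "ln B \<le> x" using assms by (metis exp_le_cancel_iff exp_ln order_less_le)
  then show ?thesis using assms False by (simp add: elog_def)
qed (simp add: elog_def)

lemma
  assumes \<theta>: "0 < \<theta>" "\<theta> < 1"
    and g: "g < pi" and D: "0 \<le> D0" "0 \<le> D1"
    and M0: "continuous_on UNIV M0" "\<And>y. 0 \<le> M0 y" "\<And>y. M0 y \<le> exp (D0 * exp (g * \<bar>y\<bar>))"
    and M1: "continuous_on UNIV M1" "\<And>y. 0 \<le> M1 y" "\<And>y. M1 y \<le> exp (D1 * exp (g * \<bar>y\<bar>))"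
  shows log_average_less_top: "log_average M0 M1 \<theta> < \<infinity>"
    and log_average_ge: "\<lbrakk>\<And>n. continuous_on UNIV (V0 n); \<And>n. continuous_on UNIV (V1 n);
        \<And>n. \<exists>d>0. \<forall>y. d \<le> V0 n y; \<And>n. \<exists>d>0. \<forall>y. d \<le> V1 n y;
        \<And>n y. ln (V0 n y) \<le> D0 * exp (g * \<bar>y\<bar>); \<And>n y. ln (V1 n y) \<le> D1 * exp (g * \<bar>y\<bar>);
        \<And>y t. M0 y < t \<Longrightarrow> eventually (\<lambda>n. V0 n y < t) sequentially;
        \<And>y t. M1 y < t \<Longrightarrow> eventually (\<lambda>n. V1 n y < t) sequentially;
        \<And>n. L \<le> (LBINT y. half_poisson (1 - \<theta>) y * ln (V0 n y)) + (LBINT y. half_poisson \<theta> y * ln (V1 n y))\<rbrakk>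
       \<Longrightarrow> ereal L \<le> log_average M0 M1 \<theta>"
    and integrable_half_poisson_ln: "\<lbrakk>0 < t; t < 1; continuous_on UNIV (V::real \<Rightarrow> real); \<exists>d>0. \<forall>y. d \<le> V y; \<And>y. ln (V y) \<le> D0 * exp (g * \<bar>y\<bar>)\<rbrakk>
       \<Longrightarrow> integrable lborel (\<lambda>y. half_poisson t y * ln (V y))"
proof -
  have \<theta>': "0 < 1 - \<theta>" "1 - \<theta> < 1" using \<theta> by auto
  note pos = half_poisson_pos[OF \<theta>'] half_poisson_pos[OF \<theta>]
  define k0 where "k0 = half_poisson (1 - \<theta>)"
  define k1 where "k1 = half_poisson \<theta>"
  have km[measurable]: "k0 \<in> borel_measurable borel" "k1 \<in> borel_measurable borel" by (auto simp: k0_def k1_def)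
  have kp: "0 < k0 y" "0 < k1 y" for y using pos by (auto simp: k0_def k1_def)
  define A where "A y = ereal (k0 y) * elog (ennreal (M0 y)) + ereal (k1 y) * elog (ennreal (M1 y))" for y
  define D where "D y = k0 y * (D0 * exp (g * \<bar>y\<bar>)) + k1 y * (D1 * exp (g * \<bar>y\<bar>))" for y
  have [measurable]: "M0 \<in> borel_measurable borel" "M1 \<in> borel_measurable borel"
    using M0(1) M1(1) by (auto intro: borel_measurable_continuous_onI)
  have Am: "A \<in> borel_measurable lborel" unfolding A_def by measurable
  have iD: "integrable lborel (\<lambda>y. half_poisson t y * (d * exp (g * \<bar>y\<bar>)))" if "0 < t" "t < 1" for t d
    using integrable_half_poisson_exp[OF that g] by (simp add: mult.left_commute)
  have Di: "integrable lborel D" unfolding D_def k0_def k1_def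
    by (intro Bochner_Integration.integrable_add iD \<theta> \<theta>')
  have AD: "A y \<le> ereal (D y)" for y
  proof -
    have "A y \<le> ereal (k0 y) * ereal (D0 * exp (g * \<bar>y\<bar>)) + ereal (k1 y) * ereal (D1 * exp (g * \<bar>y\<bar>))"
      unfolding A_def using kp[of y] M0 M1
      by (intro add_mono ereal_mult_left_mono elog_le_growth) auto
    then show ?thesis by (simp add: D_def)
  qed
  have LA: "log_average M0 M1 \<theta> = ereal_integral lborel A"
    by (simp add: log_average_def A_def[abs_def] k0_def k1_def)
  show "log_average M0 M1 \<theta> < \<infinity>"
    unfolding LA by (rule ereal_integral_less_top[OF Am Di AD])
  have int: "integrable lborel (\<lambda>y. half_poisson t y * ln (V y))"
    if t: "0 < t" "t < 1" and V: "continuous_on UNIV V" "\<exists>d>0. \<forall>y. d \<le> V y" "\<And>y. ln (V y) \<le> E * exp (g * \<bar>y\<bar>)" and E: "0 \<le> E"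
    for t E and V :: "real \<Rightarrow> real"
  proof -
    obtain d where d: "d > 0" "\<And>y. d \<le> V y" using V(2) by auto
    have [measurable]: "V \<in> borel_measurable borel" using V(1) by (rule borel_measurable_continuous_onI)
    have dom: "integrable lborel (\<lambda>y. half_poisson t y * \<bar>ln d\<bar> + half_poisson t y * (E * exp (g * \<bar>y\<bar>)))"
      by (intro Bochner_Integration.integrable_add iD t integrable_mult_left half_poisson_mass(1))
    show ?thesis
    proof (rule Bochner_Integration.integrable_bound[OF dom])
      show "AE y in lborel. norm (half_poisson t y * ln (V y)) \<le> norm (half_poisson t y * \<bar>ln d\<bar> + half_poisson t y * (E * exp (g * \<bar>y\<bar>)))"
      proof (rule AE_I2)
        fix y
        have "ln d \<le> ln (V y)" using d by (intro ln_mono) auto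
        then have "\<bar>ln (V y)\<bar> \<le> \<bar>ln d\<bar> + E * exp (g * \<bar>y\<bar>)"
          using V(3)[of y] E by (auto simp: abs_if intro: order_trans[OF _ add_increasing] split: if_splits) (smt (verit) exp_gt_zero mult_nonneg_nonneg)+
        then have "half_poisson t y * \<bar>ln (V y)\<bar> \<le> half_poisson t y * (\<bar>ln d\<bar> + E * exp (g * \<bar>y\<bar>))"
          using half_poisson_pos[OF t, of y] by (intro mult_left_mono) auto
        moreover have "0 \<le> half_poisson t y * (\<bar>ln d\<bar> + E * exp (g * \<bar>y\<bar>))"
          using half_poisson_pos[OF t, of y] E by simp
        ultimately show "norm (half_poisson t y * ln (V y)) \<le> norm (half_poisson t y * \<bar>ln d\<bar> + half_poisson t y * (E * exp (g * \<bar>y\<bar>)))"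
          using half_poisson_pos[OF t, of y] by (simp add: abs_mult distrib_left)
      qed
    qed measurable
  qed
  show "\<lbrakk>0 < t; t < 1; continuous_on UNIV (V::real \<Rightarrow> real); \<exists>d>0. \<forall>y. d \<le> V y; \<And>y. ln (V y) \<le> D0 * exp (g * \<bar>y\<bar>)\<rbrakk>
       \<Longrightarrow> integrable lborel (\<lambda>y. half_poisson t y * ln (V y))"
    using int D(1) by blast
  assume V0: "\<And>n. continuous_on UNIV (V0 n)" "\<And>n. \<exists>d>0. \<forall>y. d \<le> V0 n y" "\<And>n y. ln (V0 n y) \<le> D0 * exp (g * \<bar>y\<bar>)"
      "\<And>y t. M0 y < t \<Longrightarrow> eventually (\<lambda>n. V0 n y < t) sequentially"
    and V1: "\<And>n. continuous_on UNIV (V1 n)" "\<And>n. \<exists>d>0. \<forall>y. d \<le> V1 n y" "\<And>n y. ln (V1 n y) \<le> D1 * exp (g * \<bar>y\<bar>)"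
      "\<And>y t. M1 y < t \<Longrightarrow> eventually (\<lambda>n. V1 n y < t) sequentially"
    and L: "\<And>n. L \<le> (LBINT y. half_poisson (1 - \<theta>) y * ln (V0 n y)) + (LBINT y. half_poisson \<theta> y * ln (V1 n y))"
  have Vp: "0 < V0 n y" "0 < V1 n y" for n y using V0(2)[of n] V1(2)[of n] by (auto intro: less_le_trans)
  define a where "a n y = k0 y * ln (V0 n y) + k1 y * ln (V1 n y)" for n y
  have i0: "integrable lborel (\<lambda>y. k0 y * ln (V0 n y))" and i1: "integrable lborel (\<lambda>y. k1 y * ln (V1 n y))" for n
    unfolding k0_def k1_def by (intro int[OF \<theta>' V0(1,2) V0(3) D(1)] int[OF \<theta> V1(1,2) V1(3) D(2)])+
  show "ereal L \<le> log_average M0 M1 \<theta>"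
    unfolding LA
  proof (rule reverse_Fatou_ereal[OF Am Di AD])
    show "integrable lborel (a n)" for n unfolding a_def using i0 i1 by simp
    show "a n y \<le> D y" for n y
      unfolding a_def D_def using kp[of y] V0(3) V1(3) by (intro add_mono mult_left_mono) auto
    show "L \<le> integral\<^sup>L lborel (a n)" for n
      unfolding a_def using i0 i1 L[of n] by (simp add: k0_def k1_def)
    fix y t assume "A y < ereal t"
    moreover have "elog (ennreal (M0 y)) < \<infinity>" "elog (ennreal (M1 y)) < \<infinity>"
      by (auto simp: elog_def)
    ultimately obtain s0 s1 where s: "elog (ennreal (M0 y)) < ereal s0" "elog (ennreal (M1 y)) < ereal s1" "k0 y * s0 + k1 y * s1 \<le> t"
      using ereal_split_bound[OF kp] unfolding A_def by blast
    have "M0 y < exp s0" "M1 y < exp s1" using s(1,2) M0(2) M1(2) by (simp_all add: elog_less_ereal_iff)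
    from V0(4)[OF this(1)] V1(4)[OF this(2)]
    show "eventually (\<lambda>n. a n y < t) sequentially"
    proof eventually_elim
      case (elim n)
      then have "ln (V0 n y) < s0" "ln (V1 n y) < s1" using Vp by (metis exp_less_cancel_iff exp_ln)+
      then have "a n y < k0 y * s0 + k1 y * s1" unfolding a_def using kp[of y] by (intro add_strict_mono mult_strict_left_mono) auto
      then show ?case using s(3) by linarith
    qed
  qed
qed

section \<open>Weakly analytic families\<close>

text \<open>
  These are the properties of \<open>z \<mapsto> T z \<phi>\<close> that the interpolation uses. They are stable under
  combinations with bounded analytic coefficients, which \<open>z \<mapsto> T z (F\<^sub>z)\<close> requires. The growth
  is measured in \<open>L\<^sup>1\<close> on compact sets, the weakest of the admissible norms.
\<close>
definition tame_family :: "'a metric \<Rightarrow> 'a measure \<Rightarrow> real \<Rightarrow> (complex \<Rightarrow> 'a \<Rightarrow> complex) \<Rightarrow> bool" where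
  "tame_family X \<mu> \<gamma> G \<longleftrightarrow>
     (\<forall>z\<in>closure open_strip. G z \<in> L1_loc X \<mu>) \<and>
     (\<forall>w\<in>borel_measurable \<mu>. (\<exists>b. \<forall>x\<in>mspace X. norm (w x) \<le> b) \<and> compact_support X w \<longrightarrow>
        (\<lambda>z. LINT x|\<mu>. G z x * w x) holomorphic_on open_strip \<and>
        continuous_on (closure open_strip) (\<lambda>z. LINT x|\<mu>. G z x * w x)) \<and>
     (\<forall>K. compactin (mtopology_of X) K \<longrightarrow> (\<exists>C\<ge>0. \<forall>z\<in>closure open_strip.
        (LINT x|restrict_space \<mu> K. norm (G z x)) \<le> exp (C * exp (\<gamma> * \<bar>Im z\<bar>))))"

lemma L1_loc_integrable_restrict:
  assumes mms: "metric_measure_space X \<mu>" and K: "compactin (mtopology_of X) K" and f: "f \<in> L1_loc X \<mu>"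
  shows "integrable (restrict_space \<mu> K) f"
proof -
  have Ks: "K \<in> sets \<mu>" using mms_compact_sets[OF mms K] .
  have "set_integrable \<mu> K f" using f K by (auto simp: L1_loc_def)
  then show ?thesis
    unfolding set_integrable_def using Ks by (subst integrable_restrict_space) (auto simp: sets.Int_space_eq2)
qed

lemma compact_support_indicator:
  assumes K: "compactin (mtopology_of X) K" and A: "A \<subseteq> K"
  shows "compact_support X (indicator A)"
proof -
  have "{x \<in> mspace X. indicator A x \<noteq> (0::complex)} \<subseteq> K" using A by (auto simp: indicator_def)
  then have "mtopology_of X closure_of {x \<in> mspace X. indicator A x \<noteq> (0::complex)} \<subseteq> K"
    using compactin_imp_closedin[OF Hausdorff_mtopology_of K] by (intro closure_of_minimal)
  then show ?thesis unfolding compact_support_def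
    by (intro closed_compactin[OF K]) auto
qed

lemma tame_family_cell_mean:
  assumes mms: "metric_measure_space X \<mu>" and K: "compactin (mtopology_of X) K" and G: "tame_family X \<mu> \<gamma> G"
    and A: "A \<in> sets (restrict_space \<mu> K)"
  shows "(\<lambda>z. cell_mean (restrict_space \<mu> K) (G z) A) holomorphic_on open_strip"
    and "continuous_on (closure open_strip) (\<lambda>z. cell_mean (restrict_space \<mu> K) (G z) A)"
proof -
  have Ks: "K \<in> sets \<mu>" using mms_compact_sets[OF mms K] .
  have A': "A \<in> sets \<mu>" "A \<subseteq> K" using A Ks by (auto simp: sets_restrict_space_iff)
  have eq: "cell_mean (restrict_space \<mu> K) (G z) A = (LINT x|\<mu>. G z x * indicator A x) / of_real (measure (restrict_space \<mu> K) A)" for z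
  proof -
    have "(LINT x|restrict_space \<mu> K. indicator A x *\<^sub>R G z x) = (LINT x|\<mu>. indicator K x *\<^sub>R (indicator A x *\<^sub>R G z x))"
      using Ks by (intro integral_restrict_space) (auto simp: sets.Int_space_eq2)
    also have "\<dots> = (LINT x|\<mu>. G z x * indicator A x)"
      using A'(2) by (intro Bochner_Integration.integral_cong) (auto simp: indicator_def)
    finally show ?thesis by (simp add: cell_mean_def)
  qed
  have "\<exists>b. \<forall>x\<in>mspace X. norm (indicator A x :: complex) \<le> b" by (intro exI[of _ 1]) (auto simp: indicator_def)
  moreover have "compact_support X (indicator A)" using K A'(2) by (rule compact_support_indicator)
  moreover have "(indicator A :: 'a \<Rightarrow> complex) \<in> borel_measurable \<mu>" using A' by simp
  ultimately have "(\<lambda>z. LINT x|\<mu>. G z x * indicator A x) holomorphic_on open_strip"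
     "continuous_on (closure open_strip) (\<lambda>z. LINT x|\<mu>. G z x * indicator A x)"
    using G unfolding tame_family_def by blast+
  then show "(\<lambda>z. cell_mean (restrict_space \<mu> K) (G z) A) holomorphic_on open_strip"
    "continuous_on (closure open_strip) (\<lambda>z. cell_mean (restrict_space \<mu> K) (G z) A)"
    unfolding eq divide_inverse by (auto intro!: holomorphic_intros continuous_intros)
qed

lemma Lp_le_restrict:
  assumes le: "Lp_le r \<mu> f B" and K: "K \<in> sets \<mu>"
  shows "Lp_le r (restrict_space \<mu> K) f B"
proof (cases "r = 0")
  case True
  then show ?thesis using le K by (auto simp: Lp_le_def AE_restrict_space_iff sets.Int_space_eq2)
next
  case False
  have "(\<integral>\<^sup>+x. ennreal (norm (f x) powr (1 / r)) \<partial>restrict_space \<mu> K) = (\<integral>\<^sup>+x. ennreal (norm (f x) powr (1 / r)) * indicator K x \<partial>\<mu>)"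
    using K by (intro nn_integral_restrict_space) (auto simp: sets.Int_space_eq2)
  also have "\<dots> \<le> (\<integral>\<^sup>+x. ennreal (norm (f x) powr (1 / r)) \<partial>\<mu>)"
    by (intro nn_integral_mono) (auto simp: indicator_def)
  finally show ?thesis using le False by (auto simp: Lp_le_def intro: order_trans)
qed

lemma eventually_less_if_no_subseq_ge:
  fixes I :: "nat \<Rightarrow> real"
  assumes "\<And>s :: nat \<Rightarrow> nat. strict_mono s \<Longrightarrow> (\<And>n. L \<le> I (s n)) \<Longrightarrow> False"
  shows "eventually (\<lambda>n. I n < L) sequentially"
proof (rule ccontr)
  assume "\<not> eventually (\<lambda>n. I n < L) sequentially"
  then have "infinite {n. L \<le> I n}"
    by (simp add: not_eventually not_less frequently_cofinite flip: cofinite_eq_sequentially)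
  from infinite_enumerate[OF this] obtain s :: "nat \<Rightarrow> nat" where "strict_mono s" "\<forall>n. s n \<in> {n. L \<le> I n}" by auto
  then show False using assms by auto
qed

text \<open>
  The two edges of the strip are treated alike by means of a parametrisation \<open>e\<close> of height
  \<open>y\<close>.
\<close>
lemma tame_family_majorants:
  assumes mms: "metric_measure_space X \<mu>" and K: "compactin (mtopology_of X) K"
    and \<gamma>: "0 \<le> \<gamma>" "\<gamma> \<le> g" and G: "tame_family X \<mu> \<gamma> G"
    and res: "finite_measure.resolving (restrict_space \<mu> K) P" and r: "0 \<le> r"
    and e: "continuous_on UNIV e" "\<And>y. e y \<in> closure open_strip" "\<And>y. Im (e y) = y"
    and B: "continuous_on UNIV B" "\<And>y. 0 \<le> B y" "0 \<le> c" "\<And>y. B y \<le> exp (c * exp (g * \<bar>y\<bar>))"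
    and le: "\<And>y. Lp_le r \<mu> (G (e y)) (B y)"
  shows "\<exists>V. finite_measure.majorants (restrict_space \<mu> K) P r (\<lambda>y. G (e y)) B g V"
proof -
  define \<nu> where "\<nu> = restrict_space \<mu> K"
  interpret finite_measure \<nu> unfolding \<nu>_def by (rule finite_measure_restrict_compact[OF mms K])
  have res': "resolving P" using res by (simp add: \<nu>_def)
  have g: "0 \<le> g" using \<gamma> by linarith
  have Gi: "integrable \<nu> (G (e y))" for y
    using G e(2) unfolding \<nu>_def tame_family_def by (intro L1_loc_integrable_restrict[OF mms K]) auto
  obtain C where C: "C \<ge> 0" "\<And>z. z \<in> closure open_strip \<Longrightarrow> (LINT x|\<nu>. norm (G z x)) \<le> exp (C * exp (\<gamma> * \<bar>Im z\<bar>))"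
    using G K unfolding tame_family_def \<nu>_def by meson
  have C': "(LINT x|\<nu>. norm (G (e y) x)) \<le> exp (C * exp (g * \<bar>y\<bar>))" for y
  proof -
    have "exp (C * exp (\<gamma> * \<bar>y\<bar>)) \<le> exp (C * exp (g * \<bar>y\<bar>))"
      using C(1) \<gamma> by (auto intro!: mult_left_mono mult_right_mono)
    then show ?thesis using C(2)[OF e(2), of y] unfolding e(3) by linarith
  qed
  have "continuous_on UNIV (\<lambda>y. cell_mean \<nu> (G (e y)) A)" if "A \<in> P n" for n A
  proof -
    have "A \<in> sets \<nu>" using res' that by (auto simp: resolving_def cell_partition_def)
    then show ?thesis
      using tame_family_cell_mean(2)[OF mms K G, of A] e unfolding \<nu>_def[symmetric]
      by (auto intro: continuous_on_compose2)
  qed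
  from majorants_exist[OF res' r g Gi this C(1) C' B Lp_le_restrict[OF le mms_compact_sets[OF mms K], folded \<nu>_def]]
  show ?thesis by (simp add: \<nu>_def)
qed

text \<open>
  The finite-dimensional inequality for the cell averages passes to the limit. By reverse
  Fatou the logarithmic integrals of the majorants are eventually below every \<open>L\<close> above the
  logarithmic average, and almost everywhere convergence of a subsequence of the averages at
  \<open>\<theta>\<close> carries the bound \<open>exp L\<close> over to the family.
\<close>
lemma tame_family_compact_bound:
  assumes mms: "metric_measure_space X \<mu>" and K: "compactin (mtopology_of X) K"
    and \<gamma>: "0 \<le> \<gamma>" "\<gamma> < pi" and G: "tame_family X \<mu> \<gamma> G"
    and \<theta>: "0 < \<theta>" "\<theta> < 1" and r: "0 \<le> r0" "0 \<le> r1"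
    and \<tau>: "0 \<le> \<tau>" "\<tau> < pi" and c: "0 \<le> c"
    and M0: "continuous_on UNIV M0" "\<And>y. 0 \<le> M0 y" "\<And>y. M0 y \<le> exp (c * exp (\<tau> * \<bar>y\<bar>))"
    and M1: "continuous_on UNIV M1" "\<And>y. 0 \<le> M1 y" "\<And>y. M1 y \<le> exp (c * exp (\<tau> * \<bar>y\<bar>))"
    and b0: "\<And>y. Lp_le r0 \<mu> (G (\<i> * of_real y)) (M0 y)"
    and b1: "\<And>y. Lp_le r1 \<mu> (G (1 + \<i> * of_real y)) (M1 y)"
    and L: "log_average M0 M1 \<theta> < ereal L"
  shows "Lp_le ((1 - \<theta>) * r0 + \<theta> * r1) (restrict_space \<mu> K) (G (of_real \<theta>)) (exp L)"
proof -
  define \<nu> where "\<nu> = restrict_space \<mu> K"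
  define g where "g = max \<gamma> \<tau>"
  have g: "0 \<le> g" "g < pi" "\<gamma> \<le> g" "\<tau> \<le> g" using \<gamma> \<tau> by (auto simp: g_def)
  have \<theta>': "0 < 1 - \<theta>" "1 - \<theta> < 1" using \<theta> by auto
  interpret finite_measure \<nu> unfolding \<nu>_def by (rule finite_measure_restrict_compact[OF mms K])
  have Ks: "K \<in> sets \<mu>" using mms_compact_sets[OF mms K] .
  obtain P where res: "resolving P" using compact_resolving_partitions[OF mms K] unfolding \<nu>_def by blast
  have P: "cell_partition \<nu> (P n)" for n using res by (simp add: resolving_def)
  have Ps: "A \<in> sets (restrict_space \<mu> K)" "0 < measure \<nu> A" if "A \<in> P n" for A n
    using P[of n] that unfolding cell_partition_def \<nu>_def by auto
  have Gi: "integrable \<nu> (G z)" if "z \<in> closure open_strip" for z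
    using G that unfolding \<nu>_def tame_family_def by (intro L1_loc_integrable_restrict[OF mms K]) auto
  obtain C where C: "C \<ge> 0" "\<And>z. z \<in> closure open_strip \<Longrightarrow> (LINT x|\<nu>. norm (G z x)) \<le> exp (C * exp (\<gamma> * \<bar>Im z\<bar>))"
    using G K unfolding tame_family_def \<nu>_def by meson
  have Mg: "exp (c * exp (\<tau> * \<bar>y\<bar>)) \<le> exp (c * exp (g * \<bar>y\<bar>))" for y
    using c g by (auto intro!: mult_left_mono mult_right_mono)
  have M0g: "M0 y \<le> exp (c * exp (g * \<bar>y\<bar>))" and M1g: "M1 y \<le> exp (c * exp (g * \<bar>y\<bar>))" for y
    using M0(3)[of y] M1(3)[of y] Mg[of y] by linarith+
  have edge: "\<i> * of_real y \<in> closure open_strip" "1 + \<i> * of_real y \<in> closure open_strip" for y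
    by (auto simp: closure_open_strip)
  note cm = tame_family_cell_mean[OF mms K G, folded \<nu>_def]
  have ec: "continuous_on UNIV (\<lambda>y. \<i> * of_real y)" "continuous_on UNIV (\<lambda>y. 1 + \<i> * of_real y)"
    by (intro continuous_intros)+
  note maj = tame_family_majorants[OF mms K \<gamma>(1) g(3) G res[unfolded \<nu>_def], folded \<nu>_def]
  obtain V0 where V0: "majorants P r0 (\<lambda>y. G (\<i> * of_real y)) M0 g V0"
    using maj[OF r(1) ec(1) edge(1) _ M0(1,2) c M0g b0] by auto
  obtain V1 where V1: "majorants P r1 (\<lambda>y. G (1 + \<i> * of_real y)) M1 g V1"
    using maj[OF r(2) ec(2) edge(2) _ M1(1,2) c M1g b1] by auto
  obtain d0 d1 where d: "0 \<le> d0" "\<And>n y. ln (V0 n y) \<le> d0 * exp (g * \<bar>y\<bar>)" "0 \<le> d1" "\<And>n y. ln (V1 n y) \<le> d1 * exp (g * \<bar>y\<bar>)"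
    using V0 V1 unfolding majorants_def by metis
  define D where "D = max c (max d0 d1)"
  have D: "c \<le> D" "d0 \<le> D" "d1 \<le> D" "0 \<le> D" using c by (auto simp: D_def)
  have VD: "ln (V0 n y) \<le> D * exp (g * \<bar>y\<bar>)" "ln (V1 n y) \<le> D * exp (g * \<bar>y\<bar>)" for n y
    by (rule order_trans[OF d(2) mult_right_mono[OF D(2)]], simp, rule order_trans[OF d(4) mult_right_mono[OF D(3)]], simp)
  have MD: "M0 y \<le> exp (D * exp (g * \<bar>y\<bar>))" "M1 y \<le> exp (D * exp (g * \<bar>y\<bar>))" for y
    using M0g[of y] M1g[of y] mult_right_mono[OF D(1), of "exp (g * \<bar>y\<bar>)"] by (meson exp_ge_zero exp_le_cancel_iff order_trans)+
  have Vc: "continuous_on UNIV (V0 n)" "continuous_on UNIV (V1 n)" and Vd: "\<exists>d>0. \<forall>y. d \<le> V0 n y" "\<exists>d>0. \<forall>y. d \<le> V1 n y"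
    and Vw: "weighted_norm_le r0 (measure \<nu>) (P n) (\<lambda>A. max (norm (cell_mean \<nu> (G (\<i> * of_real y)) A)) (1 / (real n + 1))) (V0 n y)"
      "weighted_norm_le r1 (measure \<nu>) (P n) (\<lambda>A. max (norm (cell_mean \<nu> (G (1 + \<i> * of_real y)) A)) (1 / (real n + 1))) (V1 n y)"
    and Vl: "M0 y < t \<Longrightarrow> eventually (\<lambda>n. V0 n y < t) sequentially" "M1 y < t \<Longrightarrow> eventually (\<lambda>n. V1 n y < t) sequentially" for n y t
    using V0 V1 unfolding majorants_def by auto
  have Vp: "0 < V0 n y" "0 < V1 n y" for n y using Vd[of n] by (auto intro: less_le_trans)
  define I where "I n = (LBINT y. half_poisson (1 - \<theta>) y * ln (V0 n y)) + (LBINT y. half_poisson \<theta> y * ln (V1 n y))" for n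
  note ii = integrable_half_poisson_ln[OF \<theta> g(2) D(4) D(4) M0(1,2) MD(1) M1(1,2) MD(2)]
  have evI: "eventually (\<lambda>n. I n < L) sequentially"
  proof (rule eventually_less_if_no_subseq_ge)
    fix s :: "nat \<Rightarrow> nat" assume s: "strict_mono s" "\<And>n. L \<le> I (s n)"
    have "ereal L \<le> log_average M0 M1 \<theta>"
    proof (rule log_average_ge[OF \<theta> g(2) D(4) D(4) M0(1,2) MD(1) M1(1,2) MD(2), where ?V0.0 = "\<lambda>n. V0 (s n)" and ?V1.0 = "\<lambda>n. V1 (s n)"])
      show "L \<le> (LBINT y. half_poisson (1 - \<theta>) y * ln (V0 (s n) y)) + (LBINT y. half_poisson \<theta> y * ln (V1 (s n) y))" for n
        using s(2)[of n] by (simp add: I_def)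
      show "M0 y < t \<Longrightarrow> eventually (\<lambda>n. V0 (s n) y < t) sequentially" "M1 y < t \<Longrightarrow> eventually (\<lambda>n. V1 (s n) y < t) sequentially" for y t
        using eventually_subseq[OF s(1) Vl(1)] eventually_subseq[OF s(1) Vl(2)] by blast+
    qed (use Vc Vd VD in auto)
    then show False using L by simp
  qed
  define q where "q = (1 - \<theta>) * r0 + \<theta> * r1"
  have q0: "0 \<le> q" using \<theta> r by (simp add: q_def)
  have fin: "weighted_norm_le q (measure \<nu>) (P n) (\<lambda>A. norm (cell_mean \<nu> (G (of_real \<theta>)) A)) (exp (I n))" for n
    unfolding q_def
  proof (rule finite_interpolation[where c = "\<lambda>A z. cell_mean \<nu> (G z) A" and \<eta> = "1 / (real n + 1)" and \<gamma> = \<gamma>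
        and C = "\<lambda>A. C + \<bar>ln (1 / measure \<nu> A)\<bar>" and ?V0.0 = "V0 n" and ?V1.0 = "V1 n"])
    show "finite (P n)" using P[of n] by (simp add: cell_partition_def)
    fix A assume A: "A \<in> P n"
    show "0 < measure \<nu> A" by (rule Ps(2)[OF A])
    show "(\<lambda>z. cell_mean \<nu> (G z) A) holomorphic_on open_strip" "continuous_on (closure open_strip) (\<lambda>z. cell_mean \<nu> (G z) A)"
      using cm[of A] Ps(1)[OF A, folded \<nu>_def] by auto
    fix z assume z: "z \<in> closure open_strip"
    have As: "A \<in> sets \<nu>" using Ps(1)[OF A] by (simp add: \<nu>_def)
    have "measure \<nu> A * norm (cell_mean \<nu> (G z) A) \<le> (LINT x|\<nu>. indicator A x *\<^sub>R norm (G z x))"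
      by (rule measure_norm_cell_mean_le[OF P A Gi[OF z]])
    also have "\<dots> \<le> (LINT x|\<nu>. norm (G z x))"
    proof (rule integral_mono)
      show "integrable \<nu> (\<lambda>x. indicator A x *\<^sub>R norm (G z x))" using Gi[OF z] As by (intro integrable_indicator_scaleR) auto
    qed (use Gi[OF z] in \<open>auto simp: indicator_def\<close>)
    also have "\<dots> \<le> exp (C * exp (\<gamma> * \<bar>Im z\<bar>))" by (rule C(2)[OF z])
    finally have "norm (cell_mean \<nu> (G z) A) \<le> 1 / measure \<nu> A * exp (C * exp (\<gamma> * \<bar>Im z\<bar>))"
      using Ps(2)[OF A] by (simp add: field_simps)
    also have "\<dots> = exp (ln (1 / measure \<nu> A) + C * exp (\<gamma> * \<bar>Im z\<bar>))"
      using Ps(2)[OF A] by (simp add: exp_add)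
    also have "\<dots> \<le> exp ((C + \<bar>ln (1 / measure \<nu> A)\<bar>) * exp (\<gamma> * \<bar>Im z\<bar>))"
    proof -
      have "ln (1 / measure \<nu> A) \<le> \<bar>ln (1 / measure \<nu> A)\<bar> * 1" by simp
      also have "\<dots> \<le> \<bar>ln (1 / measure \<nu> A)\<bar> * exp (\<gamma> * \<bar>Im z\<bar>)" using \<gamma> by (intro mult_left_mono) auto
      finally show ?thesis by (simp add: distrib_right)
    qed
    finally show "norm (cell_mean \<nu> (G z) A) \<le> exp ((C + \<bar>ln (1 / measure \<nu> A)\<bar>) * exp (\<gamma> * \<bar>Im z\<bar>))" .
  qed (use ii[OF \<theta>' Vc(1) Vd(1) VD(1)] ii[OF \<theta> Vc(2) Vd(2) VD(2)] \<theta> r \<gamma> Vp Vw in \<open>auto simp: I_def\<close>)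
  have Gth: "integrable \<nu> (G (of_real \<theta>))" using \<theta> by (intro Gi) (auto simp: closure_open_strip)
  have "(\<lambda>n. LINT x|\<nu>. norm (cell_average \<nu> (P n) (G (of_real \<theta>)) x - G (of_real \<theta>) x)) \<longlonglongrightarrow> 0"
    using res Gth by (simp add: resolving_def)
  from tendsto_L1_AE_subseq[OF _ this] obtain s :: "nat \<Rightarrow> nat" where s: "strict_mono s"
    "AE x in \<nu>. (\<lambda>n. cell_average \<nu> (P (s n)) (G (of_real \<theta>)) x - G (of_real \<theta>) x) \<longlonglongrightarrow> 0"
    using integrable_cell_average[OF P] Gth by auto
  have evs: "eventually (\<lambda>n. I (s n) < L) sequentially" by (rule eventually_subseq[OF s(1) evI])
  have "Lp_le q \<nu> (G (of_real \<theta>)) (exp L)"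
  proof (cases "q = 0")
    case True
    obtain N where N: "\<And>n. n \<ge> N \<Longrightarrow> I (s n) < L" using evs by (auto simp: eventually_sequentially)
    have "AE x in \<nu>. \<forall>n\<ge>N. norm (cell_average \<nu> (P (s n)) (G (of_real \<theta>)) x) \<le> exp L"
    proof (subst AE_all_countable, rule allI)
      fix n
      have "AE x in \<nu>. x \<in> \<Union>(P (s n))" using P by (simp add: cell_partition_def)
      then show "AE x in \<nu>. N \<le> n \<longrightarrow> norm (cell_average \<nu> (P (s n)) (G (of_real \<theta>)) x) \<le> exp L"
      proof eventually_elim
        case (elim x)
        then obtain A where A: "A \<in> P (s n)" "x \<in> A" by auto
        have "cell_average \<nu> (P (s n)) (G (of_real \<theta>)) x = cell_mean \<nu> (G (of_real \<theta>)) A"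
          unfolding cell_average_def using P[of "s n"] A by (intro indicator_sum_disjoint) (auto simp: cell_partition_def)
        moreover have "norm (cell_mean \<nu> (G (of_real \<theta>)) A) \<le> exp (I (s n))"
          using fin[of "s n"] A True by (auto simp: weighted_norm_le_def)
        moreover have "N \<le> n \<Longrightarrow> exp (I (s n)) \<le> exp L" using N[of n] by simp
        ultimately show ?case by (auto intro: order_trans)
      qed
    qed
    with s(2) have "AE x in \<nu>. norm (G (of_real \<theta>) x) \<le> exp L"
    proof eventually_elim
      case (elim x)
      have "(\<lambda>n. norm (cell_average \<nu> (P (s n)) (G (of_real \<theta>)) x)) \<longlonglongrightarrow> norm (G (of_real \<theta>) x)"
        using tendsto_norm[OF tendsto_add[OF elim(1) tendsto_const[of "G (of_real \<theta>) x"]]] by simp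
      then show ?case by (rule LIMSEQ_le_const2) (use elim(2) in auto)
    qed
    then show ?thesis using True by (simp add: Lp_le_def)
  next
    case False
    then have q: "q > 0" using q0 by simp
    let ?u = "\<lambda>n x. ennreal (norm (cell_average \<nu> (P (s n)) (G (of_real \<theta>)) x) powr (1 / q))"
    have "(\<integral>\<^sup>+x. ennreal (norm (G (of_real \<theta>) x) powr (1 / q)) \<partial>\<nu>) = (\<integral>\<^sup>+x. liminf (\<lambda>n. ?u n x) \<partial>\<nu>)"
    proof (rule nn_integral_cong_AE)
      show "AE x in \<nu>. ennreal (norm (G (of_real \<theta>) x) powr (1 / q)) = liminf (\<lambda>n. ?u n x)"
        using s(2)
      proof eventually_elim
        case (elim x)
        have "(\<lambda>n. norm (cell_average \<nu> (P (s n)) (G (of_real \<theta>)) x)) \<longlonglongrightarrow> norm (G (of_real \<theta>) x)"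
          using tendsto_norm[OF tendsto_add[OF elim(1) tendsto_const[of "G (of_real \<theta>) x"]]] by simp
        then have "(\<lambda>n. ?u n x) \<longlonglongrightarrow> ennreal (norm (G (of_real \<theta>) x) powr (1 / q))"
          using q by (intro tendsto_ennrealI tendsto_powr'[OF _ tendsto_const]) (auto intro!: always_eventually)
        then show ?case by (rule lim_imp_Liminf[OF trivial_limit_sequentially, symmetric])
      qed
    qed
    also have "\<dots> \<le> liminf (\<lambda>n. \<integral>\<^sup>+x. ?u n x \<partial>\<nu>)"
    proof (rule nn_integral_liminf)
      fix n
      note [measurable] = cell_average_measurable[OF P[of "s n"], of "G (of_real \<theta>)"]
      show "?u n \<in> borel_measurable \<nu>" by measurable
    qed
    also have "\<dots> \<le> liminf (\<lambda>n::nat. ennreal (exp L powr (1 / q)))"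
    proof (rule Liminf_mono)
      show "\<forall>\<^sub>F n in sequentially. (\<integral>\<^sup>+x. ?u n x \<partial>\<nu>) \<le> ennreal (exp L powr (1 / q))"
        using evs
      proof eventually_elim
        case (elim n)
        have mq: "(\<lambda>z::complex. norm z powr (1 / q)) \<in> borel_measurable borel" by measurable
        have "(\<integral>\<^sup>+x. ?u n x \<partial>\<nu>) = ennreal (LINT x|\<nu>. norm (cell_average \<nu> (P (s n)) (G (of_real \<theta>)) x) powr (1 / q))"
          by (rule nn_integral_eq_integral) (use integrable_fun_cell_average[OF P mq] in auto)
        also have "(LINT x|\<nu>. norm (cell_average \<nu> (P (s n)) (G (of_real \<theta>)) x) powr (1 / q)) =
          (\<Sum>A\<in>P (s n). measure \<nu> A * norm (cell_mean \<nu> (G (of_real \<theta>)) A) powr (1 / q))"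
          by (rule lint_fun_cell_average[OF P mq])
        also have "\<dots> \<le> exp (I (s n)) powr (1 / q)" using fin[of "s n"] q by (simp add: weighted_norm_le_def)
        also have "\<dots> \<le> exp L powr (1 / q)" using elim q by (intro powr_mono2) auto
        finally show ?case by (simp add: ennreal_leI)
      qed
    qed
    also have "\<dots> = ennreal (exp L powr (1 / q))" by (simp add: Liminf_const)
    finally show ?thesis using False by (simp add: Lp_le_def)
  qed
  then show ?thesis by (simp add: q_def \<nu>_def)
qed

text \<open>
  Local norms determine the global norm because the compact sets fill the space up to a null
  set.
\<close>
lemma Lp_le_from_exhaustion:
  assumes K: "\<And>n::nat. K n \<in> sets \<mu>" "incseq K" "AE x in \<mu>. x \<in> (\<Union>n. K n)" and f[measurable]: "f \<in> borel_measurable \<mu>"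
    and le: "\<And>n. Lp_le r (restrict_space \<mu> (K n)) f B"
  shows "Lp_le r \<mu> f B"
proof (cases "r = 0")
  case True
  have "AE x in \<mu>. \<forall>n. x \<in> K n \<longrightarrow> norm (f x) \<le> B"
    using le True K(1) by (subst AE_all_countable) (auto simp: Lp_le_def AE_restrict_space_iff sets.Int_space_eq2)
  with K(3) have "AE x in \<mu>. norm (f x) \<le> B" by eventually_elim auto
  then show ?thesis using True by (simp add: Lp_le_def)
next
  case False
  let ?h = "\<lambda>x. ennreal (norm (f x) powr (1 / r))"
  have "(\<integral>\<^sup>+x. ?h x \<partial>\<mu>) = (\<integral>\<^sup>+x. liminf (\<lambda>n. ?h x * indicator (K n) x) \<partial>\<mu>)"
  proof (rule nn_integral_cong_AE)
    show "AE x in \<mu>. ?h x = liminf (\<lambda>n. ?h x * indicator (K n) x)"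
      using K(3)
    proof eventually_elim
      case (elim x)
      then obtain N where N: "x \<in> K N" by auto
      have "eventually (\<lambda>n. ?h x * indicator (K n) x = ?h x) sequentially"
        using eventually_ge_at_top[of N]
      proof eventually_elim
        case (elim n)
        then have "x \<in> K n" using N K(2) by (auto simp: incseq_def)
        then show ?case by simp
      qed
      then have "(\<lambda>n. ?h x * indicator (K n) x) \<longlonglongrightarrow> ?h x" by (rule tendsto_eventually)
      then show ?case by (simp add: lim_imp_Liminf)
    qed
  qed
  also have "\<dots> \<le> liminf (\<lambda>n. \<integral>\<^sup>+x. ?h x * indicator (K n) x \<partial>\<mu>)"
    by (rule nn_integral_liminf) (use K(1) in measurable)
  also have "\<dots> \<le> liminf (\<lambda>n::nat. ennreal (B powr (1 / r)))"
  proof (rule Liminf_mono, rule always_eventually, rule allI)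
    fix n
    have "(\<integral>\<^sup>+x. ?h x * indicator (K n) x \<partial>\<mu>) = (\<integral>\<^sup>+x. ?h x \<partial>restrict_space \<mu> (K n))"
      using K(1) by (intro nn_integral_restrict_space[symmetric]) (auto simp: sets.Int_space_eq2)
    then show "(\<integral>\<^sup>+x. ?h x * indicator (K n) x \<partial>\<mu>) \<le> ennreal (B powr (1 / r))"
      using le[of n] False by (simp add: Lp_le_def)
  qed
  also have "\<dots> = ennreal (B powr (1 / r))" by (simp add: Liminf_const)
  finally show ?thesis using False by (simp add: Lp_le_def)
qed

lemma ennreal_recip_cases:
  assumes "0 < (q::ennreal)"
  obtains "q = \<infinity>" "enn2real (1 / q) = 0" | s where "0 < s" "q = ennreal (1 / s)" "enn2real (1 / q) = s"
proof (cases q)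
  case (real t)
  then have t: "t > 0" using assms by simp
  have "1 / q = ennreal (1 / t)" using real t by (simp add: divide_ennreal flip: ennreal_1)
  then show ?thesis using that(2)[of "1 / t"] t real by simp
next
  case top
  then show ?thesis using that(1) by simp
qed

lemma Lp_norm_le_iff:
  assumes q: "0 < q" and f[measurable]: "f \<in> borel_measurable \<mu>" and B: "0 \<le> B"
  shows "Lp_norm q \<mu> f \<le> ennreal B \<longleftrightarrow> Lp_le (enn2real (1 / q)) \<mu> f B"
proof (rule ennreal_recip_cases[OF q])
  assume q: "q = \<infinity>" "enn2real (1 / q) = 0"
  have "esssup \<mu> (\<lambda>x. ennreal (norm (f x))) \<le> ennreal B \<longleftrightarrow> (AE x in \<mu>. norm (f x) \<le> B)"
  proof
    assume le: "esssup \<mu> (\<lambda>x. ennreal (norm (f x))) \<le> ennreal B"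
    have "AE x in \<mu>. ennreal (norm (f x)) \<le> esssup \<mu> (\<lambda>x. ennreal (norm (f x)))" by (rule esssup_AE)
    then show "AE x in \<mu>. norm (f x) \<le> B"
    proof eventually_elim
      case (elim x)
      then have "ennreal (norm (f x)) \<le> ennreal B" using le by (rule order_trans)
      then show ?case using B by (simp add: ennreal_le_iff)
    qed
  next
    assume "AE x in \<mu>. norm (f x) \<le> B"
    then show "esssup \<mu> (\<lambda>x. ennreal (norm (f x))) \<le> ennreal B"
      by (intro esssup_I) (auto intro: ennreal_leI)
  qed
  then show ?thesis using q by (simp add: Lp_norm_def Lp_le_def)
next
  fix s assume s: "0 < s" "q = ennreal (1 / s)" "enn2real (1 / q) = s"
  define I where "I = (\<integral>\<^sup>+x. ennreal (norm (f x) powr (1 / s)) \<partial>\<mu>)"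
  have L: "Lp_norm q \<mu> f = ennpowr I s" using s by (simp add: Lp_norm_def I_def)
  have "ennpowr I s \<le> ennreal B \<longleftrightarrow> I \<le> ennreal (B powr (1 / s))"
  proof (cases I)
    case (real t)
    have "t powr s \<le> B \<longleftrightarrow> t \<le> B powr (1 / s)"
    proof
      assume "t powr s \<le> B"
      then have "(t powr s) powr (1 / s) \<le> B powr (1 / s)" using s by (intro powr_mono2) auto
      then show "t \<le> B powr (1 / s)" using s real by (simp add: powr_powr)
    next
      assume "t \<le> B powr (1 / s)"
      then have "t powr s \<le> (B powr (1 / s)) powr s" using s real by (intro powr_mono2) auto
      then show "t powr s \<le> B" using s B by (simp add: powr_powr)
    qed
    then show ?thesis using real B by (simp add: ennpowr_def ennreal_le_iff)
  qed (auto simp: ennpowr_def top_unique)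
  then show ?thesis using s L by (simp add: Lp_le_def I_def)
qed

text \<open>
  The estimate is proved with \<open>exp L\<close> for real \<open>L > J\<close>; letting \<open>L\<close> decrease to \<open>J\<close> includes
  the case \<open>J = - \<infinity>\<close>, where the norm vanishes.
\<close>
lemma le_eexpI:
  assumes "J < \<infinity>" "\<And>L. J < ereal L \<Longrightarrow> x \<le> ennreal (exp L)"
  shows "x \<le> eexp J"
proof (cases J)
  case (real j)
  have "(\<lambda>n. ennreal (exp (j + 1 / (real n + 1)))) \<longlonglongrightarrow> ennreal (exp (j + 0))"
    by (intro tendsto_ennrealI tendsto_exp tendsto_add tendsto_const) real_asymp
  then have "x \<le> ennreal (exp (j + 0))"
    by (rule LIMSEQ_le_const) (use assms(2) real in auto)
  then show ?thesis using real by (simp add: eexp_def)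
next
  case MInf
  have "(\<lambda>n. ennreal (exp (- real n))) \<longlonglongrightarrow> ennreal 0"
    by (intro tendsto_ennrealI) real_asymp
  then have "x \<le> ennreal 0"
    by (rule LIMSEQ_le_const) (use assms(2) MInf in auto)
  then show ?thesis using MInf by (simp add: eexp_def)
qed (use assms in auto)

lemma recip_interp:
  assumes \<theta>: "0 < \<theta>" "\<theta> < 1" and q: "0 < (q0::ennreal)" "0 < q1"
    and eq: "1 / q = ennreal (1 - \<theta>) / q0 + ennreal \<theta> / q1"
  shows "0 < q" "enn2real (1 / q) = (1 - \<theta>) * enn2real (1 / q0) + \<theta> * enn2real (1 / q1)"
proof -
  have fin: "1 / q0 < top" "1 / q1 < top" using q by (simp_all add: ennreal_divide_eq_top_iff less_top[symmetric])
  have rq: "1 / q = ennreal ((1 - \<theta>) * enn2real (1 / q0) + \<theta> * enn2real (1 / q1))"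
  proof -
    have "1 / q = ennreal (1 - \<theta>) * (1 / q0) + ennreal \<theta> * (1 / q1)"
      unfolding eq by (simp add: ennreal_times_divide)
    also have "\<dots> = ennreal (1 - \<theta>) * ennreal (enn2real (1 / q0)) + ennreal \<theta> * ennreal (enn2real (1 / q1))"
      using fin by simp
    also have "\<dots> = ennreal ((1 - \<theta>) * enn2real (1 / q0) + \<theta> * enn2real (1 / q1))"
      using \<theta> by (simp add: ennreal_mult ennreal_plus)
    finally show ?thesis .
  qed
  then have "q \<noteq> 0" by (metis ennreal_divide_zero ennreal_neq_top infinity_ennreal_def ennreal_top_neq_zero zero_neq_one ennreal_divide_eq_top_iff)
  then show "0 < q" by (simp add: zero_less_iff_neq_zero)
  show "enn2real (1 / q) = (1 - \<theta>) * enn2real (1 / q0) + \<theta> * enn2real (1 / q1)"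
    unfolding rq using \<theta> by (intro enn2real_ennreal) auto
qed

lemma tame_family_interpolation:
  assumes mms: "metric_measure_space X \<mu>"
    and \<gamma>: "0 \<le> \<gamma>" "\<gamma> < pi" and G: "tame_family X \<mu> \<gamma> G"
    and \<theta>: "0 < \<theta>" "\<theta> < 1" and q: "0 < q0" "0 < q1"
    and eq: "1 / q = ennreal (1 - \<theta>) / q0 + ennreal \<theta> / q1"
    and \<tau>: "0 \<le> \<tau>" "\<tau> < pi" and c: "0 \<le> c"
    and M0: "continuous_on UNIV M0" "\<And>y. 0 \<le> M0 y" "\<And>y. M0 y \<le> exp (c * exp (\<tau> * \<bar>y\<bar>))"
    and M1: "continuous_on UNIV M1" "\<And>y. 0 \<le> M1 y" "\<And>y. M1 y \<le> exp (c * exp (\<tau> * \<bar>y\<bar>))"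
    and b0: "\<And>y. Lp_norm q0 \<mu> (G (\<i> * of_real y)) \<le> ennreal (M0 y)"
    and b1: "\<And>y. Lp_norm q1 \<mu> (G (1 + \<i> * of_real y)) \<le> ennreal (M1 y)"
  shows "Lp_norm q \<mu> (G (of_real \<theta>)) \<le> interp_const M0 M1 \<theta>"
proof -
  have Gm: "G z \<in> borel_measurable \<mu>" if "z \<in> closure open_strip" for z
    using G that by (auto simp: tame_family_def L1_loc_def)
  have edge: "\<i> * of_real y \<in> closure open_strip" "1 + \<i> * of_real y \<in> closure open_strip" "of_real \<theta> \<in> closure open_strip" for y
    using \<theta> by (auto simp: closure_open_strip)
  note q' = recip_interp(1)[OF \<theta> q eq] and rq' = recip_interp(2)[OF \<theta> q eq]
  have fl: "log_average M0 M1 \<theta> < \<infinity>"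
    by (rule log_average_less_top[OF \<theta> \<tau>(2) c c M0 M1])
  obtain K where K: "\<And>n::nat. compactin (mtopology_of X) (K n)" "incseq K" "AE x in \<mu>. x \<in> (\<Union>n. K n)"
    using mms_exhaustion[OF mms] by blast
  show "Lp_norm q \<mu> (G (of_real \<theta>)) \<le> interp_const M0 M1 \<theta>"
    unfolding interp_const_eq
  proof (rule le_eexpI[OF fl])
    fix L assume L: "log_average M0 M1 \<theta> < ereal L"
    have "Lp_le (enn2real (1 / q)) \<mu> (G (of_real \<theta>)) (exp L)"
    proof (rule Lp_le_from_exhaustion[OF mms_compact_sets[OF mms K(1)] K(2,3) Gm[OF edge(3)]])
      fix n
      show "Lp_le (enn2real (1 / q)) (restrict_space \<mu> (K n)) (G (of_real \<theta>)) (exp L)"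
        unfolding rq'
      proof (rule tame_family_compact_bound[OF mms K(1) \<gamma> G \<theta> _ _ \<tau> c M0 M1 _ _ L])
        show "Lp_le (enn2real (1 / q0)) \<mu> (G (\<i> * of_real y)) (M0 y)" for y
          using b0[of y] Lp_norm_le_iff[OF q(1) Gm[OF edge(1)[of y]] M0(2)[of y]] by simp
        show "Lp_le (enn2real (1 / q1)) \<mu> (G (1 + \<i> * of_real y)) (M1 y)" for y
          using b1[of y] Lp_norm_le_iff[OF q(2) Gm[OF edge(2)[of y]] M1(2)[of y]] by simp
      qed auto
    qed
    then show "Lp_norm q \<mu> (G (of_real \<theta>)) \<le> ennreal (exp L)"
      using Lp_norm_le_iff[OF q' Gm[OF edge(3)], of "exp L"] by simp
  qed
qed

section \<open>Slicing the values of a test function\<close>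

definition hat :: "real \<Rightarrow> real" where "hat s = max 0 (1 - \<bar>s\<bar>)"

lemma hat_nonneg: "0 \<le> hat s" by (simp add: hat_def)

lemma hat_eq_0: "1 \<le> \<bar>s\<bar> \<Longrightarrow> hat s = 0" by (simp add: hat_def)

lemma sum_hat:
  assumes "finite J"
  shows "(\<Sum>j\<in>J. hat (s - real_of_int j)) \<le> 1"
    and "{\<lfloor>s\<rfloor>, \<lfloor>s\<rfloor> + 1} \<subseteq> J \<Longrightarrow> (\<Sum>j\<in>J. hat (s - real_of_int j)) = 1"
proof -
  have two: "(\<Sum>j\<in>{\<lfloor>s\<rfloor>, \<lfloor>s\<rfloor> + 1}. hat (s - real_of_int j)) = 1"
    by (simp add: hat_def) linarith
  have z: "hat (s - real_of_int j) = 0" if "j \<notin> {\<lfloor>s\<rfloor>, \<lfloor>s\<rfloor> + 1}" for j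
  proof (rule hat_eq_0)
    have "j \<le> \<lfloor>s\<rfloor> - 1 \<or> \<lfloor>s\<rfloor> + 2 \<le> j" using that by auto
    then show "1 \<le> \<bar>s - real_of_int j\<bar>" by linarith
  qed
  have "(\<Sum>j\<in>J. hat (s - real_of_int j)) = (\<Sum>j\<in>J \<inter> {\<lfloor>s\<rfloor>, \<lfloor>s\<rfloor> + 1}. hat (s - real_of_int j))"
    using z assms by (intro sum.mono_neutral_right) auto
  also have "\<dots> \<le> (\<Sum>j\<in>{\<lfloor>s\<rfloor>, \<lfloor>s\<rfloor> + 1}. hat (s - real_of_int j))"
    by (intro sum_mono2) (auto simp: hat_nonneg)
  finally show "(\<Sum>j\<in>J. hat (s - real_of_int j)) \<le> 1" using two by simp
  assume "{\<lfloor>s\<rfloor>, \<lfloor>s\<rfloor> + 1} \<subseteq> J"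
  then have "(\<Sum>j\<in>J. hat (s - real_of_int j)) = (\<Sum>j\<in>{\<lfloor>s\<rfloor>, \<lfloor>s\<rfloor> + 1}. hat (s - real_of_int j))"
    using z assms by (intro sum.mono_neutral_right) auto
  then show "(\<Sum>j\<in>J. hat (s - real_of_int j)) = 1" using two by simp
qed

text \<open>
  The functions \<open>slice \<beta> j\<close> are a partition of unity for the phase \<open>sgn w\<close>, subordinate to
  \<open>\<beta>\<^bsup>j-1\<^esup> < \<bar>w\<bar> < \<beta>\<^bsup>j+1\<^esup>\<close>. They are continuous, and vanish near \<open>0\<close>, so composing them with a
  test function gives test functions.
\<close>
definition slice :: "real \<Rightarrow> int \<Rightarrow> complex \<Rightarrow> complex" where
  "slice \<beta> j w = of_real (hat (ln (norm w) / ln \<beta> - real_of_int j)) * sgn w"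

lemma slice_0 [simp]: "slice \<beta> j 0 = 0" by (simp add: slice_def)

lemma slice_continuous:
  assumes \<beta>: "1 < \<beta>"
  shows "continuous_on UNIV (slice \<beta> j)"
proof -
  define \<rho> where "\<rho> = \<beta> powr (real_of_int j - 1)"
  have \<rho>: "\<rho> > 0" using \<beta> by (simp add: \<rho>_def)
  have 0: "slice \<beta> j w = 0" if w: "w \<in> ball 0 \<rho>" for w
  proof (cases "w = 0")
    case False
    then have "ln (norm w) < ln \<rho>" using w \<rho> by simp
    also have "ln \<rho> = (real_of_int j - 1) * ln \<beta>" using \<beta> by (simp add: \<rho>_def ln_powr)
    finally have "ln (norm w) / ln \<beta> < real_of_int j - 1" using \<beta> by (simp add: pos_divide_less_eq)
    then show ?thesis by (simp add: slice_def hat_eq_0)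
  qed simp
  have "continuous_on (ball 0 \<rho>) (slice \<beta> j)"
    by (rule continuous_on_eq[OF continuous_on_const[of _ 0]]) (simp add: 0)
  moreover have "continuous_on (- {0}) (slice \<beta> j)"
    unfolding slice_def hat_def sgn_div_norm using \<beta> by (intro continuous_intros) auto
  ultimately have "continuous_on (ball 0 \<rho> \<union> - {0}) (slice \<beta> j)"
    by (intro continuous_on_open_Un) auto
  moreover have "ball 0 \<rho> \<union> - {0} = (UNIV :: complex set)" using \<rho> by auto
  ultimately show ?thesis by simp
qed

lemma norm_slice: "norm (slice \<beta> j w) = (if w = 0 then 0 else hat (ln (norm w) / ln \<beta> - real_of_int j))"
  by (simp add: slice_def norm_mult norm_sgn hat_nonneg)

text \<open>
  Only the two levels \<open>j\<close> next to \<open>log\<^sub>\<beta> \<bar>w\<bar>\<close> contribute, and the weights of the slices add up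
  to at most \<open>1\<close>. So replacing the factor \<open>\<beta>\<^sup>j\<close> by one of modulus \<open>\<beta>\<^bsup>j e\<^esup>\<close> has the effect of
  \<open>\<bar>w\<bar>\<^sup>e\<close>, up to the constant \<open>\<beta>\<^sup>e\<close>, uniformly in \<open>w\<close>.
\<close>
lemma norm_sum_slice_le:
  assumes \<beta>: "1 < \<beta>" and J: "finite J" and e: "0 \<le> e" and w: "w \<noteq> 0"
    and c: "\<And>j. j \<in> J \<Longrightarrow> norm (c j) = \<beta> powr (real_of_int j * e)"
  shows "norm (\<Sum>j\<in>J. c j * slice \<beta> j w) \<le> (\<beta> * norm w) powr e"
proof -
  define s where "s = ln (norm w) / ln \<beta>"
  have ws: "norm w = \<beta> powr s" using \<beta> w by (simp add: s_def powr_def)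
  have "norm (\<Sum>j\<in>J. c j * slice \<beta> j w) \<le> (\<Sum>j\<in>J. norm (c j * slice \<beta> j w))" by (rule norm_sum)
  also have "\<dots> \<le> (\<Sum>j\<in>J. \<beta> powr ((s + 1) * e) * hat (s - real_of_int j))"
  proof (rule sum_mono)
    fix j assume j: "j \<in> J"
    have "\<beta> powr (real_of_int j * e) * hat (s - real_of_int j) \<le> \<beta> powr ((s + 1) * e) * hat (s - real_of_int j)"
    proof (cases "real_of_int j \<le> s + 1")
      case True
      then show ?thesis using \<beta> e hat_nonneg by (intro mult_right_mono powr_mono mult_right_mono) auto
    qed (simp add: hat_eq_0)
    then show "norm (c j * slice \<beta> j w) \<le> \<beta> powr ((s + 1) * e) * hat (s - real_of_int j)"
      using w by (simp add: norm_mult c[OF j] norm_slice s_def)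
  qed
  also have "\<dots> \<le> \<beta> powr ((s + 1) * e) * 1"
    unfolding sum_distrib_left[symmetric] using sum_hat(1)[OF J] by (intro mult_left_mono) auto
  also have "\<beta> powr ((s + 1) * e) = (\<beta> powr (s + 1)) powr e" by (simp add: powr_powr)
  also have "\<beta> powr (s + 1) = \<beta> * norm w" using \<beta> ws by (simp add: powr_add)
  finally show ?thesis by simp
qed

text \<open>
  If \<open>\<beta>\<close> is close to \<open>1\<close>, the relative error between \<open>w\<close> and its sliced version is small;
  values below the lowest level of \<open>J\<close> are small anyway.
\<close>
lemma slice_approx:
  assumes F: "0 < F" and \<delta>: "0 < \<delta>" and \<kappa>: "1 < \<kappa>"
  obtains \<beta> and J :: "int set" where "1 < \<beta>" "\<beta> \<le> \<kappa>" "finite J"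
    "\<And>w. norm w \<le> F \<Longrightarrow> norm (w - (\<Sum>j\<in>J. of_real (\<beta> powr real_of_int j) * slice \<beta> j w)) \<le> \<delta>"
proof -
  define \<beta> where "\<beta> = min \<kappa> (1 + \<delta> / F)"
  have \<beta>: "1 < \<beta>" "\<beta> \<le> \<kappa>" and \<beta>F: "F * (\<beta> - 1) \<le> \<delta>"
  proof -
    show "1 < \<beta>" "\<beta> \<le> \<kappa>" using F \<delta> \<kappa> by (auto simp: \<beta>_def)
    have "F * (\<beta> - 1) \<le> F * (\<delta> / F)" using F by (intro mult_left_mono) (auto simp: \<beta>_def)
    then show "F * (\<beta> - 1) \<le> \<delta>" using F by simp
  qed
  define lo where "lo = ln (\<delta> / (1 + \<beta>)) / ln \<beta>"
  define hi where "hi = ln F / ln \<beta>"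
  define J where "J = {\<lfloor>lo\<rfloor>..\<lfloor>hi\<rfloor> + 1}"
  have ln: "ln \<beta> > 0" using \<beta> by simp
  show ?thesis
  proof (rule that[OF \<beta>])
    show "finite J" by (simp add: J_def)
    fix w :: complex assume wF: "norm w \<le> F"
    show "norm (w - (\<Sum>j\<in>J. of_real (\<beta> powr real_of_int j) * slice \<beta> j w)) \<le> \<delta>"
    proof (cases "norm w \<le> \<delta> / (1 + \<beta>)")
      case True
      have "norm (w - (\<Sum>j\<in>J. of_real (\<beta> powr real_of_int j) * slice \<beta> j w)) \<le>
        norm w + norm (\<Sum>j\<in>J. of_real (\<beta> powr real_of_int j) * slice \<beta> j w)" by (rule norm_triangle_ineq4)
      also have "norm (\<Sum>j\<in>J. of_real (\<beta> powr real_of_int j) * slice \<beta> j w) \<le> \<beta> * norm w"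
      proof (cases "w = 0")
        case False
        have "norm (\<Sum>j\<in>J. of_real (\<beta> powr real_of_int j) * slice \<beta> j w) \<le> (\<beta> * norm w) powr 1"
          by (rule norm_sum_slice_le[OF \<beta>(1) _ _ False]) (auto simp: J_def)
        then show ?thesis using \<beta> by simp
      qed simp
      also have "norm w + \<beta> * norm w = (1 + \<beta>) * norm w" by (simp add: algebra_simps)
      also have "\<dots> \<le> \<delta>" using True \<beta> by (simp add: field_simps)
      finally show ?thesis by simp
    next
      case False
      define s where "s = ln (norm w) / ln \<beta>"
      have d0: "0 < \<delta> / (1 + \<beta>)" using \<delta> \<beta> by simp
      then have w: "norm w > 0" using False by linarith
      have ws: "norm w = \<beta> powr s" using \<beta> w by (simp add: s_def powr_def)
      have "lo \<le> s" unfolding lo_def s_def using False d0 ln by (intro divide_right_mono ln_mono) auto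
      moreover have "s \<le> hi" unfolding hi_def s_def using wF w ln by (intro divide_right_mono ln_mono) auto
      ultimately have sub: "{\<lfloor>s\<rfloor>, \<lfloor>s\<rfloor> + 1} \<subseteq> J" by (auto simp: J_def floor_mono intro: order_trans[OF floor_mono])
      have J: "finite J" by (simp add: J_def)
      have h1: "(\<Sum>j\<in>J. hat (s - real_of_int j)) = 1" using sum_hat(2)[OF J sub] .
      have w0: "w \<noteq> 0" using w by auto
      have sl: "slice \<beta> j w = of_real (hat (s - real_of_int j)) * sgn w" for j by (simp add: slice_def s_def)
      have "w = of_real (\<beta> powr s) * sgn w" using w0 by (simp add: ws[symmetric] sgn_div_norm scaleR_conv_of_real)
      then have "w = of_real (\<beta> powr s) * sgn w * of_real (\<Sum>j\<in>J. hat (s - real_of_int j))" by (simp add: h1)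
      also have "\<dots> = (\<Sum>j\<in>J. of_real (\<beta> powr s) * slice \<beta> j w)"
        unfolding sl of_real_sum sum_distrib_left by (simp add: mult_ac)
      finally have "w - (\<Sum>j\<in>J. of_real (\<beta> powr real_of_int j) * slice \<beta> j w) =
        (\<Sum>j\<in>J. of_real (\<beta> powr s) * slice \<beta> j w) - (\<Sum>j\<in>J. of_real (\<beta> powr real_of_int j) * slice \<beta> j w)" by simp
      also have "\<dots> = (\<Sum>j\<in>J. of_real (\<beta> powr s - \<beta> powr real_of_int j) * slice \<beta> j w)"
        by (simp add: sum_subtractf left_diff_distrib)
      also have "norm \<dots> \<le> (\<Sum>j\<in>J. norm (of_real (\<beta> powr s - \<beta> powr real_of_int j) * slice \<beta> j w))" by (rule norm_sum)
      also have "\<dots> \<le> (\<Sum>j\<in>J. \<delta> * hat (s - real_of_int j))"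
      proof (rule sum_mono)
        fix j
        have "\<bar>\<beta> powr s - \<beta> powr real_of_int j\<bar> * hat (s - real_of_int j) \<le> \<delta> * hat (s - real_of_int j)"
        proof (cases "\<bar>s - real_of_int j\<bar> < 1")
          case True
          have "\<beta> powr real_of_int j \<le> \<beta> powr (s + 1)" using True \<beta> by (intro powr_mono) auto
          then have up: "\<beta> powr real_of_int j \<le> \<beta> * norm w" using \<beta> by (simp add: powr_add ws mult.commute)
          have "\<beta> powr (s - 1) \<le> \<beta> powr real_of_int j" using True \<beta> by (intro powr_mono) auto
          then have dn: "norm w / \<beta> \<le> \<beta> powr real_of_int j" using \<beta> by (simp add: powr_diff ws)
          have "norm w * (1 - 1 / \<beta>) \<le> norm w * (\<beta> - 1)"
          proof (intro mult_left_mono)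
            have "0 \<le> (\<beta> - 1)\<^sup>2 / \<beta>" using \<beta> by simp
            also have "(\<beta> - 1)\<^sup>2 / \<beta> = (\<beta> - 1) - (1 - 1 / \<beta>)" using \<beta> by (simp add: power2_eq_square field_simps)
            finally show "1 - 1 / \<beta> \<le> \<beta> - 1" by simp
          qed simp
          also have "norm w * (\<beta> - 1) \<le> F * (\<beta> - 1)" using wF \<beta> by (intro mult_right_mono) auto
          finally have A: "norm w - norm w / \<beta> \<le> \<delta>" using \<beta>F by (simp add: right_diff_distrib)
          have "norm w * (\<beta> - 1) \<le> F * (\<beta> - 1)" using wF \<beta> by (intro mult_right_mono) auto
          then have B: "\<beta> * norm w - norm w \<le> \<delta>" using \<beta>F by (simp add: algebra_simps)
          have "\<bar>\<beta> powr s - \<beta> powr real_of_int j\<bar> \<le> \<delta>"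
            unfolding ws[symmetric] using up dn A B by (intro abs_leI) linarith+
          then show ?thesis by (intro mult_right_mono hat_nonneg)
        qed (simp add: hat_eq_0)
        then show "norm (of_real (\<beta> powr s - \<beta> powr real_of_int j) * slice \<beta> j w) \<le> \<delta> * hat (s - real_of_int j)"
          using w0 by (simp only: norm_mult norm_of_real norm_slice s_def if_False)
      qed
      also have "\<dots> = \<delta>" by (simp add: sum_distrib_left[symmetric] h1)
      finally show ?thesis .
    qed
  qed
qed

lemma Cc_borel_measurable:
  assumes mms: "metric_measure_space X \<mu>" and f: "f \<in> Cc X"
  shows "f \<in> borel_measurable \<mu>"
proof (rule borel_measurableI)
  fix S :: "complex set" assume "open S"
  then have "openin (mtopology_of X) {x \<in> topspace (mtopology_of X). f x \<in> S}"
    using f by (intro openin_continuous_map_preimage[where Y = euclidean]) (auto simp: Cc_def)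
  moreover have "{x \<in> topspace (mtopology_of X). f x \<in> S} = f -` S \<inter> space \<mu>"
    using mms_space[OF mms] by auto
  ultimately show "f -` S \<inter> space \<mu> \<in> sets \<mu>" using mms_openin[OF mms] by metis
qed

lemma Cc_compact_carrier:
  assumes f: "f \<in> Cc X"
  obtains K where "compactin (mtopology_of X) K" "\<And>x. x \<notin> K \<Longrightarrow> f x = 0"
proof (rule that)
  let ?K = "mtopology_of X closure_of {x \<in> mspace X. f x \<noteq> 0}"
  show "compactin (mtopology_of X) ?K" using f by (auto simp: Cc_def compact_support_def)
  fix x assume x: "x \<notin> ?K"
  have "{x \<in> mspace X. f x \<noteq> 0} \<subseteq> ?K" by (intro closure_of_subset) auto
  then show "f x = 0" using x f by (auto simp: Cc_def)
qed

lemma Cc_bounded: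
  assumes f: "f \<in> Cc X"
  obtains F where "0 < F" "\<And>x. norm (f x) \<le> F"
proof -
  obtain K where K: "compactin (mtopology_of X) K" "\<And>x. x \<notin> K \<Longrightarrow> f x = 0" using Cc_compact_carrier[OF f] by blast
  have "compactin euclidean (f ` K)" using f by (intro image_compactin[OF K(1)]) (auto simp: Cc_def)
  then have "bounded (f ` K)" by (simp add: compact_imp_bounded)
  then obtain F where F: "F > 0" "\<forall>y\<in>f ` K. norm y \<le> F" by (auto simp: bounded_pos)
  show ?thesis
  proof (rule that[OF F(1)])
    fix x show "norm (f x) \<le> F" using F K(2)[of x] by (cases "x \<in> K") auto
  qed
qed

lemma Cc_comp:
  assumes f: "f \<in> Cc X" and \<phi>: "continuous_on UNIV \<phi>" "\<phi> 0 = 0"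
  shows "(\<lambda>x. \<phi> (f x)) \<in> Cc X"
proof -
  have "continuous_map (mtopology_of X) euclidean (\<phi> \<circ> f)"
    using f \<phi> by (intro continuous_map_compose[of _ euclidean]) (auto simp: Cc_def)
  moreover have "compact_support X (\<lambda>x. \<phi> (f x))"
    unfolding compact_support_def
  proof (rule closed_compactin)
    show "compactin (mtopology_of X) (mtopology_of X closure_of {x \<in> mspace X. f x \<noteq> 0})"
      using f by (auto simp: Cc_def compact_support_def)
    show "mtopology_of X closure_of {x \<in> mspace X. \<phi> (f x) \<noteq> 0} \<subseteq> mtopology_of X closure_of {x \<in> mspace X. f x \<noteq> 0}"
      using \<phi>(2) by (intro closure_of_mono) auto
  qed auto
  ultimately show ?thesis using f \<phi>(2) by (auto simp: Cc_def o_def)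
qed

lemma Cc_lincomb:
  assumes f: "f \<in> Cc X" and g: "g \<in> Cc X"
  shows "(\<lambda>x. a * f x + b * g x) \<in> Cc X"
proof -
  have "continuous_map (mtopology_of X) euclidean (\<lambda>x. a * f x + b * g x)"
  proof -
    have "continuous_on UNIV (\<lambda>p::complex \<times> complex. a * fst p + b * snd p)" by (intro continuous_intros)
    then have "continuous_map euclidean euclidean (\<lambda>p::complex \<times> complex. a * fst p + b * snd p)" by simp
    moreover have "continuous_map (mtopology_of X) (prod_topology euclidean euclidean) (\<lambda>x. (f x, g x))"
      using f g by (intro continuous_map_pairedI) (auto simp: Cc_def)
    ultimately have "continuous_map (mtopology_of X) euclidean ((\<lambda>p::complex \<times> complex. a * fst p + b * snd p) \<circ> (\<lambda>x. (f x, g x)))"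
      by (intro continuous_map_compose) (auto simp: euclidean_product_topology)
    then show ?thesis by (simp add: o_def)
  qed
  moreover have "compact_support X (\<lambda>x. a * f x + b * g x)"
    unfolding compact_support_def
  proof (rule closed_compactin)
    show "compactin (mtopology_of X) ((mtopology_of X closure_of {x \<in> mspace X. f x \<noteq> 0}) \<union> (mtopology_of X closure_of {x \<in> mspace X. g x \<noteq> 0}))"
      using f g by (intro compactin_Un) (auto simp: Cc_def compact_support_def)
    have "{x \<in> mspace X. a * f x + b * g x \<noteq> 0} \<subseteq> {x \<in> mspace X. f x \<noteq> 0} \<union> {x \<in> mspace X. g x \<noteq> 0}" by auto
    then show "mtopology_of X closure_of {x \<in> mspace X. a * f x + b * g x \<noteq> 0} \<subseteq> (mtopology_of X closure_of {x \<in> mspace X. f x \<noteq> 0}) \<union> (mtopology_of X closure_of {x \<in> mspace X. g x \<noteq> 0})"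
      unfolding closure_of_Un[symmetric] by (rule closure_of_mono)
  qed auto
  ultimately show ?thesis using f g by (auto simp: Cc_def)
qed

lemma zero_in_Cc: "(\<lambda>x. 0) \<in> Cc X"
  by (auto simp: Cc_def compact_support_def)

lemma Cc_sum:
  assumes "finite J" "\<And>j. j \<in> J \<Longrightarrow> u j \<in> Cc X"
  shows "(\<lambda>x. \<Sum>j\<in>J. b j * u j x) \<in> Cc X"
  using assms
proof (induction J rule: finite_induct)
  case empty
  then show ?case by (simp add: zero_in_Cc)
next
  case (insert j J)
  then have "(\<lambda>x. b j * u j x + 1 * (\<Sum>j\<in>J. b j * u j x)) \<in> Cc X" by (intro Cc_lincomb) auto
  then show ?case using insert by simp
qed

section \<open>Analytic deformation of a test function\<close>

text \<open>
  A replacement for the triangle inequality that is valid for every exponent: one of the two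
  summands dominates up to the factor \<open>\<eta>\<close>.
\<close>
lemma powr_add_split_le:
  fixes a b q \<eta> :: real
  assumes "0 \<le> a" "0 \<le> b" "0 < q" "0 < \<eta>"
  shows "(a + b) powr q \<le> (1 + \<eta>) powr q * (a powr q + (b / \<eta>) powr q)"
proof (cases "b \<le> \<eta> * a")
  case True
  have "(a + b) powr q \<le> ((1 + \<eta>) * a) powr q" using assms True by (intro powr_mono2) (auto simp: algebra_simps)
  also have "\<dots> = (1 + \<eta>) powr q * a powr q" using assms by (simp add: powr_mult)
  also have "\<dots> \<le> (1 + \<eta>) powr q * (a powr q + (b / \<eta>) powr q)" using assms by (intro mult_left_mono) auto
  finally show ?thesis .
next
  case False
  then have "a \<le> b / \<eta>" using assms by (simp add: pos_le_divide_eq mult.commute)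
  moreover have "(1 + \<eta>) * (b / \<eta>) = b / \<eta> + b" using assms by (simp add: field_simps)
  ultimately have "a + b \<le> (1 + \<eta>) * (b / \<eta>)" by linarith
  then have "(a + b) powr q \<le> ((1 + \<eta>) * (b / \<eta>)) powr q" using assms by (intro powr_mono2) auto
  also have "\<dots> = (1 + \<eta>) powr q * (b / \<eta>) powr q" using assms by (subst powr_mult) auto
  also have "\<dots> \<le> (1 + \<eta>) powr q * (a powr q + (b / \<eta>) powr q)" using assms by (intro mult_left_mono) auto
  finally show ?thesis .
qed

text \<open>
  On an edge the deformed function is \<open>h + e\<close>, where \<open>\<bar>h\<bar>\<close> is essentially \<open>\<bar>f\<bar>\<close> to the power
  \<open>s / r\<close> and \<open>e\<close> is a small error supported in a fixed compact set. The bound on \<open>\<delta>\<close> is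
  chosen such that it reads \<open>\<delta> \<le> \<eta>\<close> when \<open>s = 0\<close>, that is, for the exponent \<open>\<infinity>\<close>.
\<close>
lemma Lp_le_perturbed:
  assumes mms: "metric_measure_space X \<mu>" and K: "compactin (mtopology_of X) K"
    and f[measurable]: "f \<in> borel_measurable \<mu>" and r: "0 < r" "0 \<le> s"
    and fS: "(\<integral>\<^sup>+x. ennreal (norm (f x) powr (1 / r)) \<partial>\<mu>) \<le> ennreal S1" and S: "0 < S1" "S1 < S" and \<eta>: "0 < \<eta>"
    and \<beta>: "0 < \<beta>" "\<beta> powr (1 / r) * S1 \<le> (S1 + S) / 2"
    and \<delta>: "0 < \<delta>" "\<delta> \<le> \<eta> * ((S - S1) / (2 * (measure \<mu> K + 1))) powr s"
    and hb: "\<And>x. norm (h x) \<le> (if f x = 0 then 0 else (\<beta> * norm (f x)) powr (s / r))"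
    and eb: "\<And>x. norm (e x) \<le> \<delta> * indicator K x"
  shows "Lp_le s \<mu> (\<lambda>x. h x + e x) ((1 + \<eta>) * S powr s)"
proof (cases "s = 0")
  case True
  have "norm (h x + e x) \<le> 1 + \<eta>" for x
  proof -
    have "norm (h x) \<le> 1" using hb[of x] True \<beta>(1) by (auto split: if_splits)
    moreover have "norm (e x) \<le> \<eta>"
    proof -
      have "0 < measure \<mu> K + 1" by (simp add: add_nonneg_pos)
      then have "\<delta> \<le> \<eta>" using \<delta>(2) S unfolding True by simp
      then show ?thesis using eb[of x] \<eta> by (cases "x \<in> K") auto
    qed
    ultimately show ?thesis using norm_triangle_ineq[of "h x" "e x"] by linarith
  qed
  then show ?thesis using True S by (simp add: Lp_le_def)
next
  case False
  then have s: "s > 0" using r by simp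
  have Ks: "K \<in> sets \<mu>" using mms_compact_sets[OF mms K] .
  have Kf: "emeasure \<mu> K = ennreal (measure \<mu> K)"
    using mms_compact_finite[OF mms K] by (auto intro!: emeasure_eq_ennreal_measure)
  define \<kappa> where "\<kappa> = measure \<mu> K"
  have \<kappa>: "0 \<le> \<kappa>" by (simp add: \<kappa>_def)
  define d where "d = (S - S1) / (2 * (\<kappa> + 1))"
  have d: "d > 0" using S \<kappa> by (simp add: d_def)
  have dl: "(\<delta> / \<eta>) powr (1 / s) \<le> d"
  proof -
    have "\<delta> / \<eta> \<le> d powr s" using \<delta> \<eta> by (simp add: d_def \<kappa>_def pos_divide_le_eq mult.commute)
    then have "(\<delta> / \<eta>) powr (1 / s) \<le> (d powr s) powr (1 / s)" using s \<delta> \<eta> by (intro powr_mono2) auto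
    then show ?thesis using s d by (simp add: powr_powr)
  qed
  have pw: "norm (h x + e x) powr (1 / s) \<le> (1 + \<eta>) powr (1 / s) * (\<beta> powr (1 / r) * norm (f x) powr (1 / r) + d * indicator K x)" for x
  proof -
    have "norm (h x + e x) powr (1 / s) \<le> (norm (h x) + norm (e x)) powr (1 / s)"
      using s norm_triangle_ineq by (intro powr_mono2) auto
    also have "\<dots> \<le> (1 + \<eta>) powr (1 / s) * (norm (h x) powr (1 / s) + (norm (e x) / \<eta>) powr (1 / s))"
      using s \<eta> by (intro powr_add_split_le) auto
    also have "\<dots> \<le> (1 + \<eta>) powr (1 / s) * (\<beta> powr (1 / r) * norm (f x) powr (1 / r) + d * indicator K x)"
    proof (intro mult_left_mono add_mono)
      show "norm (h x) powr (1 / s) \<le> \<beta> powr (1 / r) * norm (f x) powr (1 / r)"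
      proof (cases "f x = 0")
        case True
        then show ?thesis using hb[of x] by simp
      next
        case False
        then have "norm (h x) powr (1 / s) \<le> ((\<beta> * norm (f x)) powr (s / r)) powr (1 / s)"
          using hb[of x] s by (intro powr_mono2) auto
        also have "\<dots> = (\<beta> * norm (f x)) powr (1 / r)" using s by (simp add: powr_powr)
        also have "\<dots> = \<beta> powr (1 / r) * norm (f x) powr (1 / r)" using \<beta> by (simp add: powr_mult)
        finally show ?thesis .
      qed
      show "(norm (e x) / \<eta>) powr (1 / s) \<le> d * indicator K x"
      proof (cases "x \<in> K")
        case True
        have "(norm (e x) / \<eta>) powr (1 / s) \<le> (\<delta> / \<eta>) powr (1 / s)"
          using eb[of x] True s \<eta> by (intro powr_mono2 divide_right_mono) auto
        then show ?thesis using dl True by simp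
      next
        case False
        then show ?thesis using eb[of x] by simp
      qed
    qed simp
    finally show ?thesis .
  qed
  have "(\<integral>\<^sup>+x. ennreal (norm (h x + e x) powr (1 / s)) \<partial>\<mu>) \<le>
    (\<integral>\<^sup>+x. ennreal ((1 + \<eta>) powr (1 / s)) * (ennreal (\<beta> powr (1 / r)) * ennreal (norm (f x) powr (1 / r)) + ennreal d * indicator K x) \<partial>\<mu>)"
  proof (rule nn_integral_mono)
    fix x
    have "ennreal (norm (h x + e x) powr (1 / s)) \<le> ennreal ((1 + \<eta>) powr (1 / s) * (\<beta> powr (1 / r) * norm (f x) powr (1 / r) + d * indicator K x))"
      by (rule ennreal_leI[OF pw])
    also have "\<dots> = ennreal ((1 + \<eta>) powr (1 / s)) * (ennreal (\<beta> powr (1 / r)) * ennreal (norm (f x) powr (1 / r)) + ennreal d * indicator K x)"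
      using d by (simp add: ennreal_mult ennreal_plus ennreal_indicator)
    finally show "ennreal (norm (h x + e x) powr (1 / s)) \<le> ennreal ((1 + \<eta>) powr (1 / s)) * (ennreal (\<beta> powr (1 / r)) * ennreal (norm (f x) powr (1 / r)) + ennreal d * indicator K x)" .
  qed
  also have "\<dots> = ennreal ((1 + \<eta>) powr (1 / s)) * (ennreal (\<beta> powr (1 / r)) * (\<integral>\<^sup>+x. ennreal (norm (f x) powr (1 / r)) \<partial>\<mu>) + ennreal d * ennreal \<kappa>)"
    using Ks by (simp add: nn_integral_cmult nn_integral_add nn_integral_cmult_indicator Kf \<kappa>_def)
  also have "\<dots> \<le> ennreal ((1 + \<eta>) powr (1 / s)) * (ennreal (\<beta> powr (1 / r)) * ennreal S1 + ennreal d * ennreal \<kappa>)"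
    by (intro mult_left_mono add_right_mono fS) auto
  also have "\<dots> = ennreal ((1 + \<eta>) powr (1 / s) * (\<beta> powr (1 / r) * S1 + d * \<kappa>))"
    using S d \<kappa> by (simp add: ennreal_mult ennreal_plus)
  also have "\<dots> \<le> ennreal ((1 + \<eta>) powr (1 / s) * S)"
  proof (intro ennreal_leI mult_left_mono)
    have "d * \<kappa> \<le> d * (\<kappa> + 1)" using d by simp
    also have "d * (\<kappa> + 1) = (S - S1) / 2" using \<kappa> by (simp add: d_def field_simps)
    finally show "\<beta> powr (1 / r) * S1 + d * \<kappa> \<le> S" using \<beta>(2) by (simp add: field_simps)
  qed simp
  also have "(1 + \<eta>) powr (1 / s) * S = ((1 + \<eta>) * S powr s) powr (1 / s)"
    using s S \<eta> by (simp add: powr_mult powr_powr)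
  finally show ?thesis using False by (simp add: Lp_le_def)
qed

text \<open>
  With \<open>Pz z = ((1 - z) r0 + z r1) / r\<close> the deformation is
  \<open>f + \<Sum>j. (\<beta>\<^bsup>j Pz z\<^esup> - \<beta>\<^sup>j) slice \<beta> j f\<close>. It equals \<open>f\<close> at \<open>\<theta>\<close> because \<open>Pz \<theta> = 1\<close>, so the
  operator at \<open>\<theta>\<close> is evaluated at \<open>f\<close> itself rather than at an approximation of \<open>f\<close>. The index
  \<open>None\<close> stands for the summand \<open>f\<close>. If \<open>p = \<infinity>\<close>, all exponents are infinite and the constant
  family does.
\<close>
lemma test_function_deformation:
  assumes mms: "metric_measure_space X \<mu>" and \<theta>: "0 < \<theta>" "\<theta> < 1" and p: "0 < p0" "0 < p1"
    and eq: "1 / p = ennreal (1 - \<theta>) / p0 + ennreal \<theta> / p1"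
    and f: "f \<in> Cc X" and R: "Lp_norm p \<mu> f < ennreal R"
  shows "\<exists>(J :: int option set) u b A0 A1. finite J \<and> (\<forall>j\<in>J. u j \<in> Cc X \<and> b j holomorphic_on UNIV \<and>
        (\<exists>B. \<forall>z\<in>closure open_strip. norm (b j z) \<le> B)) \<and> 0 < A0 \<and> 0 < A1 \<and> A0 powr (1 - \<theta>) * A1 powr \<theta> \<le> R \<and>
      (\<forall>x. (\<Sum>j\<in>J. b j (of_real \<theta>) * u j x) = f x) \<and>
      (\<forall>y. Lp_norm p0 \<mu> (\<lambda>x. \<Sum>j\<in>J. b j (\<i> * of_real y) * u j x) \<le> ennreal A0) \<and>
      (\<forall>y. Lp_norm p1 \<mu> (\<lambda>x. \<Sum>j\<in>J. b j (1 + \<i> * of_real y) * u j x) \<le> ennreal A1)"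
proof -
  define r0 r1 r where "r0 = enn2real (1 / p0)" and "r1 = enn2real (1 / p1)" and "r = enn2real (1 / p)"
  have p': "0 < p" and r: "r = (1 - \<theta>) * r0 + \<theta> * r1"
    using recip_interp[OF \<theta> p eq] by (auto simp: r0_def r1_def r_def)
  have rn: "0 \<le> r0" "0 \<le> r1" by (auto simp: r0_def r1_def)
  have fm[measurable]: "f \<in> borel_measurable \<mu>" by (rule Cc_borel_measurable[OF mms f])
  have Rp: "R > 0" using R by (metis ennreal_neg not_gr_zero not_less_zero linorder_not_less)
  show ?thesis
  proof (cases "r = 0")
    case True
    then have z: "r0 = 0" "r1 = 0" using r rn \<theta> by (auto simp: add_nonneg_eq_0_iff)
    have pinf: "p = \<infinity>" "p0 = \<infinity>" "p1 = \<infinity>"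
      using ennreal_recip_cases[OF p'] ennreal_recip_cases[OF p(1)] ennreal_recip_cases[OF p(2)] True z
      unfolding r_def r0_def r1_def by (metis less_irrefl)+
    have "R powr (1 - \<theta>) * R powr \<theta> = R" using Rp by (simp add: powr_add[symmetric])
    then show ?thesis
      using f R Rp pinf
      by (intro exI[of _ "{None}"] exI[of _ "\<lambda>_. f"] exI[of _ "\<lambda>_ _. 1"] exI[of _ R]) (auto intro: less_imp_le)
  next
    case False
    then have rp: "r > 0" using r rn \<theta> by (simp add: order_less_le)
    have fin: "Lp_le r \<mu> f (enn2real (Lp_norm p \<mu> f))"
      using Lp_norm_le_iff[OF p' fm, of "enn2real (Lp_norm p \<mu> f)"] R unfolding r_def
      by (metis enn2real_nonneg ennreal_enn2real ennreal_less_top order.refl order.strict_trans)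
    define n where "n = enn2real (Lp_norm p \<mu> f)"
    have "Lp_norm p \<mu> f = ennreal n" unfolding n_def using R by (intro ennreal_enn2real[symmetric]) (auto intro: less_trans)
    then have "ennreal n < ennreal R" using R by simp
    then have n: "0 \<le> n" "n < R" by (auto simp: n_def ennreal_less_iff)
    \<comment> \<open>Room for the errors: \<open>n powr (1 / r) < S1 < S\<close> and \<open>S powr r < R\<close>; the factor
      \<open>1 + \<eta>\<close> uses up the remaining distance to \<open>R\<close>.\<close>
    define S where "S = ((n + R) / 2) powr (1 / r)"
    define S1 where "S1 = (n powr (1 / r) + S) / 2"
    have mid: "0 < (n + R) / 2" "n < (n + R) / 2" "(n + R) / 2 < R" using n Rp by auto
    have S: "n powr (1 / r) < S" unfolding S_def using mid n rp by (intro powr_less_mono2) auto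
    have S0: "0 < S" using mid by (simp add: S_def)
    have Sr: "S powr r = (n + R) / 2" using mid rp by (simp add: S_def powr_powr)
    have S1: "0 < S1" "S1 < S" "n powr (1 / r) \<le> S1" using S S0 by (auto simp: S1_def intro: add_nonneg_pos)
    have fS: "(\<integral>\<^sup>+x. ennreal (norm (f x) powr (1 / r)) \<partial>\<mu>) \<le> ennreal S1"
      using fin rp S1(3) unfolding n_def[symmetric] Lp_le_def by (auto intro: order_trans ennreal_leI)
    define \<eta> where "\<eta> = R / S powr r - 1"
    have \<eta>: "0 < \<eta>" and \<eta>R: "(1 + \<eta>) * S powr r = R" using mid unfolding \<eta>_def Sr by (auto simp: field_simps)
    obtain K where K: "compactin (mtopology_of X) K" "\<And>x. x \<notin> K \<Longrightarrow> f x = 0" using Cc_compact_carrier[OF f] by blast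
    obtain F where F: "0 < F" "\<And>x. norm (f x) \<le> F" using Cc_bounded[OF f] by blast
    define dd where "dd s = \<eta> * ((S - S1) / (2 * (measure \<mu> K + 1))) powr s" for s
    have Kp: "0 < measure \<mu> K + 1" by (simp add: add_nonneg_pos)
    have dd: "0 < dd s" for s using \<eta> S1 Kp by (simp add: dd_def)
    define \<delta> where "\<delta> = min (dd r0) (dd r1)"
    have \<delta>: "0 < \<delta>" "\<delta> \<le> dd r0" "\<delta> \<le> dd r1" using dd by (auto simp: \<delta>_def)
    \<comment> \<open>The bound for \<open>\<beta>\<close> makes \<open>\<beta> powr (1 / r) * S1 \<le> (S1 + S) / 2\<close>.\<close>
    define \<kappa> where "\<kappa> = ((S1 + S) / 2 / S1) powr r"
    have \<kappa>: "1 < \<kappa>" unfolding \<kappa>_def using S1 rp by (intro gr_one_powr) auto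
    obtain \<beta> and J :: "int set" where \<beta>: "1 < \<beta>" "\<beta> \<le> \<kappa>" and J: "finite J"
      and ap: "\<And>w. norm w \<le> F \<Longrightarrow> norm (w - (\<Sum>j\<in>J. of_real (\<beta> powr real_of_int j) * slice \<beta> j w)) \<le> \<delta>"
      using slice_approx[OF F(1) \<delta>(1) \<kappa>] by blast
    have \<beta>S: "\<beta> powr (1 / r) * S1 \<le> (S1 + S) / 2"
    proof -
      have "\<beta> powr (1 / r) \<le> \<kappa> powr (1 / r)" using \<beta> rp by (intro powr_mono2) auto
      also have "\<dots> = (S1 + S) / 2 / S1" using S1 rp by (simp add: \<kappa>_def powr_powr)
      finally show ?thesis using S1 by (simp add: field_simps)
    qed
    define Pz where "Pz z = ((1 - z) * of_real r0 + z * of_real r1) / complex_of_real r" for z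
    have P\<theta>: "Pz (of_real \<theta>) = 1"
    proof -
      have "Pz (of_real \<theta>) = of_real ((1 - \<theta>) * r0 + \<theta> * r1) / of_real r" by (simp add: Pz_def)
      then show ?thesis using False by (simp add: r[symmetric])
    qed
    have RePz: "Re (Pz z) = ((1 - Re z) * r0 + Re z * r1) / r" for z
      unfolding Pz_def by (simp only: Re_divide_of_real) simp
    define a where "a j z = exp (of_real (real_of_int j * ln \<beta>) * Pz z)" for j z
    have na: "norm (a j z) = \<beta> powr (real_of_int j * Re (Pz z))" for j z
      using \<beta> by (simp add: a_def powr_def mult_ac)
    have a\<theta>: "a j (of_real \<theta>) = of_real (\<beta> powr real_of_int j)" for j
      using \<beta> by (simp add: a_def P\<theta> powr_def exp_of_real[symmetric])
    define b where "b k z = (case k of None \<Rightarrow> 1 | Some j \<Rightarrow> a j z - of_real (\<beta> powr real_of_int j))" for k z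
    define u where "u k x = (case k of None \<Rightarrow> f x | Some j \<Rightarrow> slice \<beta> j (f x))" for k x
    define JJ where "JJ = insert None (Some ` J)"
    have fJJ: "finite JJ" using J by (simp add: JJ_def)
    have sumJJ: "(\<Sum>k\<in>JJ. b k z * u k x) = (\<Sum>j\<in>J. a j z * slice \<beta> j (f x)) + (f x - (\<Sum>j\<in>J. of_real (\<beta> powr real_of_int j) * slice \<beta> j (f x)))" for z x
      using J by (simp add: JJ_def b_def u_def sum.reindex left_diff_distrib sum_subtractf)
    have uC: "u k \<in> Cc X" for k
    proof (cases k)
      case None
      then show ?thesis using f by (simp add: u_def[abs_def])
    next
      case (Some j)
      then show ?thesis using Cc_comp[OF f slice_continuous[OF \<beta>(1)], of j] by (simp add: u_def[abs_def])
    qed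
    have bh: "b k holomorphic_on UNIV" for k
      unfolding b_def a_def Pz_def using False by (cases k) (auto intro!: holomorphic_intros)
    have bb: "\<exists>B. \<forall>z\<in>closure open_strip. norm (b k z) \<le> B" for k
    proof (cases k)
      case None
      then show ?thesis by (intro exI[of _ 1]) (simp add: b_def)
    next
      case (Some j)
      have "norm (b k z) \<le> \<beta> powr (\<bar>real_of_int j\<bar> * ((r0 + r1) / r)) + \<beta> powr real_of_int j" if z: "z \<in> closure open_strip" for z
      proof -
        have zz: "0 \<le> Re z" "Re z \<le> 1" using z by (auto simp: closure_open_strip)
        have "(1 - Re z) * r0 \<le> 1 * r0" "Re z * r1 \<le> 1 * r1" using zz rn by (intro mult_right_mono; simp)+
        then have "Re (Pz z) \<le> (r0 + r1) / r" unfolding RePz using rp by (intro divide_right_mono) auto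
        moreover have "0 \<le> Re (Pz z)" unfolding RePz using zz rn rp by auto
        ultimately have "real_of_int j * Re (Pz z) \<le> \<bar>real_of_int j\<bar> * ((r0 + r1) / r)"
          by (intro order_trans[OF mult_right_mono[OF abs_ge_self] mult_left_mono]) auto
        then have "norm (a j z) \<le> \<beta> powr (\<bar>real_of_int j\<bar> * ((r0 + r1) / r))"
          unfolding na using \<beta> by (intro powr_mono) auto
        moreover have "norm (b k z) \<le> norm (a j z) + norm (complex_of_real (\<beta> powr real_of_int j))"
          unfolding b_def Some option.case by (rule norm_triangle_ineq4)
        ultimately show ?thesis by simp
      qed
      then show ?thesis by blast
    qed
    have edge: "Lp_le s \<mu> (\<lambda>x. \<Sum>k\<in>JJ. b k z * u k x) ((1 + \<eta>) * S powr s)"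
      if s: "0 \<le> s" "\<delta> \<le> dd s" "Re (Pz z) = s / r" for s z
      unfolding sumJJ
    proof (rule Lp_le_perturbed[OF mms K(1) fm rp s(1) fS S1(1,2) \<eta> _ \<beta>S \<delta>(1) s(2)[unfolded dd_def]])
      fix x
      show "norm (\<Sum>j\<in>J. a j z * slice \<beta> j (f x)) \<le> (if f x = 0 then 0 else (\<beta> * norm (f x)) powr (s / r))"
        using norm_sum_slice_le[OF \<beta>(1) J, of "s / r" "f x" "\<lambda>j. a j z"] s rp by (auto simp: na)
      show "norm (f x - (\<Sum>j\<in>J. of_real (\<beta> powr real_of_int j) * slice \<beta> j (f x))) \<le> \<delta> * indicator K x"
        using ap[OF F(2)[of x]] K(2)[of x] \<delta>(1) by (cases "x \<in> K") auto
    qed (use \<beta> in auto)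
    have um: "(\<lambda>x. \<Sum>k\<in>JJ. b k z * u k x) \<in> borel_measurable \<mu>" for z
      by (intro borel_measurable_sum borel_measurable_times Cc_borel_measurable[OF mms uC]) auto
    have props: "\<forall>k\<in>JJ. u k \<in> Cc X \<and> b k holomorphic_on UNIV \<and> (\<exists>B. \<forall>z\<in>closure open_strip. norm (b k z) \<le> B)"
      using uC bh bb by blast
    show ?thesis
    proof (rule exI[of _ JJ], rule exI[of _ u], rule exI[of _ b], rule exI[of _ "(1 + \<eta>) * S powr r0"],
        rule exI[of _ "(1 + \<eta>) * S powr r1"], intro conjI allI fJJ props)
      show "0 < (1 + \<eta>) * S powr r0" "0 < (1 + \<eta>) * S powr r1" using \<eta> S0 by simp_all
      have "((1 + \<eta>) * S powr r0) powr (1 - \<theta>) * ((1 + \<eta>) * S powr r1) powr \<theta> =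
         ((1 + \<eta>) powr (1 - \<theta>) * (1 + \<eta>) powr \<theta>) * (S powr (r0 * (1 - \<theta>)) * S powr (r1 * \<theta>))"
        using \<eta> S0 by (simp add: powr_mult powr_powr)
      also have "\<dots> = (1 + \<eta>) * S powr r"
        using \<eta> S0 unfolding powr_add[symmetric] by (simp add: r mult.commute)
      finally show "((1 + \<eta>) * S powr r0) powr (1 - \<theta>) * ((1 + \<eta>) * S powr r1) powr \<theta> \<le> R" by (simp add: \<eta>R)
      show "(\<Sum>k\<in>JJ. b k (of_real \<theta>) * u k x) = f x" for x by (simp add: sumJJ a\<theta>)
      fix y
      show "Lp_norm p0 \<mu> (\<lambda>x. \<Sum>k\<in>JJ. b k (\<i> * of_real y) * u k x) \<le> ennreal ((1 + \<eta>) * S powr r0)"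
        using edge[of r0 "\<i> * of_real y"] Lp_norm_le_iff[OF p(1) um, of "(1 + \<eta>) * S powr r0" "\<i> * of_real y"] rn \<delta> \<eta> S0
        by (simp add: RePz r0_def[symmetric])
      show "Lp_norm p1 \<mu> (\<lambda>x. \<Sum>k\<in>JJ. b k (1 + \<i> * of_real y) * u k x) \<le> ennreal ((1 + \<eta>) * S powr r1)"
        using edge[of r1 "1 + \<i> * of_real y"] Lp_norm_le_iff[OF p(2) um, of "(1 + \<eta>) * S powr r1" "1 + \<i> * of_real y"] rn \<delta> \<eta> S0
        by (simp add: RePz r1_def[symmetric])
    qed
  qed
qed

section \<open>Combinations of weakly analytic families\<close>

lemma Lp_le_scale:
  assumes le: "Lp_le r \<mu> f B" and r: "0 \<le> r" and f[measurable]: "f \<in> borel_measurable \<mu>" and B: "0 \<le> B"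
  shows "Lp_le r \<mu> (\<lambda>x. c * f x) (norm c * B)"
proof (cases "r = 0")
  case True
  then have "AE x in \<mu>. norm (f x) \<le> B" using le by (simp add: Lp_le_def)
  then have "AE x in \<mu>. norm (c * f x) \<le> norm c * B"
    by eventually_elim (auto simp: norm_mult intro!: mult_left_mono)
  then show ?thesis using True by (simp add: Lp_le_def)
next
  case False
  have "(\<integral>\<^sup>+x. ennreal (norm (c * f x) powr (1 / r)) \<partial>\<mu>) = (\<integral>\<^sup>+x. ennreal (norm c powr (1 / r)) * ennreal (norm (f x) powr (1 / r)) \<partial>\<mu>)"
    by (simp add: norm_mult powr_mult ennreal_mult)
  also have "\<dots> = ennreal (norm c powr (1 / r)) * (\<integral>\<^sup>+x. ennreal (norm (f x) powr (1 / r)) \<partial>\<mu>)"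
    by (rule nn_integral_cmult) measurable
  also have "\<dots> \<le> ennreal (norm c powr (1 / r)) * ennreal (B powr (1 / r))"
    using le False by (intro mult_left_mono) (auto simp: Lp_le_def)
  also have "\<dots> = ennreal ((norm c * B) powr (1 / r))" using B by (simp add: powr_mult ennreal_mult)
  finally show ?thesis using False by (simp add: Lp_le_def)
qed

lemma Lp_norm_scale_le:
  assumes q: "0 < q" and f: "f \<in> borel_measurable \<mu>" and B: "0 \<le> B" and le: "Lp_norm q \<mu> f \<le> ennreal B"
  shows "Lp_norm q \<mu> (\<lambda>x. c * f x) \<le> ennreal (norm c * B)"
proof -
  have m: "(\<lambda>x. c * f x) \<in> borel_measurable \<mu>" using f by measurable
  show ?thesis
    using Lp_le_scale[of "enn2real (1 / q)" \<mu> f B c] le Lp_norm_le_iff[OF q f B] Lp_norm_le_iff[OF q m, of "norm c * B"] f B by simp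
qed

text \<open>
  The elementary inequality \<open>t \<le> 1 + t powr (1 / r)\<close>, \<open>r \<le> 1\<close>, on a set of finite measure
  takes the place of Hoelder's inequality; the constants are absorbed into \<open>D\<close> because
  \<open>exp (\<gamma> \<bar>Im z\<bar>) \<ge> 1\<close>.
\<close>
lemma admissible_growth_imp_L1_growth:
  assumes mms: "metric_measure_space X \<mu>" and K: "compactin (mtopology_of X) K" and s: "1 \<le> s" and \<gamma>: "0 \<le> \<gamma>"
    and f: "\<And>z. z \<in> Z \<Longrightarrow> integrable (restrict_space \<mu> K) (f z)"
    and C: "\<And>z. z \<in> Z \<Longrightarrow> elog (Lp_norm s (restrict_space \<mu> K) (f z)) \<le> ereal (C * exp (\<gamma> * \<bar>Im z\<bar>))"
  shows "\<exists>D\<ge>0. \<forall>z\<in>Z. (LINT x|restrict_space \<mu> K. norm (f z x)) \<le> exp (D * exp (\<gamma> * \<bar>Im z\<bar>))"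
proof -
  define \<nu> where "\<nu> = restrict_space \<mu> K"
  interpret finite_measure \<nu> unfolding \<nu>_def by (rule finite_measure_restrict_compact[OF mms K])
  define \<kappa> where "\<kappa> = measure \<nu> (space \<nu>)"
  have \<kappa>: "0 \<le> \<kappa>" by (simp add: \<kappa>_def)
  have sp: "0 < s" using s by (rule less_le_trans[rotated]) simp
  define r where "r = enn2real (1 / s)"
  have r: "0 \<le> r" "r \<le> 1"
  proof -
    show "0 \<le> r" by (simp add: r_def)
    have "1 / s \<le> 1" using s by (metis divide_le_posI_ennreal mult.left_neutral mult.commute sp)
    then show "r \<le> 1" unfolding r_def by (metis enn2real_mono enn2real_1 ennreal_1 ennreal_less_top)
  qed
  have bound: "(LINT x|\<nu>. norm (f z x)) \<le> (\<kappa> + 1) * exp ((if r = 0 then 1 else 1 / r) * \<bar>C\<bar> * exp (\<gamma> * \<bar>Im z\<bar>))"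
    if z: "z \<in> Z" for z
  proof -
    define E where "E = \<bar>C\<bar> * exp (\<gamma> * \<bar>Im z\<bar>)"
    have E: "0 \<le> E" by (simp add: E_def)
    have fi: "integrable \<nu> (f z)" using f[OF z] by (simp add: \<nu>_def)
    note fm[measurable] = borel_measurable_integrable[OF fi]
    have "elog (Lp_norm s \<nu> (f z)) \<le> ereal E"
    proof -
      have "C * exp (\<gamma> * \<bar>Im z\<bar>) \<le> E" unfolding E_def by (intro mult_right_mono) auto
      then show ?thesis using C[OF z] unfolding \<nu>_def by (metis ereal_less_eq(3) order_trans)
    qed
    then have "Lp_norm s \<nu> (f z) \<le> ennreal (exp E)"
    proof (cases "Lp_norm s \<nu> (f z)")
      case (real t)
      show ?thesis
      proof (cases "t = 0")
        case False
        then have "ln t \<le> E" using \<open>elog (Lp_norm s \<nu> (f z)) \<le> ereal E\<close> real by (simp add: elog_def)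
        then have "t \<le> exp E" using False real by (metis exp_le_cancel_iff exp_ln order_less_le)
        then show ?thesis using real by (simp add: ennreal_leI)
      qed (use real in simp)
    qed (simp add: elog_def)
    then have le: "Lp_le r \<nu> (f z) (exp E)" using Lp_norm_le_iff[OF sp fm, of "exp E"] by (simp add: r_def)
    show ?thesis
    proof (cases "r = 0")
      case True
      have "(LINT x|\<nu>. norm (f z x)) \<le> (LINT x|\<nu>. exp E)"
        by (rule integral_mono_AE) (use le True fi in \<open>auto simp: Lp_le_def\<close>)
      also have "\<dots> = \<kappa> * exp E" by (simp add: \<kappa>_def)
      finally show ?thesis using True by (simp add: E_def distrib_right add_increasing2)
    next
      case False
      then have rp: "r > 0" using r by simp
      note li = Lp_le_imp_integrable[OF rp fm le]
      have "(LINT x|\<nu>. norm (f z x)) \<le> (LINT x|\<nu>. 1 + norm (f z x) powr (1 / r))"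
      proof (rule integral_mono)
        show "integrable \<nu> (\<lambda>x. 1 + norm (f z x) powr (1 / r))" using li by auto
        fix x
        show "norm (f z x) \<le> 1 + norm (f z x) powr (1 / r)"
        proof (cases "norm (f z x) \<le> 1")
          case False
          then have "norm (f z x) powr 1 \<le> norm (f z x) powr (1 / r)" using rp r by (intro powr_mono) auto
          then show ?thesis by simp
        qed (simp add: add_increasing2)
      qed (use fi in auto)
      also have "\<dots> = \<kappa> + (LINT x|\<nu>. norm (f z x) powr (1 / r))" using li by (simp add: \<kappa>_def)
      also have "\<dots> \<le> \<kappa> * exp (1 / r * E) + exp (1 / r * E)"
      proof (rule add_mono)
        show "\<kappa> \<le> \<kappa> * exp (1 / r * E)" using \<kappa> E rp by (intro mult_le_cancel_left1[THEN iffD2]) auto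
        show "(LINT x|\<nu>. norm (f z x) powr (1 / r)) \<le> exp (1 / r * E)" using li by (simp add: powr_def)
      qed
      finally show ?thesis using False by (simp add: E_def algebra_simps)
    qed
  qed
  define k where "k = (if r = 0 then 1 else 1 / r) * \<bar>C\<bar>"
  have k: "0 \<le> k" using r by (simp add: k_def)
  show ?thesis
  proof (intro exI[of _ "ln (\<kappa> + 1) + k"] conjI ballI)
    have l: "0 \<le> ln (\<kappa> + 1)" using \<kappa> by simp
    then show "0 \<le> ln (\<kappa> + 1) + k" using k by simp
    fix z assume z: "z \<in> Z"
    have "ln (\<kappa> + 1) * 1 \<le> ln (\<kappa> + 1) * exp (\<gamma> * \<bar>Im z\<bar>)" using l \<gamma> by (intro mult_left_mono) auto
    then have "exp (ln (\<kappa> + 1) + k * exp (\<gamma> * \<bar>Im z\<bar>)) \<le> exp ((ln (\<kappa> + 1) + k) * exp (\<gamma> * \<bar>Im z\<bar>))"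
      by (simp add: distrib_right)
    moreover have "exp (ln (\<kappa> + 1) + k * exp (\<gamma> * \<bar>Im z\<bar>)) = (\<kappa> + 1) * exp (k * exp (\<gamma> * \<bar>Im z\<bar>))"
      using \<kappa> by (simp add: exp_add)
    ultimately show "(LINT x|restrict_space \<mu> K. norm (f z x)) \<le> exp ((ln (\<kappa> + 1) + k) * exp (\<gamma> * \<bar>Im z\<bar>))"
      using bound[OF z] unfolding \<nu>_def[symmetric] k_def by linarith
  qed
qed

lemma bounded_compact_support_integrable:
  assumes mms: "metric_measure_space X \<mu>" and f: "f \<in> L1_loc X \<mu>"
    and w: "w \<in> borel_measurable \<mu>" "\<exists>b. \<forall>x\<in>mspace X. norm (w x) \<le> b" "compact_support X w"
  shows "integrable \<mu> (\<lambda>x. f x * w x)"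
proof -
  define K where "K = mtopology_of X closure_of {x \<in> mspace X. w x \<noteq> 0}"
  have K: "compactin (mtopology_of X) K" using w(3) by (simp add: K_def compact_support_def)
  obtain b where b: "\<And>x. x \<in> mspace X \<Longrightarrow> norm (w x) \<le> b" using w(2) by auto
  have fK: "integrable \<mu> (\<lambda>x. indicator K x *\<^sub>R f x)" using f K by (auto simp: L1_loc_def set_integrable_def)
  have fm: "f \<in> borel_measurable \<mu>" using f by (simp add: L1_loc_def)
  show ?thesis
  proof (rule Bochner_Integration.integrable_bound[of _ "\<lambda>x. b *\<^sub>R (indicator K x *\<^sub>R f x)"])
    show "integrable \<mu> (\<lambda>x. b *\<^sub>R (indicator K x *\<^sub>R f x))" using fK by (rule integrable_scaleR_right)
    show "(\<lambda>x. f x * w x) \<in> borel_measurable \<mu>" using fm w(1) by measurable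
    show "AE x in \<mu>. norm (f x * w x) \<le> norm (b *\<^sub>R (indicator K x *\<^sub>R f x))"
    proof (rule AE_I2)
      fix x assume "x \<in> space \<mu>"
      then have x: "x \<in> mspace X" using mms_space[OF mms] by simp
      have sub: "{x \<in> mspace X. w x \<noteq> 0} \<subseteq> K" unfolding K_def by (intro closure_of_subset) auto
      show "norm (f x * w x) \<le> norm (b *\<^sub>R (indicator K x *\<^sub>R f x))"
      proof (cases "x \<in> K")
        case True
        have "norm (f x) * norm (w x) \<le> norm (f x) * \<bar>b\<bar>" using b[OF x] by (intro mult_left_mono) auto
        then show ?thesis using True by (simp add: norm_mult mult.commute)
      next
        case False
        then show ?thesis using sub x by auto
      qed
    qed
  qed
qed

lemma L1_loc_add_mult:
  assumes "f \<in> L1_loc X \<mu>" "g \<in> L1_loc X \<mu>"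
  shows "(\<lambda>x. a * f x + b * g x) \<in> L1_loc X \<mu>"
  using assms
  by (auto simp: L1_loc_def set_integrable_def scaleR_add_right simp flip: mult_scaleR_right
      intro!: Bochner_Integration.integrable_add integrable_mult_right)

lemma tame_family_combine:
  assumes mms: "metric_measure_space X \<mu>" and \<gamma>: "0 \<le> \<gamma>"
    and G: "tame_family X \<mu> \<gamma> G" and H: "tame_family X \<mu> \<gamma> H"
    and a: "a holomorphic_on UNIV" "\<And>z. z \<in> closure open_strip \<Longrightarrow> norm (a z) \<le> A"
    and b: "b holomorphic_on UNIV" "\<And>z. z \<in> closure open_strip \<Longrightarrow> norm (b z) \<le> B"
  shows "tame_family X \<mu> \<gamma> (\<lambda>z x. a z * G z x + b z * H z x)"
  unfolding tame_family_def
proof (intro conjI ballI impI allI)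
  show L: "(\<lambda>x. a z * G z x + b z * H z x) \<in> L1_loc X \<mu>" if "z \<in> closure open_strip" for z
    using G H that by (intro L1_loc_add_mult) (auto simp: tame_family_def)
  fix w assume w: "w \<in> borel_measurable \<mu>" "(\<exists>b. \<forall>x\<in>mspace X. norm (w x) \<le> b) \<and> compact_support X w"
  have eq: "(LINT x|\<mu>. (a z * G z x + b z * H z x) * w x) = a z * (LINT x|\<mu>. G z x * w x) + b z * (LINT x|\<mu>. H z x * w x)"
    if z: "z \<in> closure open_strip" for z
  proof -
    have "integrable \<mu> (\<lambda>x. G z x * w x)" "integrable \<mu> (\<lambda>x. H z x * w x)"
      using G H z w by (auto intro!: bounded_compact_support_integrable[OF mms] simp: tame_family_def)
    then show ?thesis by (simp add: distrib_right mult.assoc)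
  qed
  have "(\<lambda>z. LINT x|\<mu>. G z x * w x) holomorphic_on open_strip" "continuous_on (closure open_strip) (\<lambda>z. LINT x|\<mu>. G z x * w x)"
    "(\<lambda>z. LINT x|\<mu>. H z x * w x) holomorphic_on open_strip" "continuous_on (closure open_strip) (\<lambda>z. LINT x|\<mu>. H z x * w x)"
    using G H w by (auto simp: tame_family_def)
  note gh = this
  have "(\<lambda>z. a z * (LINT x|\<mu>. G z x * w x) + b z * (LINT x|\<mu>. H z x * w x)) holomorphic_on open_strip"
    using gh holomorphic_on_subset[OF a(1)] holomorphic_on_subset[OF b(1)] by (intro holomorphic_intros) auto
  then show "(\<lambda>z. LINT x|\<mu>. (a z * G z x + b z * H z x) * w x) holomorphic_on open_strip"
  proof (rule holomorphic_transform)
    fix z assume "z \<in> open_strip"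
    then have "z \<in> closure open_strip" using closure_subset by blast
    then show "a z * (LINT x|\<mu>. G z x * w x) + b z * (LINT x|\<mu>. H z x * w x) = (LINT x|\<mu>. (a z * G z x + b z * H z x) * w x)"
      by (rule eq[symmetric])
  qed
  have "continuous_on (closure open_strip) (\<lambda>z. a z * (LINT x|\<mu>. G z x * w x) + b z * (LINT x|\<mu>. H z x * w x))"
    using gh holomorphic_on_imp_continuous_on[OF holomorphic_on_subset[OF a(1)]] holomorphic_on_imp_continuous_on[OF holomorphic_on_subset[OF b(1)]]
    by (intro continuous_intros) auto
  then show "continuous_on (closure open_strip) (\<lambda>z. LINT x|\<mu>. (a z * G z x + b z * H z x) * w x)"
    by (rule continuous_on_eq) (use eq in auto)
next
  fix K assume K: "compactin (mtopology_of X) K"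
  define \<nu> where "\<nu> = restrict_space \<mu> K"
  obtain C where C: "C \<ge> 0" "\<And>z. z \<in> closure open_strip \<Longrightarrow> (LINT x|\<nu>. norm (G z x)) \<le> exp (C * exp (\<gamma> * \<bar>Im z\<bar>))"
    using G K unfolding tame_family_def \<nu>_def by meson
  obtain D where D: "D \<ge> 0" "\<And>z. z \<in> closure open_strip \<Longrightarrow> (LINT x|\<nu>. norm (H z x)) \<le> exp (D * exp (\<gamma> * \<bar>Im z\<bar>))"
    using H K unfolding tame_family_def \<nu>_def by meson
  define k where "k = \<bar>A\<bar> + \<bar>B\<bar> + 1"
  show "\<exists>C\<ge>0. \<forall>z\<in>closure open_strip. (LINT x|restrict_space \<mu> K. norm (a z * G z x + b z * H z x)) \<le> exp (C * exp (\<gamma> * \<bar>Im z\<bar>))"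
    unfolding \<nu>_def[symmetric]
  proof (intro exI[of _ "ln k + (C + D)"] conjI ballI)
    have l: "0 \<le> ln k" by (simp add: k_def)
    then show "0 \<le> ln k + (C + D)" using C(1) D(1) by simp
    fix z assume z: "z \<in> closure open_strip"
    have Gi: "integrable \<nu> (G z)" "integrable \<nu> (H z)"
      using G H z unfolding \<nu>_def by (auto intro!: L1_loc_integrable_restrict[OF mms K] simp: tame_family_def)
    define E where "E = exp (\<gamma> * \<bar>Im z\<bar>)"
    have E: "1 \<le> E" using \<gamma> by (simp add: E_def)
    have "(LINT x|\<nu>. norm (a z * G z x + b z * H z x)) \<le> (LINT x|\<nu>. \<bar>A\<bar> * norm (G z x) + \<bar>B\<bar> * norm (H z x))"
    proof (rule integral_mono)
      show "norm (a z * G z x + b z * H z x) \<le> \<bar>A\<bar> * norm (G z x) + \<bar>B\<bar> * norm (H z x)" for x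
      proof -
        have "norm (a z) \<le> \<bar>A\<bar>" "norm (b z) \<le> \<bar>B\<bar>" using a(2)[OF z] b(2)[OF z] by linarith+
        then show ?thesis
          by (intro order_trans[OF norm_triangle_ineq] add_mono) (auto simp: norm_mult intro!: mult_right_mono)
      qed
    qed (use Gi in auto)
    also have "\<dots> = \<bar>A\<bar> * (LINT x|\<nu>. norm (G z x)) + \<bar>B\<bar> * (LINT x|\<nu>. norm (H z x))" using Gi by simp
    also have "\<dots> \<le> \<bar>A\<bar> * exp ((C + D) * E) + \<bar>B\<bar> * exp ((C + D) * E)"
    proof (intro add_mono mult_left_mono)
      have "exp (C * E) \<le> exp ((C + D) * E)" "exp (D * E) \<le> exp ((C + D) * E)"
        using C(1) D(1) E by (simp_all add: distrib_right)
      then show "(LINT x|\<nu>. norm (G z x)) \<le> exp ((C + D) * E)" "(LINT x|\<nu>. norm (H z x)) \<le> exp ((C + D) * E)"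
        using C(2)[OF z] D(2)[OF z] unfolding E_def by linarith+
    qed auto
    also have "\<dots> \<le> k * exp ((C + D) * E)" by (simp add: k_def algebra_simps)
    also have "\<dots> = exp (ln k + (C + D) * E)" by (simp add: exp_add k_def)
    also have "\<dots> \<le> exp ((ln k + (C + D)) * E)"
      using mult_left_mono[OF E l] by (simp add: distrib_right)
    finally show "(LINT x|\<nu>. norm (a z * G z x + b z * H z x)) \<le> exp ((ln k + (C + D)) * exp (\<gamma> * \<bar>Im z\<bar>))"
      by (simp add: E_def)
  qed
qed

lemma tame_family_cong_AE:
  assumes mms: "metric_measure_space X \<mu>" and G: "tame_family X \<mu> \<gamma> G"
    and H: "\<And>z. z \<in> closure open_strip \<Longrightarrow> H z \<in> L1_loc X \<mu>"
    and ae: "\<And>z. z \<in> closure open_strip \<Longrightarrow> AE x in \<mu>. H z x = G z x"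
  shows "tame_family X \<mu> \<gamma> H"
  unfolding tame_family_def
proof (intro conjI ballI impI allI H)
  have HM: "H z \<in> borel_measurable \<mu>" "G z \<in> borel_measurable \<mu>" if "z \<in> closure open_strip" for z
    using H[OF that] G that by (auto simp: tame_family_def L1_loc_def)
  fix w assume w: "w \<in> borel_measurable \<mu>" "(\<exists>b. \<forall>x\<in>mspace X. norm (w x) \<le> b) \<and> compact_support X w"
  have eq: "(LINT x|\<mu>. G z x * w x) = (LINT x|\<mu>. H z x * w x)" if z: "z \<in> closure open_strip" for z
  proof (rule integral_cong_AE)
    show "AE x in \<mu>. G z x * w x = H z x * w x" using ae[OF z] by eventually_elim auto
  qed (use HM[OF z] w in measurable)
  have gh: "(\<lambda>z. LINT x|\<mu>. G z x * w x) holomorphic_on open_strip" "continuous_on (closure open_strip) (\<lambda>z. LINT x|\<mu>. G z x * w x)"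
    using G w by (auto simp: tame_family_def)
  show "(\<lambda>z. LINT x|\<mu>. H z x * w x) holomorphic_on open_strip"
    by (rule holomorphic_transform[OF gh(1)], rule eq) (use closure_subset in blast)
  show "continuous_on (closure open_strip) (\<lambda>z. LINT x|\<mu>. H z x * w x)"
    by (rule continuous_on_eq[OF gh(2)]) (use eq in auto)
next
  fix K assume K: "compactin (mtopology_of X) K"
  have HM: "H z \<in> borel_measurable \<mu>" "G z \<in> borel_measurable \<mu>" if "z \<in> closure open_strip" for z
    using H[OF that] G that by (auto simp: tame_family_def L1_loc_def)
  have Ks: "K \<in> sets \<mu>" using mms_compact_sets[OF mms K] .
  have "(LINT x|restrict_space \<mu> K. norm (H z x)) = (LINT x|restrict_space \<mu> K. norm (G z x))" if z: "z \<in> closure open_strip" for z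
  proof (rule integral_cong_AE)
    show "AE x in restrict_space \<mu> K. norm (H z x) = norm (G z x)"
      using ae[OF z] Ks by (subst AE_restrict_space_iff) (auto simp: sets.Int_space_eq2)
  qed (use HM[OF z] in \<open>auto intro!: borel_measurable_norm measurable_restrict_space1\<close>)
  then show "\<exists>C\<ge>0. \<forall>z\<in>closure open_strip. (LINT x|restrict_space \<mu> K. norm (H z x)) \<le> exp (C * exp (\<gamma> * \<bar>Im z\<bar>))"
    using G K unfolding tame_family_def by simp
qed

lemma tame_family_sum:
  assumes mms: "metric_measure_space X \<mu>" and \<gamma>: "0 \<le> \<gamma>" and J: "finite J"
    and G: "\<And>j. j \<in> J \<Longrightarrow> tame_family X \<mu> \<gamma> (G j)"
    and b: "\<And>j. j \<in> J \<Longrightarrow> b j holomorphic_on UNIV" "\<And>j. j \<in> J \<Longrightarrow> \<exists>B. \<forall>z\<in>closure open_strip. norm (b j z) \<le> B"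
    and Z: "tame_family X \<mu> \<gamma> Z"
  shows "tame_family X \<mu> \<gamma> (\<lambda>z x. \<Sum>j\<in>J. b j z * G j z x)"
  using J G b
proof (induction J rule: finite_induct)
  case empty
  have "tame_family X \<mu> \<gamma> (\<lambda>z x. 0 * Z z x + 0 * Z z x)"
    by (rule tame_family_combine[OF mms \<gamma> Z Z, where A = 0 and B = 0]) auto
  then show ?case by simp
next
  case (insert j J)
  obtain B where B: "\<And>z. z \<in> closure open_strip \<Longrightarrow> norm (b j z) \<le> B" using insert.prems(3)[of j] by blast
  have "tame_family X \<mu> \<gamma> (\<lambda>z x. b j z * G j z x + 1 * (\<Sum>j\<in>J. b j z * G j z x))"
    by (rule tame_family_combine[OF mms \<gamma>, where A = B and B = 1]) (use insert B in auto)
  then show ?case using insert by simp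
qed

section \<open>Multilinear operators\<close>

lemma Cc_tuples_upd:
  assumes "\<phi> \<in> Cc_tuples m X" "\<kappa> \<in> {1..m}" "f \<in> Cc (X \<kappa>)"
  shows "\<phi>(\<kappa> := f) \<in> Cc_tuples m X"
  using assms by (auto simp: Cc_tuples_def PiE_iff extensional_def)

lemma multilinear_opD:
  assumes "multilinear_op m X \<mu> L" "\<phi> \<in> Cc_tuples m X" "\<kappa> \<in> {1..m}" "f \<in> Cc (X \<kappa>)" "g \<in> Cc (X \<kappa>)"
  shows "AE x in \<mu> 0. L (\<phi>(\<kappa> := (\<lambda>t. a * f t + b * g t))) x = a * L (\<phi>(\<kappa> := f)) x + b * L (\<phi>(\<kappa> := g)) x"
  using assms by (auto simp: multilinear_op_def)

lemma multilinear_op_sum: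
  assumes L: "multilinear_op m X \<mu> L" and \<phi>: "\<phi> \<in> Cc_tuples m X" and \<kappa>: "\<kappa> \<in> {1..m}"
    and J: "finite J" and u: "\<And>j. j \<in> J \<Longrightarrow> u j \<in> Cc (X \<kappa>)"
  shows "AE x in \<mu> 0. L (\<phi>(\<kappa> := (\<lambda>t. \<Sum>j\<in>J. b j * u j t))) x = (\<Sum>j\<in>J. b j * L (\<phi>(\<kappa> := u j)) x)"
  using J u
proof (induction J rule: finite_induct)
  case empty
  show ?case
    using multilinear_opD[OF L \<phi> \<kappa> zero_in_Cc zero_in_Cc, of 0 0] by (simp add: fun_upd_def)
next
  case (insert j J)
  have "AE x in \<mu> 0. L (\<phi>(\<kappa> := (\<lambda>t. b j * u j t + 1 * (\<Sum>j\<in>J. b j * u j t)))) x =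
      b j * L (\<phi>(\<kappa> := u j)) x + 1 * L (\<phi>(\<kappa> := (\<lambda>t. \<Sum>j\<in>J. b j * u j t))) x"
  proof -
    have "u j \<in> Cc (X \<kappa>)" "(\<lambda>t. \<Sum>j\<in>J. b j * u j t) \<in> Cc (X \<kappa>)" using insert by (auto intro: Cc_sum)
    then show ?thesis by (rule multilinear_opD[OF L \<phi> \<kappa>])
  qed
  moreover have "AE x in \<mu> 0. L (\<phi>(\<kappa> := (\<lambda>t. \<Sum>j\<in>J. b j * u j t))) x = (\<Sum>j\<in>J. b j * L (\<phi>(\<kappa> := u j)) x)"
    by (rule insert.IH) (use insert.prems in auto)
  ultimately show ?case
    by eventually_elim (simp only: sum.insert[OF insert.hyps(1,2)] mult_1)
qed

lemma analytic_family_tame: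
  assumes mms: "metric_measure_space (X 0) (\<mu> 0)"
    and ml: "\<And>z. z \<in> closure open_strip \<Longrightarrow> multilinear_op m X \<mu> (T z)"
    and an: "analytic_family m X \<mu> T" and ag: "admissible_growth m X \<mu> T"
  obtains \<gamma> where "0 \<le> \<gamma>" "\<gamma> < pi" "\<And>\<phi>. \<phi> \<in> Cc_tuples m X \<Longrightarrow> tame_family (X 0) (\<mu> 0) \<gamma> (\<lambda>z. T z \<phi>)"
proof -
  obtain \<gamma> s where \<gamma>: "0 \<le> \<gamma>" "\<gamma> < pi" and s: "1 \<le> s" and
    gr: "\<And>\<phi> K. \<phi> \<in> Cc_tuples m X \<Longrightarrow> compactin (mtopology_of (X 0)) K \<Longrightarrow>
         (\<exists>C::real. \<forall>z\<in>closure open_strip.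
            elog (Lp_norm s (restrict_space (\<mu> 0) K) (T z \<phi>)) \<le> ereal (C * exp (\<gamma> * \<bar>Im z\<bar>)))"
    using ag unfolding admissible_growth_def by blast
  show ?thesis
  proof (rule that[OF \<gamma>])
    fix \<phi> assume \<phi>: "\<phi> \<in> Cc_tuples m X"
    have loc: "T z \<phi> \<in> L1_loc (X 0) (\<mu> 0)" if "z \<in> closure open_strip" for z
      using ml[OF that] \<phi> by (auto simp: multilinear_op_def)
    show "tame_family (X 0) (\<mu> 0) \<gamma> (\<lambda>z. T z \<phi>)"
      unfolding tame_family_def
    proof (intro conjI ballI impI allI loc)
      fix w assume "w \<in> borel_measurable (\<mu> 0)" "(\<exists>b. \<forall>x\<in>mspace (X 0). norm (w x) \<le> b) \<and> compact_support (X 0) w"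
      then have "(\<lambda>z. LINT x|\<mu> 0. T z \<phi> x * w x) analytic_on open_strip \<and>
        continuous_on (closure open_strip) (\<lambda>z. LINT x|\<mu> 0. T z \<phi> x * w x)"
        using an \<phi> unfolding analytic_family_def by blast
      then show "(\<lambda>z. LINT x|\<mu> 0. T z \<phi> x * w x) holomorphic_on open_strip"
        "continuous_on (closure open_strip) (\<lambda>z. LINT x|\<mu> 0. T z \<phi> x * w x)"
        using analytic_imp_holomorphic by blast+
    next
      fix K assume K: "compactin (mtopology_of (X 0)) K"
      obtain C where C: "\<And>z. z \<in> closure open_strip \<Longrightarrow>
            elog (Lp_norm s (restrict_space (\<mu> 0) K) (T z \<phi>)) \<le> ereal (C * exp (\<gamma> * \<bar>Im z\<bar>))"
        using gr[OF \<phi> K] by blast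
      show "\<exists>C\<ge>0. \<forall>z\<in>closure open_strip. (LINT x|restrict_space (\<mu> 0) K. norm (T z \<phi> x)) \<le> exp (C * exp (\<gamma> * \<bar>Im z\<bar>))"
        by (rule admissible_growth_imp_L1_growth[OF mms K s \<gamma>(1) _ C]) (auto intro: L1_loc_integrable_restrict[OF mms K loc])
    qed
  qed
qed

text \<open>
  The arguments are deformed one after the other. In each step multilinearity expands the
  newly deformed argument, which leaves finitely many families whose remaining arguments are
  covered by the induction hypothesis.
\<close>
lemma tame_family_deformed:
  fixes u :: "nat \<Rightarrow> 'j \<Rightarrow> 'a \<Rightarrow> complex"
  assumes mms: "metric_measure_space (X 0) (\<mu> 0)" and \<gamma>: "0 \<le> \<gamma>"
    and ml: "\<And>z. z \<in> closure open_strip \<Longrightarrow> multilinear_op m X \<mu> (T z)"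
    and tame: "\<And>\<phi>. \<phi> \<in> Cc_tuples m X \<Longrightarrow> tame_family (X 0) (\<mu> 0) \<gamma> (\<lambda>z. T z \<phi>)"
    and J: "\<And>\<kappa>. \<kappa> \<in> {1..m} \<Longrightarrow> finite (J \<kappa>)"
    and u: "\<And>\<kappa> j. \<kappa> \<in> {1..m} \<Longrightarrow> j \<in> J \<kappa> \<Longrightarrow> u \<kappa> j \<in> Cc (X \<kappa>)"
    and b: "\<And>\<kappa> j. \<kappa> \<in> {1..m} \<Longrightarrow> j \<in> J \<kappa> \<Longrightarrow> b \<kappa> j holomorphic_on UNIV"
      "\<And>\<kappa> j. \<kappa> \<in> {1..m} \<Longrightarrow> j \<in> J \<kappa> \<Longrightarrow> \<exists>B. \<forall>z\<in>closure open_strip. norm (b \<kappa> j z) \<le> B"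
  shows "n \<le> m \<Longrightarrow> \<phi> \<in> Cc_tuples m X \<Longrightarrow>
    tame_family (X 0) (\<mu> 0) \<gamma> (\<lambda>z. T z (\<lambda>\<kappa>. if \<kappa> \<in> {1..n} then (\<lambda>t. \<Sum>j\<in>J \<kappa>. b \<kappa> j z * u \<kappa> j t) else \<phi> \<kappa>))"
proof (induction n arbitrary: \<phi>)
  case 0
  then show ?case using tame by simp
next
  case (Suc n)
  define \<psi> where "\<psi> \<phi> z = (\<lambda>\<kappa>. if \<kappa> \<in> {1..n} then (\<lambda>t. \<Sum>j\<in>J \<kappa>. b \<kappa> j z * u \<kappa> j t) else \<phi> \<kappa>)" for \<phi> z
  define k where "k = Suc n"
  have k: "k \<in> {1..m}" using Suc.prems by (simp add: k_def)
  have kn: "k \<notin> {1..n}" by (simp add: k_def)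
  have mem: "\<psi> \<phi>' z \<in> Cc_tuples m X" if "\<phi>' \<in> Cc_tuples m X" for \<phi>' z
    using that Suc.prems(1) J u by (auto simp: \<psi>_def Cc_tuples_def PiE_iff extensional_def intro!: Cc_sum)
  have upd: "(\<psi> \<phi> z)(k := g) = \<psi> (\<phi>(k := g)) z" for g z
    using kn by (auto simp: \<psi>_def fun_eq_iff)
  have eq: "(\<lambda>\<kappa>. if \<kappa> \<in> {1..Suc n} then (\<lambda>t. \<Sum>j\<in>J \<kappa>. b \<kappa> j z * u \<kappa> j t) else \<phi> \<kappa>) =
      (\<psi> \<phi> z)(k := (\<lambda>t. \<Sum>j\<in>J k. b k j z * u k j t))" for z
    by (auto simp: \<psi>_def k_def fun_eq_iff)
  have IH: "tame_family (X 0) (\<mu> 0) \<gamma> (\<lambda>z. T z (\<psi> \<phi>' z))" if "\<phi>' \<in> Cc_tuples m X" for \<phi>'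
    unfolding \<psi>_def using Suc.IH[of \<phi>'] Suc.prems(1) that by simp
  have S: "tame_family (X 0) (\<mu> 0) \<gamma> (\<lambda>z x. \<Sum>j\<in>J k. b k j z * T z (\<psi> (\<phi>(k := u k j)) z) x)"
    by (rule tame_family_sum[OF mms \<gamma> J[OF k] _ _ _ tame[OF Suc.prems(2)]])
       (use IH Cc_tuples_upd[OF Suc.prems(2) k] u[OF k] b[OF k] in auto)
  show ?case
    unfolding eq
  proof (rule tame_family_cong_AE[OF mms S])
    fix z assume z: "z \<in> closure open_strip"
    have "(\<psi> \<phi> z)(k := (\<lambda>t. \<Sum>j\<in>J k. b k j z * u k j t)) \<in> Cc_tuples m X"
      using mem[OF Suc.prems(2)] J u k by (intro Cc_tuples_upd Cc_sum) auto
    then show "T z ((\<psi> \<phi> z)(k := (\<lambda>t. \<Sum>j\<in>J k. b k j z * u k j t))) \<in> L1_loc (X 0) (\<mu> 0)"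
      using ml[OF z] by (auto simp: multilinear_op_def)
    show "AE x in \<mu> 0. T z ((\<psi> \<phi> z)(k := (\<lambda>t. \<Sum>j\<in>J k. b k j z * u k j t))) x = (\<Sum>j\<in>J k. b k j z * T z (\<psi> (\<phi>(k := u k j)) z) x)"
      using multilinear_op_sum[OF ml[OF z] mem[OF Suc.prems(2)] k J[OF k] u[OF k], where b = "\<lambda>j. b k j z"] unfolding upd by simp
  qed
qed

lemma Cc_Lp_norm_finite:
  assumes mms: "metric_measure_space X \<mu>" and p: "0 < p" and f: "f \<in> Cc X"
  shows "Lp_norm p \<mu> f < \<infinity>"
proof -
  have fm[measurable]: "f \<in> borel_measurable \<mu>" by (rule Cc_borel_measurable[OF mms f])
  obtain K where K: "compactin (mtopology_of X) K" "\<And>x. x \<notin> K \<Longrightarrow> f x = 0" using Cc_compact_carrier[OF f] by blast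
  obtain F where F: "0 < F" "\<And>x. norm (f x) \<le> F" using Cc_bounded[OF f] by blast
  define r where "r = enn2real (1 / p)"
  define \<kappa> where "\<kappa> = measure \<mu> K"
  have Ks: "K \<in> sets \<mu>" using mms_compact_sets[OF mms K(1)] .
  have Kf: "emeasure \<mu> K = ennreal \<kappa>"
    using mms_compact_finite[OF mms K(1)] by (auto intro!: emeasure_eq_ennreal_measure simp: \<kappa>_def)
  have "Lp_le r \<mu> f (F * (\<kappa> + 1) powr r)"
  proof (cases "r = 0")
    case True
    have "0 < \<kappa> + 1" by (simp add: \<kappa>_def add_nonneg_pos)
    then show ?thesis using True F by (simp add: Lp_le_def)
  next
    case False
    then have rp: "r > 0" by (simp add: r_def less_le)
    have "(\<integral>\<^sup>+x. ennreal (norm (f x) powr (1 / r)) \<partial>\<mu>) \<le> (\<integral>\<^sup>+x. ennreal (F powr (1 / r)) * indicator K x \<partial>\<mu>)"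
    proof (rule nn_integral_mono)
      fix x
      show "ennreal (norm (f x) powr (1 / r)) \<le> ennreal (F powr (1 / r)) * indicator K x"
        using F K(2)[of x] rp by (cases "x \<in> K") (auto intro!: ennreal_leI powr_mono2)
    qed
    also have "\<dots> = ennreal (F powr (1 / r) * \<kappa>)" using Ks by (simp add: nn_integral_cmult_indicator Kf ennreal_mult \<kappa>_def)
    also have "\<dots> \<le> ennreal (F powr (1 / r) * (\<kappa> + 1))" by (intro ennreal_leI mult_left_mono) auto
    also have "F powr (1 / r) * (\<kappa> + 1) = (F * (\<kappa> + 1) powr r) powr (1 / r)"
    proof -
      have "0 \<le> \<kappa>" by (simp add: \<kappa>_def)
      then show ?thesis using rp F by (simp add: powr_mult powr_powr)
    qed
    finally show ?thesis using False by (simp add: Lp_le_def)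
  qed
  then have "Lp_norm p \<mu> f \<le> ennreal (F * (\<kappa> + 1) powr r)"
    using Lp_norm_le_iff[OF p fm, of "F * (\<kappa> + 1) powr r"] F by (simp add: r_def)
  also have "\<dots> < \<infinity>" by simp
  finally show ?thesis .
qed

theorem theorem3p2:
  fixes m :: nat
    and X :: "nat \<Rightarrow> 'a metric"
    and \<mu> :: "nat \<Rightarrow> 'a measure"
    and T :: "complex \<Rightarrow> (nat \<Rightarrow> 'a \<Rightarrow> complex) \<Rightarrow> 'a \<Rightarrow> complex"
    and p0 p1 p :: "nat \<Rightarrow> ennreal"
    and q0 q1 q :: ennreal
    and \<theta> B0 B1 c \<tau> :: real
    and M0 M1 :: "real \<Rightarrow> real"
  assumes "m \<ge> 1"
    and "\<And>j. j \<le> m \<Longrightarrow> metric_measure_space (X j) (\<mu> j)"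
    and "\<And>z. z \<in> closure open_strip \<Longrightarrow> multilinear_op m X \<mu> (T z)"
    and "analytic_family m X \<mu> T"
    and "admissible_growth m X \<mu> T"
    and "\<And>\<kappa>. \<kappa> \<in> {1..m} \<Longrightarrow> 0 < p0 \<kappa> \<and> 0 < p1 \<kappa>"
    and "0 < q0" and "0 < q1"
    and "0 < \<theta>" and "\<theta> < 1"
    and "\<And>\<kappa>. \<kappa> \<in> {1..m} \<Longrightarrow> 1 / p \<kappa> = ennreal (1 - \<theta>) / p0 \<kappa> + ennreal \<theta> / p1 \<kappa>"
    and "1 / q = ennreal (1 - \<theta>) / q0 + ennreal \<theta> / q1"
    and "B0 > 0" and "B1 > 0"
    and "continuous_on UNIV M0" and "continuous_on UNIV M1"
    and "\<And>y. 0 \<le> M0 y" and "\<And>y. 0 \<le> M1 y"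
    and "0 \<le> c" and "0 \<le> \<tau>" and "\<tau> < pi"
    and "\<And>y. M0 y \<le> exp (c * exp (\<tau> * \<bar>y\<bar>))"
    and "\<And>y. M1 y \<le> exp (c * exp (\<tau> * \<bar>y\<bar>))"
    and "\<And>f y. f \<in> Cc_tuples m X \<Longrightarrow>
           Lp_norm q0 (\<mu> 0) (T (\<i> * of_real y) f)
             \<le> ennreal (B0 * M0 y) * (\<Prod>\<kappa>=1..m. Lp_norm (p0 \<kappa>) (\<mu> \<kappa>) (f \<kappa>))"
    and "\<And>f y. f \<in> Cc_tuples m X \<Longrightarrow>
           Lp_norm q1 (\<mu> 0) (T (1 + \<i> * of_real y) f)
             \<le> ennreal (B1 * M1 y) * (\<Prod>\<kappa>=1..m. Lp_norm (p1 \<kappa>) (\<mu> \<kappa>) (f \<kappa>))"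
  shows "\<forall>f\<in>Cc_tuples m X.
           Lp_norm q (\<mu> 0) (T (of_real \<theta>) f)
             \<le> ennreal (B0 powr (1 - \<theta>) * B1 powr \<theta>) * interp_const M0 M1 \<theta> *
               (\<Prod>\<kappa>=1..m. Lp_norm (p \<kappa>) (\<mu> \<kappa>) (f \<kappa>))"
proof
  fix f assume f: "f \<in> Cc_tuples m X"
  note mms = assms(2) and \<theta> = assms(9,10)
  have mms0: "metric_measure_space (X 0) (\<mu> 0)" by (rule mms) simp
  have fC: "f \<kappa> \<in> Cc (X \<kappa>)" if "\<kappa> \<in> {1..m}" for \<kappa> using f that by (auto simp: Cc_tuples_def)
  have p: "0 < p0 \<kappa>" "0 < p1 \<kappa>" "0 < p \<kappa>" if "\<kappa> \<in> {1..m}" for \<kappa>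
    using assms(6)[OF that] recip_interp(1)[OF \<theta> _ _ assms(11)[OF that]] by auto
  have q: "0 < q" by (rule recip_interp(1)[OF \<theta> assms(7,8,12)])
  obtain \<gamma> where \<gamma>: "0 \<le> \<gamma>" "\<gamma> < pi" and tame: "\<And>\<phi>. \<phi> \<in> Cc_tuples m X \<Longrightarrow> tame_family (X 0) (\<mu> 0) \<gamma> (\<lambda>z. T z \<phi>)"
    using analytic_family_tame[OF mms0 assms(3,4,5)] by blast
  note M0 = assms(15,17,22) and M1 = assms(16,18,23) and \<tau> = assms(20,21) and c = assms(19)
  have Ifin: "interp_const M0 M1 \<theta> < \<infinity>"
    using log_average_less_top[OF \<theta> \<tau>(2) c c M0 M1] by (auto simp: interp_const_eq eexp_def)
  have key: "Lp_norm q (\<mu> 0) (T (of_real \<theta>) f) \<le>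
      ennreal (B0 powr (1 - \<theta>) * B1 powr \<theta> * enn2real (interp_const M0 M1 \<theta>) * (\<Prod>\<kappa>=1..m. R \<kappa>))"
    if R: "\<And>\<kappa>. \<kappa> \<in> {1..m} \<Longrightarrow> Lp_norm (p \<kappa>) (\<mu> \<kappa>) (f \<kappa>) < ennreal (R \<kappa>)" for R
  proof -
    have "\<forall>\<kappa>\<in>{1..m}. \<exists>(J :: int option set) u b A0 A1. finite J \<and> (\<forall>j\<in>J. u j \<in> Cc (X \<kappa>) \<and> b j holomorphic_on UNIV \<and>
        (\<exists>B. \<forall>z\<in>closure open_strip. norm (b j z) \<le> B)) \<and> 0 < A0 \<and> 0 < A1 \<and> A0 powr (1 - \<theta>) * A1 powr \<theta> \<le> R \<kappa> \<and>
      (\<forall>x. (\<Sum>j\<in>J. b j (of_real \<theta>) * u j x) = f \<kappa> x) \<and>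
      (\<forall>y. Lp_norm (p0 \<kappa>) (\<mu> \<kappa>) (\<lambda>x. \<Sum>j\<in>J. b j (\<i> * of_real y) * u j x) \<le> ennreal A0) \<and>
      (\<forall>y. Lp_norm (p1 \<kappa>) (\<mu> \<kappa>) (\<lambda>x. \<Sum>j\<in>J. b j (1 + \<i> * of_real y) * u j x) \<le> ennreal A1)"
      using test_function_deformation[OF mms \<theta> p(1,2) assms(11) fC R] by auto
    then obtain J :: "nat \<Rightarrow> int option set" and u b A0 A1 where
      all: "\<forall>\<kappa>\<in>{1..m}. finite (J \<kappa>) \<and> (\<forall>j\<in>J \<kappa>. u \<kappa> j \<in> Cc (X \<kappa>) \<and> b \<kappa> j holomorphic_on UNIV \<and>
        (\<exists>B. \<forall>z\<in>closure open_strip. norm (b \<kappa> j z) \<le> B)) \<and> 0 < A0 \<kappa> \<and> 0 < A1 \<kappa> \<and> A0 \<kappa> powr (1 - \<theta>) * A1 \<kappa> powr \<theta> \<le> R \<kappa> \<and>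
      (\<forall>x. (\<Sum>j\<in>J \<kappa>. b \<kappa> j (of_real \<theta>) * u \<kappa> j x) = f \<kappa> x) \<and>
      (\<forall>y. Lp_norm (p0 \<kappa>) (\<mu> \<kappa>) (\<lambda>x. \<Sum>j\<in>J \<kappa>. b \<kappa> j (\<i> * of_real y) * u \<kappa> j x) \<le> ennreal (A0 \<kappa>)) \<and>
      (\<forall>y. Lp_norm (p1 \<kappa>) (\<mu> \<kappa>) (\<lambda>x. \<Sum>j\<in>J \<kappa>. b \<kappa> j (1 + \<i> * of_real y) * u \<kappa> j x) \<le> ennreal (A1 \<kappa>))"
      by (simp only: bchoice_iff) blast
    have J: "finite (J \<kappa>)" "0 < A0 \<kappa>" "0 < A1 \<kappa>" "A0 \<kappa> powr (1 - \<theta>) * A1 \<kappa> powr \<theta> \<le> R \<kappa>"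
      "\<And>x. (\<Sum>j\<in>J \<kappa>. b \<kappa> j (of_real \<theta>) * u \<kappa> j x) = f \<kappa> x"
      "\<And>y. Lp_norm (p0 \<kappa>) (\<mu> \<kappa>) (\<lambda>x. \<Sum>j\<in>J \<kappa>. b \<kappa> j (\<i> * of_real y) * u \<kappa> j x) \<le> ennreal (A0 \<kappa>)"
      "\<And>y. Lp_norm (p1 \<kappa>) (\<mu> \<kappa>) (\<lambda>x. \<Sum>j\<in>J \<kappa>. b \<kappa> j (1 + \<i> * of_real y) * u \<kappa> j x) \<le> ennreal (A1 \<kappa>)"
      if "\<kappa> \<in> {1..m}" for \<kappa> using all that by blast+
    have ub: "u \<kappa> j \<in> Cc (X \<kappa>)" "b \<kappa> j holomorphic_on UNIV" "\<exists>B. \<forall>z\<in>closure open_strip. norm (b \<kappa> j z) \<le> B"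
      if "\<kappa> \<in> {1..m}" "j \<in> J \<kappa>" for \<kappa> j using all that by blast+
    define \<Phi> where "\<Phi> z = (\<lambda>\<kappa>. if \<kappa> \<in> {1..m} then (\<lambda>t. \<Sum>j\<in>J \<kappa>. b \<kappa> j z * u \<kappa> j t) else f \<kappa>)" for z
    have \<Phi>: "\<Phi> z \<in> Cc_tuples m X" for z
      using f J(1) ub(1) by (auto simp: \<Phi>_def Cc_tuples_def PiE_iff extensional_def intro!: Cc_sum)
    have \<Phi>\<theta>: "\<Phi> (of_real \<theta>) = f" using J(5) by (auto simp: \<Phi>_def fun_eq_iff)
    have G\<Phi>: "tame_family (X 0) (\<mu> 0) \<gamma> (\<lambda>z. T z (\<Phi> z))"
      unfolding \<Phi>_def by (rule tame_family_deformed[OF mms0 \<gamma>(1) assms(3) tame J(1) ub _ f]) auto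
    define a0 a1 where "a0 = B0 * (\<Prod>\<kappa>=1..m. A0 \<kappa>)" and "a1 = B1 * (\<Prod>\<kappa>=1..m. A1 \<kappa>)"
    have a: "0 < a0" "0 < a1" using assms(13,14) J(2,3) by (auto simp: a0_def a1_def intro!: mult_pos_pos prod_pos)
    \<comment> \<open>This scalar factor has modulus \<open>1 / a0\<close> and \<open>1 / a1\<close> on the two edges and normalises
      the edge bounds to \<open>M0\<close> and \<open>M1\<close>.\<close>
    define k where "k z = exp (- ((1 - z) * of_real (ln a0) + z * of_real (ln a1)))" for z :: complex
    have nk: "norm (k z) = exp (- ((1 - Re z) * ln a0 + Re z * ln a1))" for z by (simp add: k_def)
    have kh: "k holomorphic_on UNIV" unfolding k_def by (intro holomorphic_intros)
    have kb: "norm (k z) \<le> exp (\<bar>ln a0\<bar> + \<bar>ln a1\<bar>)" if z: "z \<in> closure open_strip" for z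
    proof -
      have zz: "0 \<le> Re z" "Re z \<le> 1" using z by (auto simp: closure_open_strip)
      have "- ((1 - Re z) * ln a0) \<le> \<bar>(1 - Re z) * ln a0\<bar>" "- (Re z * ln a1) \<le> \<bar>Re z * ln a1\<bar>" by simp_all
      moreover have "\<bar>(1 - Re z) * ln a0\<bar> \<le> 1 * \<bar>ln a0\<bar>" "\<bar>Re z * ln a1\<bar> \<le> 1 * \<bar>ln a1\<bar>"
        unfolding abs_mult using zz by (intro mult_right_mono; simp)+
      ultimately show ?thesis unfolding nk by simp
    qed
    have GG: "tame_family (X 0) (\<mu> 0) \<gamma> (\<lambda>z x. k z * T z (\<Phi> z) x + 0 * T z (\<Phi> z) x)"
      by (rule tame_family_combine[OF mms0 \<gamma>(1) G\<Phi> G\<Phi> kh kb, where B = 0]) auto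
    have Tm: "T z (\<Phi> z) \<in> borel_measurable (\<mu> 0)" if "z \<in> closure open_strip" for z
      using G\<Phi> that by (auto simp: tame_family_def L1_loc_def)
    have edge: "\<i> * of_real y \<in> closure open_strip" "1 + \<i> * of_real y \<in> closure open_strip" "of_real \<theta> \<in> closure open_strip" for y
      using \<theta> by (auto simp: closure_open_strip)
    have E: "Lp_norm qq (\<mu> 0) (\<lambda>x. k z * T z (\<Phi> z) x) \<le> ennreal N"
      if "0 < qq" and z: "z \<in> closure open_strip" and nkz: "norm (k z) * (B * (\<Prod>\<kappa>=1..m. A \<kappa>)) = 1" and "0 < B" "0 \<le> N"
        and A: "\<And>\<kappa>. \<kappa> \<in> {1..m} \<Longrightarrow> 0 < A \<kappa>" "\<And>\<kappa>. \<kappa> \<in> {1..m} \<Longrightarrow> Lp_norm (pp \<kappa>) (\<mu> \<kappa>) (\<Phi> z \<kappa>) \<le> ennreal (A \<kappa>)"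
        and le: "Lp_norm qq (\<mu> 0) (T z (\<Phi> z)) \<le> ennreal (B * N) * (\<Prod>\<kappa>=1..m. Lp_norm (pp \<kappa>) (\<mu> \<kappa>) (\<Phi> z \<kappa>))"
      for qq pp z N B and A :: "nat \<Rightarrow> real"
    proof -
      have PA: "0 \<le> (\<Prod>\<kappa>=1..m. A \<kappa>)" by (intro prod_nonneg ballI less_imp_le[OF A(1)])
      note le
      also have "(\<Prod>\<kappa>=1..m. Lp_norm (pp \<kappa>) (\<mu> \<kappa>) (\<Phi> z \<kappa>)) \<le> (\<Prod>\<kappa>=1..m. ennreal (A \<kappa>))"
        by (intro prod_mono_ennreal A(2))
      also have "\<dots> = ennreal (\<Prod>\<kappa>=1..m. A \<kappa>)" using A(1) by (intro prod_ennreal) (auto intro: less_imp_le)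
      also have "ennreal (B * N) * \<dots> = ennreal (B * (\<Prod>\<kappa>=1..m. A \<kappa>) * N)"
        using \<open>0 < B\<close> \<open>0 \<le> N\<close> PA by (subst ennreal_mult[symmetric]) (simp_all add: mult_ac)
      finally have "Lp_norm qq (\<mu> 0) (T z (\<Phi> z)) \<le> ennreal (B * (\<Prod>\<kappa>=1..m. A \<kappa>) * N)" by (simp add: mult_left_mono)
      from Lp_norm_scale_le[OF \<open>0 < qq\<close> Tm[OF z] _ this, of "k z"]
      show ?thesis using \<open>0 < B\<close> \<open>0 \<le> N\<close> PA nkz by (simp add: mult.assoc[symmetric])
    qed
    have nk1: "norm (k (\<i> * of_real y)) * (B0 * (\<Prod>\<kappa>=1..m. A0 \<kappa>)) = 1"
      "norm (k (1 + \<i> * of_real y)) * (B1 * (\<Prod>\<kappa>=1..m. A1 \<kappa>)) = 1" for y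
      unfolding a0_def[symmetric] a1_def[symmetric] nk using a by (simp_all add: exp_minus)
    have E0: "Lp_norm q0 (\<mu> 0) (\<lambda>x. k (\<i> * of_real y) * T (\<i> * of_real y) (\<Phi> (\<i> * of_real y)) x) \<le> ennreal (M0 y)" for y
      by (rule E[OF assms(7) edge(1) nk1(1) assms(13) M0(2) J(2) _ assms(24)[OF \<Phi>]])
         (use J(6) in \<open>auto simp: \<Phi>_def\<close>)
    have E1: "Lp_norm q1 (\<mu> 0) (\<lambda>x. k (1 + \<i> * of_real y) * T (1 + \<i> * of_real y) (\<Phi> (1 + \<i> * of_real y)) x) \<le> ennreal (M1 y)" for y
      by (rule E[OF assms(8) edge(2) nk1(2) assms(14) M1(2) J(3) _ assms(25)[OF \<Phi>]])
         (use J(7) in \<open>auto simp: \<Phi>_def\<close>)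
    have main: "Lp_norm q (\<mu> 0) (\<lambda>x. k (of_real \<theta>) * T (of_real \<theta>) f x) \<le> ennreal (enn2real (interp_const M0 M1 \<theta>))"
      using tame_family_interpolation[OF mms0 \<gamma> GG \<theta> assms(7,8,12) \<tau> c M0 M1] E0 E1 Ifin
      by (simp add: \<Phi>\<theta>)
    have k\<theta>: "norm (inverse (k (of_real \<theta>))) = a0 powr (1 - \<theta>) * a1 powr \<theta>"
      unfolding norm_inverse nk using a by (simp add: powr_def exp_minus[symmetric] exp_add[symmetric])
    have "Lp_norm q (\<mu> 0) (\<lambda>x. inverse (k (of_real \<theta>)) * (k (of_real \<theta>) * T (of_real \<theta>) f x)) \<le>
      ennreal (norm (inverse (k (of_real \<theta>))) * enn2real (interp_const M0 M1 \<theta>))"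
      by (rule Lp_norm_scale_le[OF q _ _ main]) (use Tm[OF edge(3)] in \<open>auto simp: \<Phi>\<theta>\<close>)
    also have "(\<lambda>x. inverse (k (of_real \<theta>)) * (k (of_real \<theta>) * T (of_real \<theta>) f x)) = T (of_real \<theta>) f"
      by (auto simp: k_def)
    finally have "Lp_norm q (\<mu> 0) (T (of_real \<theta>) f) \<le> ennreal (a0 powr (1 - \<theta>) * a1 powr \<theta> * enn2real (interp_const M0 M1 \<theta>))"
      by (simp only: k\<theta>)
    also have "\<dots> \<le> ennreal (B0 powr (1 - \<theta>) * B1 powr \<theta> * enn2real (interp_const M0 M1 \<theta>) * (\<Prod>\<kappa>=1..m. R \<kappa>))"
    proof (rule ennreal_leI)
      have "a0 powr (1 - \<theta>) * a1 powr \<theta> = B0 powr (1 - \<theta>) * B1 powr \<theta> * (\<Prod>\<kappa>=1..m. A0 \<kappa> powr (1 - \<theta>) * A1 \<kappa> powr \<theta>)"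
        by (simp add: a0_def a1_def powr_mult prod_powr_distrib prod.distrib)
      also have "\<dots> \<le> B0 powr (1 - \<theta>) * B1 powr \<theta> * (\<Prod>\<kappa>=1..m. R \<kappa>)"
        using J(4) by (intro mult_left_mono prod_mono) auto
      finally have "a0 powr (1 - \<theta>) * a1 powr \<theta> * enn2real (interp_const M0 M1 \<theta>) \<le> B0 powr (1 - \<theta>) * B1 powr \<theta> * (\<Prod>\<kappa>=1..m. R \<kappa>) * enn2real (interp_const M0 M1 \<theta>)"
        by (rule mult_right_mono) simp
      then show "a0 powr (1 - \<theta>) * a1 powr \<theta> * enn2real (interp_const M0 M1 \<theta>) \<le> B0 powr (1 - \<theta>) * B1 powr \<theta> * enn2real (interp_const M0 M1 \<theta>) * (\<Prod>\<kappa>=1..m. R \<kappa>)"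
        by (simp add: mult_ac)
    qed
    finally show ?thesis .
  qed
  define nm where "nm \<kappa> = enn2real (Lp_norm (p \<kappa>) (\<mu> \<kappa>) (f \<kappa>))" for \<kappa>
  have nm: "Lp_norm (p \<kappa>) (\<mu> \<kappa>) (f \<kappa>) = ennreal (nm \<kappa>)" if \<kappa>: "\<kappa> \<in> {1..m}" for \<kappa>
    using Cc_Lp_norm_finite[OF mms p(3)[OF \<kappa>] fC[OF \<kappa>]] \<kappa> by (simp add: nm_def)
  have nm0: "0 \<le> nm \<kappa>" for \<kappa> by (simp add: nm_def)
  define S where "S = B0 powr (1 - \<theta>) * B1 powr \<theta> * enn2real (interp_const M0 M1 \<theta>)"
  have S0: "0 \<le> S" by (simp add: S_def)
  \<comment> \<open>The strict upper bounds \<open>R \<kappa>\<close> of the norms decrease to the norms.\<close>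
  have "(\<lambda>n. ennreal (S * (\<Prod>\<kappa>=1..m. nm \<kappa> + 1 / (real n + 1)))) \<longlonglongrightarrow> ennreal (S * (\<Prod>\<kappa>=1..m. nm \<kappa> + 0))"
    by (intro tendsto_ennrealI tendsto_mult tendsto_const tendsto_prod tendsto_add) real_asymp
  moreover have "Lp_norm q (\<mu> 0) (T (of_real \<theta>) f) \<le> ennreal (S * (\<Prod>\<kappa>=1..m. nm \<kappa> + 1 / (real n + 1)))" for n
    unfolding S_def by (rule key) (use nm nm0 in \<open>auto simp: ennreal_less_iff\<close>)
  ultimately have "Lp_norm q (\<mu> 0) (T (of_real \<theta>) f) \<le> ennreal (S * (\<Prod>\<kappa>=1..m. nm \<kappa> + 0))"
    by (intro LIMSEQ_le_const) auto
  also have "\<dots> = ennreal S * (\<Prod>\<kappa>=1..m. ennreal (nm \<kappa>))"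
    using S0 nm0 by (simp add: ennreal_mult prod_nonneg prod_ennreal)
  also have "(\<Prod>\<kappa>=1..m. ennreal (nm \<kappa>)) = (\<Prod>\<kappa>=1..m. Lp_norm (p \<kappa>) (\<mu> \<kappa>) (f \<kappa>))"
    using nm by (intro prod.cong) auto
  also have "ennreal S = ennreal (B0 powr (1 - \<theta>) * B1 powr \<theta>) * interp_const M0 M1 \<theta>"
    using Ifin by (simp add: S_def ennreal_mult)
  finally show "Lp_norm q (\<mu> 0) (T (of_real \<theta>) f) \<le> ennreal (B0 powr (1 - \<theta>) * B1 powr \<theta>) * interp_const M0 M1 \<theta> *
               (\<Prod>\<kappa>=1..m. Lp_norm (p \<kappa>) (\<mu> \<kappa>) (f \<kappa>))" .
qed

end
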